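(* Let $d\ge2$, let $\kappa=(\kappa_1,\dots,\kappa_d)$ with all $\kappa_i\ge0$, let $\alpha_\kappa=|\kappa|+\frac{d-2}{2}$, let $n\in\mathbb{N}_0$, and let $(x,t),(y,s)\in\mathbb{V}_0^{d+1}$. If $\alpha_\kappa>0$, then $$\mathsf{P}_n(\mathsf{w}_\kappa;(x,t),(y,s))=C_\kappa\int_{[-1,1]^d}\int_0^\pi L_n^{2\alpha_\kappa}\big(t+s+2\rho(x,t,y,s;u)\cos\theta\big)\,e^{-\rho(x,t,y,s;u)\cos\theta}\,j_{\alpha_\kappa-1}\big(\rho(x,t,y,s;u)\sin\theta\big)(\sin\theta)^{2\alpha_\kappa-1}\,d\theta\,\Phi_\kappa(u)\,du,$$ where $C_\kappa=\frac{2^{\alpha_\kappa-1}\Gamma(\alpha_\kappa+\frac12)}{\sqrt\pi}\,c_{\kappa-\frac{\mathbf 1}{2}}$. If $\alpha_\kappa=0$ (equivalently $d=2$ and $\kappa=0$), then, with $\rho=\rho(x,t,y,s)=\sqrt{\frac12(ts+\langle x,y\rangle)}$, $$\mathsf{P}_n(\mathsf{w}_0;(x,t),(y,s))=\tfrac12\Big[e^{-\rho}L_n^0(t+s+2\rho)+e^{\rho}L_n^0(t+s-2\rho)\Big]-\tfrac12\rho^2\int_0^\pi L_n^0(t+s+2\rho\cos\theta)\,e^{-\rho\cos\theta}\,j_1(\rho\sin\theta)\sin\theta\,d\theta.$$ In particular, for $d\ge2$ and $\alpha_\kappa\ge0$, $$\mathsf{P}_n(\mathsf{w}_\kappa;(x,t),(0,0))=L_n^{2|\kappa|+d-2}(t),\qquad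 (x,t)\in\mathbb{V}_0^{d+1}.$$
   Context: Notation: $|\kappa|=\kappa_1+\dots+\kappa_d$, $h_\kappa(x)=\prod_{i=1}^d|x_i|^{\kappa_i}$. The conic surface is $\mathbb{V}_0^{d+1}=\{(x,t)\in\mathbb{R}^d\times[0,\infty):\|x\|=t\}$ with measure $\sigma$ given by $\int_{\mathbb{V}_0^{d+1}}f\,d\sigma=\int_0^\infty t^{d-1}\int_{\mathbb{S}^{d-1}}f(t\xi,t)\,d\sigma_{\mathbb{S}}(\xi)\,dt$, where $d\sigma_{\mathbb S}$ is the surface measure of $\mathbb{S}^{d-1}$. The weight is $\mathsf{w}_\kappa(x,t)=h_\kappa^2(x)t^{-1}e^{-t}$ and the inner product is $\langle f,g\rangle_\kappa=\mathsf{b}_\kappa\int_{\mathbb{V}_0^{d+1}}fg\,\mathsf{w}_\kappa\,d\sigma$, with $\mathsf{b}_\kappa$ chosen so that $\langle 1,1\rangle_\kappa=1$. $\mathcal{V}_n(\mathbb{V}_0^{d+1},\mathsf{w}_\kappa)$ is the space of (restrictions to $\mathbb{V}_0^{d+1}$ of) polynomials in $(x,t)$ of degree at most $n$ that are orthogonal in $\langle\cdot,\cdot\rangle_\kappa$ to all polynomials of degree at most $n-1$, and $\mathsf{P}_n(\mathsf{w}_\kappa;\cdot,\cdot)$ is its reproducing kernel with respect to $\langle\cdot,\cdot\rangle_\kappa$. $L_n^\alpha$ is the Laguerre polynomial, $\sum_{n\ge0}L_n^\alpha(t)r^n=(1-r)^{-\alpha-1}e^{-tr/(1-r)}$. $j_\alpha(z)=z^{-\alpha}J_\alpha(z)$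 with $J_\alpha$ the Bessel function of the first kind (extended continuously to $z=0$). $c_\lambda=\frac{\Gamma(\lambda+1)}{\Gamma(\frac12)\Gamma(\lambda+\frac12)}$, $c_{\kappa-\frac{\mathbf 1}{2}}=\prod_{i=1}^d c_{\kappa_i-\frac12}$, $\Phi_\kappa(u)=\prod_{i=1}^d(1+u_i)(1-u_i^2)^{\kappa_i-1}$, $\rho(x,t,y,s;u)=\sqrt{\tfrac12(ts+x_1y_1u_1+\dots+x_dy_du_d)}$. Convention: if $\kappa_i=0$ for some $i$, the integral in $u_i$ is understood as the limit $\kappa_i\to0+$, i.e. $c_{\kappa_i-\frac12}\int_{-1}^1 f(u_i)(1+u_i)(1-u_i^2)^{\kappa_i-1}du_i$ is replaced by $f(1)$. *)

theory Defs
  imports "HOL-Probability.Probability"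
begin

section \<open>The conic surface\<close>

text \<open>
  The dimension \<open>d\<close> is \<open>CARD('d)\<close>; a point of \<open>\<real>\<^sup>d \<times> \<real>\<close> is a pair \<open>(x, t)\<close>.
\<close>

definition conic_surface :: "((real ^ 'd) \<times> real) set" where
  "conic_surface = {(x, t). 0 \<le> t \<and> norm x = t}"

text \<open>
  Surface measure of the unit sphere: \<open>\<sigma>(A) = d \<cdot> vol {r \<xi> | 0 < r \<le> 1, \<xi> \<in> A}\<close>.
  Note that \<open>sgn x = x / norm x\<close> in a normed space.
\<close>

definition sphere_measure :: "(real ^ 'd) measure" where
  "sphere_measure =
     scale_measure (ennreal (real CARD('d)))
       (distr (restrict_space lborel (cball 0 1 - {0})) (restrict_space borel (sphere 0 1)) sgn)"

definition cone_integral :: "((real ^ 'd) \<times> real \<Rightarrow> real) \<Rightarrow> real" where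
  "cone_integral f =
     (LINT t:{0..}|lborel.
        t ^ (CARD('d) - 1) * (LINT \<xi>|sphere_measure. f (t *\<^sub>R \<xi>, t)))"

section \<open>Weight and inner product\<close>

definition abs_mult :: "real ^ 'd \<Rightarrow> real" where
  "abs_mult \<kappa> = (\<Sum>i\<in>UNIV. \<kappa> $ i)"

definition alpha :: "real ^ 'd \<Rightarrow> real" where
  "alpha \<kappa> = abs_mult \<kappa> + (real CARD('d) - 2) / 2"

text \<open>
  The case distinction is needed because \<open>0 powr 0 = 0\<close>, whereas \<open>\<bar>x\<^sub>i\<bar>\<^sup>0 = 1\<close> is meant.
\<close>

definition h_weight :: "real ^ 'd \<Rightarrow> real ^ 'd \<Rightarrow> real" where
  "h_weight \<kappa> x = (\<Prod>i\<in>UNIV. if \<kappa> $ i = 0 then 1 else \<bar>x $ i\<bar> powr (\<kappa> $ i))"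

definition cone_weight :: "real ^ 'd \<Rightarrow> (real ^ 'd) \<times> real \<Rightarrow> real" where
  "cone_weight \<kappa> = (\<lambda>(x, t). (h_weight \<kappa> x)\<^sup>2 * inverse t * exp (- t))"

definition norm_const :: "real ^ 'd \<Rightarrow> real" where
  "norm_const \<kappa> = 1 / cone_integral (cone_weight \<kappa>)"

definition cone_inner ::
  "real ^ 'd \<Rightarrow> ((real ^ 'd) \<times> real \<Rightarrow> real) \<Rightarrow> ((real ^ 'd) \<times> real \<Rightarrow> real) \<Rightarrow> real" where
  "cone_inner \<kappa> f g = norm_const \<kappa> * cone_integral (\<lambda>z. f z * g z * cone_weight \<kappa> z)"

section \<open>Orthogonal polynomials and the reproducing kernel\<close>

definition exponents :: "nat \<Rightarrow> (('d::finite \<Rightarrow> nat) \<times> nat) set" where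
  "exponents n = {(m, k). (\<Sum>i\<in>UNIV. m i) + k \<le> n}"

lemma finite_exponents: "finite (exponents n :: (('d::finite \<Rightarrow> nat) \<times> nat) set)"
proof (rule finite_subset)
  show "exponents n \<subseteq> (UNIV \<rightarrow>\<^sub>E {..n}) \<times> {..n :: nat}"
    unfolding exponents_def
    by (auto simp: PiE_def Pi_def) (meson add_leD1 finite member_le_sum order_trans UNIV_I zero_le)
qed (auto intro!: finite_PiE)

definition polys_upto :: "nat \<Rightarrow> ((real ^ 'd) \<times> real \<Rightarrow> real) set" where
  "polys_upto n =
     {f. \<exists>c. \<forall>x t. f (x, t) =
           (\<Sum>(m, k)\<in>exponents n. c m k * (\<Prod>i\<in>UNIV. (x $ i) ^ m i) * t ^ k)}"

text \<open>
  Quantifying over all \<open>m < n\<close> (rather than writing \<open>n - 1\<close>) makes the orthogonality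
  condition vacuous for \<open>n = 0\<close>.
  Functions on the cone are represented as extensional functions on \<open>conic_surface\<close>.
\<close>

definition orth_space :: "real ^ 'd \<Rightarrow> nat \<Rightarrow> ((real ^ 'd) \<times> real \<Rightarrow> real) set" where
  "orth_space \<kappa> n =
     {restrict f conic_surface | f. f \<in> polys_upto n \<and>
        (\<forall>m<n. \<forall>g\<in>polys_upto m. cone_inner \<kappa> f g = 0)}"

definition is_reproducing_kernel ::
  "'a set \<Rightarrow> ('a \<Rightarrow> real) set \<Rightarrow> (('a \<Rightarrow> real) \<Rightarrow> ('a \<Rightarrow> real) \<Rightarrow> real) \<Rightarrow> ('a \<times> 'a \<Rightarrow> real) \<Rightarrow> bool"
where
  "is_reproducing_kernel X V ip K \<longleftrightarrow>
     K \<in> extensional (X \<times> X) \<and>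
     (\<forall>q\<in>X. (\<lambda>p. K (p, q)) \<in> V \<and> (\<forall>f\<in>V. ip f (\<lambda>p. K (p, q)) = f q))"

definition kernel_P ::
  "real ^ 'd \<Rightarrow> nat \<Rightarrow> (real ^ 'd) \<times> real \<Rightarrow> (real ^ 'd) \<times> real \<Rightarrow> real" where
  "kernel_P \<kappa> n p q =
     (THE K. is_reproducing_kernel conic_surface (orth_space \<kappa> n) (cone_inner \<kappa>) K) (p, q)"

section \<open>Special functions\<close>

text \<open>
  Coefficient of \<open>r\<^sup>n\<close> in the formal power series \<open>(1 - r)\<^bsup>-a-1\<^esup> exp (- t r / (1 - r))\<close>;
  \<open>fps_binomial c\<close> is the binomial series \<open>(1 + r)\<^sup>c\<close>.
\<close>

definition laguerre :: "nat \<Rightarrow> real \<Rightarrow> real \<Rightarrow> real" where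
  "laguerre n a t =
     fps_nth ((fps_binomial (- a - 1) oo (- fps_X)) *
              (fps_exp (- t) oo (fps_X / (1 - fps_X)))) n"

text \<open>
  Both Bessel functions are meant for real \<open>z \<ge> 0\<close> only. The coefficient uses the entire
  function \<open>rGamma = 1 / \<Gamma>\<close>.
\<close>

definition bessel_J :: "real \<Rightarrow> real \<Rightarrow> real" where
  "bessel_J a z =
     (\<Sum>m. (- 1) ^ m / fact m * rGamma (real m + a + 1) * (z / 2) powr (2 * real m + a))"

definition bessel_j :: "real \<Rightarrow> real \<Rightarrow> real" where
  "bessel_j a z =
     (if z = 0 then Lim (at_right 0) (\<lambda>w. w powr (- a) * bessel_J a w)
      else z powr (- a) * bessel_J a z)"

section \<open>The integral over the cube\<close>

definition c_const :: "real \<Rightarrow> real" where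
  "c_const l = Gamma (l + 1) / (Gamma (1 / 2) * Gamma (l + 1 / 2))"

text \<open>
  Convention for \<open>\<kappa>\<^sub>i = 0\<close>: the operation
  \<open>c\<^bsub>\<kappa>\<^sub>i - 1/2\<^esub> \<integral> f(u\<^sub>i) (1 + u\<^sub>i) (1 - u\<^sub>i\<^sup>2)\<^bsup>\<kappa>\<^sub>i - 1\<^esup> du\<^sub>i\<close> is replaced by \<open>f(1)\<close>.
  It is implemented by dropping the \<open>i\<close>-th factor both from the constant and from \<open>\<Phi>\<^sub>\<kappa>\<close>,
  and by letting \<open>du\<^sub>i\<close> be the Dirac measure at \<open>1\<close>. For \<open>\<kappa>\<^sub>i > 0\<close> these are the factors
  themselves and \<open>du\<^sub>i\<close> is Lebesgue measure.
\<close>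

definition c_prod :: "real ^ 'd \<Rightarrow> real" where
  "c_prod \<kappa> = (\<Prod>i\<in>UNIV. if \<kappa> $ i = 0 then 1 else c_const (\<kappa> $ i - 1 / 2))"

definition Phi :: "real ^ 'd \<Rightarrow> ('d \<Rightarrow> real) \<Rightarrow> real" where
  "Phi \<kappa> u =
     (\<Prod>i\<in>UNIV. if \<kappa> $ i = 0 then 1 else (1 + u i) * (1 - (u i)\<^sup>2) powr (\<kappa> $ i - 1))"

definition du_measure :: "real ^ 'd \<Rightarrow> ('d \<Rightarrow> real) measure" where
  "du_measure \<kappa> = Pi\<^sub>M UNIV (\<lambda>i. if \<kappa> $ i = 0 then return lborel 1 else lborel)"

definition cube :: "('d \<Rightarrow> real) set" where
  "cube = {u. \<forall>i. u i \<in> {- 1..1}}"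

definition rho :: "real ^ 'd \<Rightarrow> real \<Rightarrow> real ^ 'd \<Rightarrow> real \<Rightarrow> ('d \<Rightarrow> real) \<Rightarrow> real" where
  "rho x t y s u = sqrt ((t * s + (\<Sum>i\<in>UNIV. x $ i * y $ i * u i)) / 2)"

definition C_const :: "real ^ 'd \<Rightarrow> real" where
  "C_const \<kappa> =
     2 powr (alpha \<kappa> - 1) * Gamma (alpha \<kappa> + 1 / 2) / sqrt pi * c_prod \<kappa>"

end

theory Submission
  imports Defs
begin

text \<open>
  Write \<open>a = alpha \<kappa>\<close> and \<open>w = r / (1 - r)\<close>. Summing the claimed kernels \<open>K\<^sub>n(p, q)\<close>, \<open>p = (x, t)\<close>,
  \<open>q = (y, s)\<close>, against \<open>r\<^sup>n\<close> gives
  \<open>(1 - r)\<^bsup>-2a-1\<^esup> exp (- (t + s) w) \<Sum>\<^sub>k (w + w\<^sup>2)\<^sup>k E\<^sub>u[((ts + \<Sum> x\<^sub>i y\<^sub>i u\<^sub>i) / 2)\<^sup>k] / (k! (a + 1/2)\<^sub>k)\<close>,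
  where \<open>E\<^sub>u\<close> is the normalized integral over the cube: the \<open>\<theta>\<close>-integral is expanded in powers of
  \<open>\<rho>\<close>, and \<open>\<Sum>\<^sub>n L\<^sub>n r\<^sup>n\<close> is an exponential in \<open>w\<close>. All moments of \<open>u\<close> and of the measure on the cone are
  explicit, so no theory of h-harmonics is needed. For a monomial \<open>g\<close> of degree \<open>N\<close> one finds that
  \<open>\<Sum>\<^sub>n \<langle>g, K\<^sub>n(\<cdot>, q)\<rangle> r\<^sup>n = (1 - r)\<^sup>N Q(w)\<close> for a polynomial \<open>Q\<close> of degree at most \<open>N\<close> whose coefficient of
  \<open>w\<^sup>N\<close> is \<open>g(q)\<close>. This is a polynomial in \<open>r\<close> of degree at most \<open>N\<close> with value \<open>g(q)\<close> at \<open>r = 1\<close>;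
  hence \<open>K\<^sub>n\<close> is orthogonal to all polynomials of degree less than \<open>n\<close>, and \<open>K\<^sub>0 + \<dots> + K\<^sub>N\<close> reproduces
  the polynomials of degree at most \<open>N\<close>.
\<close>

section \<open>Formal power series\<close>

unbundle no vec_syntax
unbundle fps_syntax

text \<open>Why \<open>Q\<close> has degree at most \<open>N\<close>: only exponents
  \<open>m\<close> with \<open>\<mu> + m\<close> even contribute to the sphere moments of a
  monomial, and for these every coordinatewise quotient of Pochhammer symbols is a polynomial in the
  summation index. Hence the moments have, up to one Pochhammer symbol in the denominator, the
  generating function \<open>exp (|y|^2 z / 4)\<close> times a polynomial in \<open>z\<close>. On
  the cone \<open>|y| = s\<close>; convolution with the powers of \<open>t s\<close> and Kummer's
  transformation, with \<open>z = w^2\<close>, turn this exponential into \<open>exp (s w)\<close>,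
  while the duplication formula turns the remaining Pochhammer quotients into polynomials in the
  index. The Laguerre generating function supplies the factor \<open>exp (- s w)\<close>, which
  cancels \<open>exp (s w)\<close> exactly. The integral over \<open>t\<close> produces a binomial
  series \<open>(1 + w) ^ (- c) = (1 - r) ^ c\<close>, and this is the origin of
  \<open>(1 - r) ^ N\<close>. The argument in \<open>r\<close> and \<open>w\<close> is formal,
  coefficient by coefficient; analysis enters only through the moments and through the expansion of
  the \<theta>-integral for fixed \<open>n\<close>.\<close>

definition multi_indices :: "nat \<Rightarrow> ('i::finite \<Rightarrow> nat) set" where
  "multi_indices n = {m. (sum m UNIV) = n}"

lemma finite_multi_indices [simp]: "finite (multi_indices n :: ('i::finite \<Rightarrow> nat) set)"
proof (rule finite_subset)
  show "multi_indices n \<subseteq> (UNIV \<rightarrow>\<^sub>E {..n} :: ('i \<Rightarrow> nat) set)"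
    unfolding multi_indices_def
    by (auto simp: PiE_def Pi_def intro: member_le_sum)
qed (auto intro!: finite_PiE)

lemma fps_nth_prod_multi_indices:
  fixes F :: "'i::finite \<Rightarrow> 'a::comm_semiring_1 fps"
  shows "(\<Prod>i\<in>UNIV. F i) $ n = (\<Sum>m\<in>multi_indices n. \<Prod>i\<in>UNIV. F i $ m i)"
proof -
  \<comment> \<open>Index functions vanish outside \<open>A\<close>, so that splitting off one
    factor of the product is the update \<open>m(a := j)\<close> and a bijection results.\<close>
  define I :: "'i set \<Rightarrow> nat \<Rightarrow> ('i \<Rightarrow> nat) set"
    where "I A n = {m. (\<forall>i. i \<notin> A \<longrightarrow> m i = 0) \<and> (\<Sum>i\<in>A. m i) = n}" for A n
  have fin: "finite (I A n)" for A n
  proof (rule finite_subset)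
    show "I A n \<subseteq> (UNIV \<rightarrow>\<^sub>E {..n})"
      unfolding I_def PiE_def Pi_def
      by auto (metis finite_code le0 member_le_sum)
  qed (auto intro!: finite_PiE)
  have "(\<Prod>i\<in>A. F i) $ n = (\<Sum>m\<in>I A n. \<Prod>i\<in>A. F i $ m i)" if "finite A" for A n
    using that
  proof (induction A arbitrary: n rule: finite_induct)
    case empty
    have "I {} n = (if n = 0 then {\<lambda>_. 0} else {})"
      by (auto simp: I_def)
    then show ?case by auto
  next
    case (insert a A)
    have "(\<Prod>i\<in>insert a A. F i) $ n = (\<Sum>j=0..n. F a $ j * (\<Sum>m\<in>I A (n-j). \<Prod>i\<in>A. F i $ m i))"
      using insert by (simp add: fps_mult_nth)
    also have "\<dots> = (\<Sum>(j,m)\<in>(SIGMA j:{0..n}. I A (n-j)). F a $ j * (\<Prod>i\<in>A. F i $ m i))"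
      by (simp add: sum_distrib_left sum.Sigma fin)
    also have "\<dots> = (\<Sum>m\<in>I (insert a A) n. \<Prod>i\<in>insert a A. F i $ m i)"
    proof (rule sum.reindex_bij_witness[where j="\<lambda>(j,m). m(a:=j)" and i="\<lambda>m. (m a, m(a:=0))"], goal_cases)
      case (1 p)
      then show ?case using insert.hyps by (auto simp: I_def fun_eq_iff)
    next
      case (2 p)
      obtain j m where p: "p = (j, m)" by (cases p)
      have "(\<Sum>i\<in>A. m i) = (\<Sum>i\<in>A. (m(a := j)) i)"
        using insert.hyps by (intro sum.cong) auto
      moreover have "j + (\<Sum>i\<in>A. m i) = n" using 2 by (auto simp: I_def p)
      ultimately show ?case using 2 insert.hyps by (auto simp: I_def p)
    next
      case (3 m)
      then show ?case by auto
    next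
      case (4 m)
      have "(\<Sum>i\<in>A. m i) = (\<Sum>i\<in>A. (m(a := 0)) i)"
        using insert.hyps by (intro sum.cong) auto
      with 4 show ?case using insert.hyps by (auto simp: I_def)
    next
      case (5 p)
      have "(\<Prod>i\<in>A. F i $ (snd p) i) = (\<Prod>i\<in>A. F i $ ((snd p)(a := fst p)) i)"
        using insert.hyps by (intro prod.cong) auto
      then show ?case using insert.hyps by (simp add: case_prod_unfold)
    qed
    finally show ?case .
  qed
  from this[of UNIV n] show ?thesis by (simp add: I_def multi_indices_def)
qed

section \<open>Exponentials times polynomials\<close>

text \<open>\<open>q\<close> is the coefficient at \<open>N\<close> and may be zero, so
  \<open>N\<close> only bounds the degree of \<open>Q\<close>. Both the exponent and this
  coefficient are tracked: the first has to cancel later, the second becomes the reproduced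
  value.\<close>

definition exp_poly :: "real \<Rightarrow> nat \<Rightarrow> real \<Rightarrow> real fps \<Rightarrow> bool" where
  "exp_poly s N q F \<longleftrightarrow> (\<exists>Q. F = fps_exp s * Q \<and> (\<forall>i>N. Q $ i = 0) \<and> Q $ N = q)"

lemma exp_polyI: "F = fps_exp s * Q \<Longrightarrow> (\<And>i. i > N \<Longrightarrow> Q $ i = 0) \<Longrightarrow> Q $ N = q \<Longrightarrow> exp_poly s N q F"
  unfolding exp_poly_def by blast

lemma exp_polyE:
  assumes "exp_poly s N q F"
  obtains Q where "F = fps_exp s * Q" "\<And>i. i > N \<Longrightarrow> Q $ i = 0" "Q $ N = q"
  using assms unfolding exp_poly_def by blast

lemma exp_poly_exp: "exp_poly s 0 1 (fps_exp s)"
  by (rule exp_polyI[where Q=1]) auto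

lemma exp_poly_mult:
  assumes "exp_poly s N q F" "exp_poly s' N' q' F'"
  shows "exp_poly (s + s') (N + N') (q * q') (F * F')"
proof -
  obtain Q where Q: "F = fps_exp s * Q" "\<And>i. i > N \<Longrightarrow> Q $ i = 0" "Q $ N = q"
    using assms(1) exp_polyE by blast
  obtain Q' where Q': "F' = fps_exp s' * Q'" "\<And>i. i > N' \<Longrightarrow> Q' $ i = 0" "Q' $ N' = q'"
    using assms(2) exp_polyE by blast
  show ?thesis
  proof (rule exp_polyI[where Q="Q * Q'"])
    show "F * F' = fps_exp (s + s') * (Q * Q')"
      by (simp add: Q(1) Q'(1) fps_exp_add_mult mult_ac)
    show "(Q * Q') $ i = 0" if "i > N + N'" for i
      unfolding fps_mult_nth
    proof (rule sum.neutral, rule ballI)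
      fix j assume "j \<in> {0..i}"
      then have "j > N \<or> i - j > N'" using that by auto
      then show "Q $ j * Q' $ (i - j) = 0" using Q(2) Q'(2) by auto
    qed
    have "(Q * Q') $ (N + N') = (\<Sum>j\<in>{N}. Q $ j * Q' $ (N + N' - j))"
      unfolding fps_mult_nth
    proof (rule sum.mono_neutral_right)
      show "\<forall>i\<in>{0..N + N'} - {N}. Q $ i * Q' $ (N + N' - i) = 0"
      proof
        fix j assume "j \<in> {0..N + N'} - {N}"
        then have "j > N \<or> N + N' - j > N'" by auto
        then show "Q $ j * Q' $ (N + N' - j) = 0" using Q(2) Q'(2) by auto
      qed
    qed auto
    then show "(Q * Q') $ (N + N') = q * q'" using Q(3) Q'(3) by simp
  qed
qed

lemma exp_poly_prod:
  assumes "finite A" "\<And>i. i \<in> A \<Longrightarrow> exp_poly (s i) (N i) (q i) (F i)"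
  shows "exp_poly (\<Sum>i\<in>A. s i) (\<Sum>i\<in>A. N i) (\<Prod>i\<in>A. q i) (\<Prod>i\<in>A. F i)"
  using assms
proof (induction A rule: finite_induct)
  case empty
  then show ?case using exp_poly_exp[of 0] by simp
next
  case (insert a A)
  then show ?case by (simp add: exp_poly_mult)
qed

lemma exp_poly_X_power:
  assumes "exp_poly s N q F"
  shows "exp_poly s (N + m) q (fps_X ^ m * F)"
proof -
  obtain Q where Q: "F = fps_exp s * Q" "\<And>i. i > N \<Longrightarrow> Q $ i = 0" "Q $ N = q"
    using assms(1) exp_polyE by blast
  show ?thesis
    by (rule exp_polyI[where Q="fps_X ^ m * Q"])
      (simp_all add: Q mult.left_commute fps_X_power_mult_nth)
qed

text \<open>Lets summands of lower degree enter \<open>exp_poly_sum\<close> with leading coefficient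
  zero.\<close>

lemma exp_poly_degree_mono:
  assumes "exp_poly s N q F" "N < M"
  shows "exp_poly s M 0 F"
  using assms unfolding exp_poly_def by (metis less_trans)

lemma exp_poly_sum:
  assumes "finite I" "\<And>i. i \<in> I \<Longrightarrow> exp_poly s N (q i) (F i)"
  shows "exp_poly s N (\<Sum>i\<in>I. q i) (\<Sum>i\<in>I. F i)"
proof -
  have "\<forall>i\<in>I. \<exists>Q. F i = fps_exp s * Q \<and> (\<forall>j>N. Q $ j = 0) \<and> Q $ N = q i"
    using assms(2) unfolding exp_poly_def by blast
  then obtain Q where Q: "\<And>i. i \<in> I \<Longrightarrow> F i = fps_exp s * Q i \<and> (\<forall>j>N. Q i $ j = 0) \<and> Q i $ N = q i"
    by metis
  show ?thesis
    by (rule exp_polyI[where Q="\<Sum>i\<in>I. Q i"])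
      (auto simp: Q sum_distrib_left fps_sum_nth)
qed

lemma exp_poly_cmult:
  assumes "exp_poly s N q F"
  shows "exp_poly s N (c * q) (fps_const c * F)"
proof -
  obtain Q where Q: "F = fps_exp s * Q" "\<And>i. i > N \<Longrightarrow> Q $ i = 0" "Q $ N = q"
    using assms(1) exp_polyE by blast
  show ?thesis
    by (rule exp_polyI[where Q="fps_const c * Q"]) (auto simp: Q(1) mult_ac Q(2,3))
qed

text \<open>The factor \<open>c + k\<close> on the coefficients is the operator
  \<open>c + X d/dX\<close>. Differentiating \<open>exp (s X)\<close> brings down \<open>s\<close>,
  and the factor \<open>X\<close> raises the degree by one; the other terms do not exceed degree
  \<open>N\<close>.\<close>

lemma exp_poly_linear:
  assumes "exp_poly s N q F"
  shows "exp_poly s (Suc N) (s * q) (Abs_fps (\<lambda>k. (c + of_nat k) * F $ k))"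
proof -
  obtain Q where Q: "F = fps_exp s * Q" "\<And>i. i > N \<Longrightarrow> Q $ i = 0" "Q $ N = q"
    using assms(1) exp_polyE by blast
  have *: "Abs_fps (\<lambda>k. (c + of_nat k) * F $ k) = fps_const c * F + fps_X * fps_deriv F"
    by (rule fps_ext) (auto simp: algebra_simps fps_X_mult_nth)
  show ?thesis unfolding *
  proof (rule exp_polyI[where Q="fps_const c * Q + fps_const s * (fps_X * Q) + fps_X * fps_deriv Q"])
    show "fps_const c * F + fps_X * fps_deriv F =
       fps_exp s * (fps_const c * Q + fps_const s * (fps_X * Q) + fps_X * fps_deriv Q)"
      by (simp add: Q(1) algebra_simps)
  qed (auto simp: Q(2,3) fps_X_mult_nth)
qed

text \<open>A Pochhammer symbol of length \<open>a\<close> in the index is a product of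
  \<open>a\<close> linear factors, so \<open>exp_poly_linear\<close> is iterated.\<close>

lemma exp_poly_pochhammer:
  assumes "exp_poly s N q F"
  shows "exp_poly s (N + a) (s ^ a * q) (Abs_fps (\<lambda>k. pochhammer (c + of_nat k) a * F $ k))"
proof (induction a)
  case 0
  then show ?case using assms by (simp add: fps_nth_inverse)
next
  case (Suc a)
  have *: "Abs_fps (\<lambda>k. pochhammer (c + of_nat k) (Suc a) * F $ k) =
    Abs_fps (\<lambda>k. ((c + of_nat a) + of_nat k) * Abs_fps (\<lambda>k. pochhammer (c + of_nat k) a * F $ k) $ k)"
    by (rule fps_ext) (simp add: pochhammer_Suc algebra_simps)
  show ?case unfolding * using exp_poly_linear[OF Suc, of "c + of_nat a"] by (simp add: mult.assoc)
qed

section \<open>Powers of 1 - X and the substitution w = X / (1 - X)\<close>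

definition one_minus_X_powr :: "real \<Rightarrow> real fps" where
  "one_minus_X_powr c = fps_binomial c oo (- fps_X)"

abbreviation geo_fps :: "real fps" where
  "geo_fps \<equiv> fps_X / (1 - fps_X)"

lemma one_minus_X_powr_add: "one_minus_X_powr (c + d) = one_minus_X_powr c * one_minus_X_powr d"
  by (simp add: one_minus_X_powr_def fps_binomial_add_mult fps_compose_mult_distrib)

lemma one_minus_X_powr_0 [simp]: "one_minus_X_powr 0 = 1"
  by (simp add: one_minus_X_powr_def)

lemma one_minus_X_powr_1: "one_minus_X_powr 1 = 1 - fps_X"
  by (simp add: one_minus_X_powr_def fps_binomial_1 fps_compose_add_distrib)

lemma one_minus_X_powr_of_nat: "one_minus_X_powr (of_nat n) = (1 - fps_X) ^ n"
  by (induction n) (simp_all add: one_minus_X_powr_add one_minus_X_powr_1)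

lemma geo_fps_altdef: "geo_fps = fps_X * one_minus_X_powr (-1)"
proof -
  have "(1 - fps_X) * one_minus_X_powr (-1) = 1"
    using one_minus_X_powr_add[of 1 "-1"] by (simp add: one_minus_X_powr_1)
  then have "inverse (1 - fps_X) = one_minus_X_powr (-1)"
    by (metis fps_inverse_unique)
  then show ?thesis by (simp add: fps_divide_unit)
qed

lemma geo_fps_0 [simp]: "geo_fps $ 0 = 0"
  by (simp add: geo_fps_altdef)

lemma geo_fps_power: "geo_fps ^ k = fps_X ^ k * one_minus_X_powr (- of_nat k)"
proof (induction k)
  case (Suc k)
  have "- of_nat (Suc k) = (-1) + (- of_nat k :: real)" by simp
  then have "one_minus_X_powr (- of_nat (Suc k)) = one_minus_X_powr (-1) * one_minus_X_powr (- of_nat k)"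
    by (simp only: one_minus_X_powr_add)
  with Suc show ?case
    by (simp only: power_Suc geo_fps_altdef) (simp only: mult_ac)
qed simp

lemma geo_fps_power_nth: "i > n \<Longrightarrow> (geo_fps ^ i) $ n = 0"
  by (simp add: geo_fps_power fps_X_power_mult_nth)

lemma one_minus_X_powr_deriv:
  "(1 - fps_X) * fps_deriv (one_minus_X_powr c) = - fps_const c * one_minus_X_powr c"
proof -
  have "(1 + fps_X) * fps_deriv (fps_binomial c) = fps_const c * fps_binomial c"
    by (simp add: fps_binomial_deriv)
  then have "((1 + fps_X) * fps_deriv (fps_binomial c)) oo (-fps_X) = (fps_const c * fps_binomial c) oo (-fps_X)"
    by simp
  then show ?thesis
    by (simp add: fps_compose_mult_distrib fps_compose_add_distrib one_minus_X_powr_def fps_compose_deriv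
        fps_const_neg[symmetric] del: fps_const_neg)
qed

text \<open>Since \<open>1 + w = 1 / (1 - X)\<close>, this is
  \<open>(1 + w) ^ d = (1 - X) ^ (- d)\<close>. For real \<open>d\<close> it is proved through the
  binomial differential equations: the product \<open>A\<close> has derivative zero and constant
  term one.\<close>

lemma fps_binomial_compose_geo: "fps_binomial d oo geo_fps = one_minus_X_powr (- d)"
proof -
  define A where "A = (fps_binomial d oo geo_fps) * one_minus_X_powr d"
  define J where "J = one_minus_X_powr (-1)"
  have J: "(1 - fps_X) * J = 1"
    using one_minus_X_powr_add[of 1 "-1"] by (simp add: one_minus_X_powr_1 J_def)
  have dJ: "(1 - fps_X) * fps_deriv J = J"
    using one_minus_X_powr_deriv[of "-1"] by (simp add: J_def)
  have w: "geo_fps = fps_X * J" by (simp add: geo_fps_altdef J_def)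
  define B where "B = fps_binomial d oo geo_fps"
  define B' where "B' = fps_deriv (fps_binomial d) oo geo_fps"
  have "((1 + fps_X) * fps_deriv (fps_binomial d)) oo geo_fps = (fps_const d * fps_binomial d) oo geo_fps"
    by (simp add: fps_binomial_deriv)
  then have 1: "(1 + geo_fps) * B' = fps_const d * B"
    by (simp add: fps_compose_mult_distrib fps_compose_add_distrib B_def B'_def)
  have 2: "fps_deriv B = B' * (J + fps_X * fps_deriv J)"
    unfolding B_def B'_def by (subst fps_compose_deriv) (simp_all add: w)
  have 3: "1 + geo_fps = J"
  proof -
    have "1 + fps_X * J = J" using J by (simp add: algebra_simps)
    then show ?thesis by (simp add: w)
  qed
  have "(1 - fps_X) * fps_deriv A =
     ((1 - fps_X) * J + fps_X * ((1 - fps_X) * fps_deriv J)) * B' * one_minus_X_powr d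
      + B * ((1 - fps_X) * fps_deriv (one_minus_X_powr d))"
    by (simp add: A_def B_def[symmetric] 2 algebra_simps)
  also have "\<dots> = ((1 + fps_X * J) * B' - fps_const d * B) * one_minus_X_powr d"
    by (simp only: J dJ one_minus_X_powr_deriv)
      (simp add: algebra_simps fps_const_neg[symmetric] del: fps_const_neg)
  also have "1 + fps_X * J = 1 + geo_fps" by (simp add: w)
  finally have "(1 - fps_X) * fps_deriv A = 0" using 1 by simp
  then have "J * ((1 - fps_X) * fps_deriv A) = 0" by simp
  then have "fps_deriv A = 0" using J by (metis mult.assoc mult.commute mult_1)
  then have "A = fps_const (A $ 0)" by simp
  also have "A $ 0 = 1" by (simp add: A_def one_minus_X_powr_def)
  finally have A1: "A = 1" by simp
  have "A * one_minus_X_powr (-d) = fps_binomial d oo geo_fps"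
    using one_minus_X_powr_add[of d "-d"] by (simp add: A_def mult.assoc)
  with A1 show ?thesis by simp
qed

lemma compose_geo_fps_nth: "(F oo geo_fps) $ n = (\<Sum>i\<le>n. F $ i * (geo_fps ^ i) $ n)"
  by (simp add: fps_compose_nth atLeast0AtMost)

lemma laguerre_altdef: "laguerre n a t = (one_minus_X_powr (- a - 1) * (fps_exp (- t) oo geo_fps)) $ n"
  by (simp add: laguerre_def one_minus_X_powr_def)

text \<open>The series with coefficients \<open>c $ n\<close> is the polynomial \<open>\<Sum>i\<le>N. Q\<^sub>i r\<^sup>i (1 - r)\<^sup>N\<^sup>-\<^sup>i\<close>; at \<open>r = 1\<close> only \<open>Q\<^sub>N\<close> survives.\<close>

lemma exp_poly_compose_geo:
  assumes "exp_poly s N q H"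
  defines "c \<equiv> one_minus_X_powr (of_nat N) * (fps_exp (- s) oo geo_fps) * (H oo geo_fps)"
  shows "n > N \<Longrightarrow> c $ n = 0" and "(\<Sum>n\<le>N. c $ n) = q"
proof -
  obtain Q where Q: "H = fps_exp s * Q" "\<And>i. i > N \<Longrightarrow> Q $ i = 0" "Q $ N = q"
    using assms(1) exp_polyE by blast
  have "c = one_minus_X_powr (of_nat N) * ((fps_exp (- s) * fps_exp s) * Q oo geo_fps)"
    by (simp add: c_def Q(1) fps_compose_mult_distrib mult_ac)
  also have "fps_exp (- s) * fps_exp s = (1 :: real fps)"
    by (simp add: fps_exp_add_mult[symmetric])
  also have "1 * Q = (\<Sum>i\<le>N. fps_const (Q $ i) * fps_X ^ i)"
    by (rule fps_ext) (use Q(2) in \<open>auto simp: fps_sum_nth fps_X_power_nth if_distrib not_le cong: if_cong\<close>)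
  also have "(\<dots> oo geo_fps) = (\<Sum>i\<le>N. fps_const (Q $ i) * geo_fps ^ i)"
    by (simp add: fps_compose_sum_distrib fps_compose_mult_distrib fps_compose_power[symmetric])
  also have "one_minus_X_powr (of_nat N) * \<dots> = (\<Sum>i\<le>N. fps_const (Q $ i) * (fps_X ^ i * (1 - fps_X) ^ (N - i)))"
    unfolding sum_distrib_left
  proof (rule sum.cong)
    fix i assume "i \<in> {..N}"
    then have "one_minus_X_powr (of_nat N) * one_minus_X_powr (- of_nat i) = (1 - fps_X) ^ (N - i)"
      by (simp add: one_minus_X_powr_add[symmetric] one_minus_X_powr_of_nat[symmetric] of_nat_diff)
    then show "one_minus_X_powr (of_nat N) * (fps_const (Q $ i) * geo_fps ^ i)
      = fps_const (Q $ i) * (fps_X ^ i * (1 - fps_X) ^ (N - i))"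
      by (simp add: geo_fps_power mult_ac)
  qed auto
  finally have c: "c = (\<Sum>i\<le>N. fps_const (Q $ i) * (fps_X ^ i * (1 - fps_X) ^ (N - i)))" .
  \<comment> \<open>A genuine polynomial, so that the sum of the coefficients is its value at
    1.\<close>
  define P :: "real poly" where "P = (\<Sum>i\<le>N. smult (Q $ i) (monom 1 i * [:1, -1:] ^ (N - i)))"
  have X: "fps_of_poly [:1, -1 :: real:] = 1 - fps_X" by (simp add: fps_of_poly_pCons fps_eq_iff)
  have cP: "c = fps_of_poly P"
    by (simp add: c P_def fps_of_poly_sum fps_of_poly_smult fps_of_poly_mult fps_of_poly_monom fps_of_poly_power X)
  have deg: "degree P \<le> N"
    unfolding P_def
  proof (rule degree_sum_le)
    fix i assume "i \<in> {..N}"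
    have "degree (smult (Q $ i) (monom 1 i * [:1, -1:] ^ (N - i))) \<le> degree (monom 1 i * [:1, -1 :: real:] ^ (N - i))"
      by (rule degree_smult_le)
    also have "\<dots> \<le> degree (monom (1::real) i) + degree ([:1, -1 :: real:] ^ (N - i))"
      by (rule degree_mult_le)
    also have "\<dots> \<le> i + (N - i)"
      using degree_power_le[of "[:1, -1 :: real:]" "N - i"] by (simp add: degree_monom_eq)
    finally show "degree (smult (Q $ i) (monom 1 i * [:1, -1:] ^ (N - i))) \<le> N"
      using \<open>i \<in> {..N}\<close> by simp
  qed auto
  show "c $ n = 0" if "n > N"
    using that deg by (simp add: cP coeff_eq_0)
  have "(\<Sum>n\<le>N. c $ n) = (\<Sum>n\<le>degree P. coeff P n)"
    unfolding cP fps_of_poly_nth using deg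
    by (intro sum.mono_neutral_right) (auto simp: coeff_eq_0)
  also have "\<dots> = poly P 1" by (simp add: poly_altdef)
  also have "\<dots> = (\<Sum>i\<le>N. Q $ i * 0 ^ (N - i))"
    by (simp add: P_def poly_sum poly_monom poly_power)
  also have "\<dots> = (\<Sum>i\<in>{N}. Q $ i * 0 ^ (N - i))"
    by (rule sum.mono_neutral_right) (auto simp: power_0_left)
  finally show "(\<Sum>n\<le>N. c $ n) = q" using Q(3) by simp
qed

text \<open>Both sides are the Taylor coefficients of Kummer's \<open>\<^sub>1F\<^sub>1(c - 1/2; 2c - 1; 2z) = exp z \<cdot> \<^sub>0F\<^sub>1(c; z\<^sup>2/4)\<close>.
  The proof compares the recurrences that the corresponding differential equation imposes.\<close>

lemma gauss_sum:
  fixes c :: real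
  assumes c: "c > 1/2"
  shows "(\<Sum>B\<le>k div 2. 1 / (fact (k - 2*B) * 4^B * fact B * pochhammer c B))
       = 2^k * pochhammer (c - 1/2) k / (pochhammer (2*c - 1) k * fact k)"
proof -
  \<comment> \<open>The series of \<open>0F1(c; X^2 / 4)\<close>; the sum in the claim is a
    coefficient of its product with the exponential.\<close>
  define G :: "real fps" where "G = Abs_fps (\<lambda>n. if even n then 1 / (4^(n div 2) * fact (n div 2) * pochhammer c (n div 2)) else 0)"
  define F where "F = fps_exp 1 * G"
  have Fk: "F $ k = (\<Sum>B\<le>k div 2. 1 / (fact (k - 2*B) * 4^B * fact B * pochhammer c B))" for k
  proof -
    let ?t = "\<lambda>j. (if even j then 1 / (4^(j div 2) * fact (j div 2) * pochhammer c (j div 2)) else 0)"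
    have "F $ k = (\<Sum>j=0..k. ?t j / fact (k - j))"
      unfolding F_def by (subst mult.commute) (simp add: fps_mult_nth G_def)
    also have "\<dots> = (\<Sum>j\<in>(\<lambda>B. 2*B) ` {..k div 2}. ?t j / fact (k - j))"
    proof (rule sum.mono_neutral_right)
      show "\<forall>i\<in>{0..k} - (\<lambda>B. 2*B) ` {..k div 2}. ?t i / fact (k - i) = 0"
        by (auto elim!: evenE)
    qed auto
    also have "\<dots> = (\<Sum>B\<le>k div 2. 1 / (fact (k - 2*B) * 4^B * fact B * pochhammer c B))"
      by (subst sum.reindex) (auto simp: inj_on_def mult_ac)
    finally show ?thesis .
  qed
  \<comment> \<open>A form of Bessel's modified equation. Multiplication of the solution by the
    exponential transforms it into Kummer's equation \<open>ODE_F\<close>, whose coefficient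
    recurrence has only two terms.\<close>
  have ODE_G: "fps_X * fps_deriv (fps_deriv G) + fps_const (2*c - 1) * fps_deriv G = fps_X * G"
  proof (rule fps_ext)
    fix n
    show "(fps_X * fps_deriv (fps_deriv G) + fps_const (2*c - 1) * fps_deriv G) $ n = (fps_X * G) $ n"
    proof (cases n)
      case 0
      then show ?thesis by (simp add: G_def)
    next
      case (Suc m)
      show ?thesis
      proof (cases "even m")
        case True
        then obtain b where b: "m = 2 * b" by (elim evenE)
        have nz: "pochhammer c b \<noteq> 0" "c + real b \<noteq> 0" "1 + real b \<noteq> 0"
          using c by (auto simp: pochhammer_eq_0_iff)
        have e: "(real (2*b+2) * real (2*b+1) + (2*c - 1) * real (2*b+2)) = 4 * (1 + real b) * (c + real b)"
          by (simp add: algebra_simps)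
        have "(fps_X * fps_deriv (fps_deriv G) + fps_const (2*c - 1) * fps_deriv G) $ n
          = (real (2*b+2) * real (2*b+1) + (2*c - 1) * real (2*b+2)) * G $ (2*b+2)"
          using Suc b by (simp add: algebra_simps)
        also have "\<dots> = 4 * (1 + real b) * (c + real b) * (1 / (4 * 4 ^ b * ((1 + real b) * fact b) * (pochhammer c b * (c + real b))))"
          unfolding e by (simp add: G_def pochhammer_Suc)
        also have "\<dots> = G $ (2*b)" using nz by (simp add: G_def divide_simps)
        finally show ?thesis using Suc b by simp
      next
        case False
        then show ?thesis using Suc by (simp add: G_def)
      qed
    qed
  qed
  have ODE_F: "fps_X * fps_deriv (fps_deriv F) + fps_const (2*c-1) * fps_deriv F
     = fps_const 2 * (fps_X * fps_deriv F) + fps_const (2*c-1) * F"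
  proof -
    have dF: "fps_deriv F = F + fps_exp 1 * fps_deriv G"
      by (simp add: F_def algebra_simps)
    have ddF: "fps_deriv (fps_deriv F) = F + fps_const 2 * (fps_exp 1 * fps_deriv G) + fps_exp 1 * fps_deriv (fps_deriv G)"
      by (simp add: dF algebra_simps flip: numeral_fps_const)
    have "fps_exp 1 * (fps_X * fps_deriv (fps_deriv G) + fps_const (2*c - 1) * fps_deriv G) = fps_X * F"
      unfolding ODE_G by (simp add: F_def mult_ac)
    then have "fps_X * F + fps_const 2 * (fps_X * (F + fps_exp 1 * fps_deriv G)) + fps_const (2*c-1) * F
      = fps_exp 1 * (fps_X * fps_deriv (fps_deriv G) + fps_const (2*c - 1) * fps_deriv G)
         + fps_const 2 * (fps_X * (F + fps_exp 1 * fps_deriv G)) + fps_const (2*c-1) * F"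
      by simp
    then show ?thesis unfolding ddF unfolding dF
      by (simp add: algebra_simps flip: numeral_fps_const)
  qed
  \<comment> \<open>Because \<open>c > 1/2\<close>, the factor \<open>2 * c - 1 + k\<close> is
    positive for every \<open>k\<close>, including \<open>k = 0\<close>, and the recurrence
    determines all coefficients.\<close>
  have rec: "real (k+1) * (2*c-1+real k) * F $ (Suc k) = (2*c-1+2*real k) * F $ k" for k
  proof -
    have "(fps_X * fps_deriv (fps_deriv F) + fps_const (2*c-1) * fps_deriv F) $ k
      = (fps_const 2 * (fps_X * fps_deriv F) + fps_const (2*c-1) * F) $ k"
      using ODE_F by simp
    then show ?thesis by (cases k) (auto simp: algebra_simps)
  qed
  have "F $ k = 2^k * pochhammer (c - 1/2) k / (pochhammer (2*c - 1) k * fact k)"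
  proof (induction k)
    case 0
    then show ?case by (simp add: Fk)
  next
    case (Suc k)
    have nz: "2*c - 1 + real k > 0" "1 + real k > 0" "pochhammer (2*c-1) k > 0"
      using c by (auto intro!: pochhammer_pos)
    have "F $ Suc k = (2*c-1+2*real k) * F $ k / (real (k+1) * (2*c-1+real k))"
      using rec[of k] nz by (simp add: eq_divide_eq mult.commute)
    then show ?case unfolding Suc using nz
      by (simp add: pochhammer_Suc divide_simps) (simp add: algebra_simps)
  qed
  then show ?thesis by (simp add: Fk)
qed

section \<open>Moments of monomials against the Dunkl kernel\<close>

text \<open>The generalized factorial of rank-one Dunkl theory: the Dunkl kernel is the exponential
  series with \<open>m!\<close> replaced by it. For \<open>k = 0\<close> it is
  \<open>m!\<close>.\<close>

definition dunkl_fact :: "real \<Rightarrow> nat \<Rightarrow> real" where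
  "dunkl_fact k m = 2 ^ m * fact (m div 2) * pochhammer (k + 1/2) ((m + 1) div 2)"

text \<open>The moments of the weight \<open>h^2\<close> on the unit sphere, normalized to total
  mass one; see \<open>sphere_integral\<close>.\<close>

definition sphere_moment :: "real \<Rightarrow> ('i::finite \<Rightarrow> real) \<Rightarrow> ('i \<Rightarrow> nat) \<Rightarrow> real" where
  "sphere_moment a k m =
     (if \<forall>i. even (m i) then (\<Prod>i\<in>UNIV. pochhammer (k i + 1/2) (m i div 2)) / pochhammer (a + 1) ((sum m UNIV) div 2)
      else 0)"

text \<open>The normalized sphere integral of the monomial with exponents \<open>\<mu>\<close> times
  the part of degree \<open>l\<close> of the Dunkl kernel in direction \<open>y\<close>.\<close>

definition kernel_moment :: "real \<Rightarrow> ('i::finite \<Rightarrow> real) \<Rightarrow> ('i \<Rightarrow> nat) \<Rightarrow> ('i \<Rightarrow> real) \<Rightarrow> nat \<Rightarrow> real" where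
  "kernel_moment a k \<mu> y l =
     (\<Sum>m\<in>multi_indices l. (\<Prod>i\<in>UNIV. y i ^ m i / dunkl_fact (k i) (m i)) * sphere_moment a k (\<lambda>i. \<mu> i + m i))"

definition moment_fps :: "('i::finite \<Rightarrow> real) \<Rightarrow> ('i \<Rightarrow> nat) \<Rightarrow> ('i \<Rightarrow> real) \<Rightarrow> real fps" where
  "moment_fps k \<mu> y =
     (\<Prod>i\<in>UNIV. Abs_fps (\<lambda>b. pochhammer (k i + 1/2 + of_nat (\<mu> i mod 2) + of_nat b) (\<mu> i div 2) * fps_exp ((y i)\<^sup>2 / 4) $ b))"

text \<open>The two Pochhammer symbols share the factor \<open>(k + 1/2)\<close> of length
  \<open>b + \<mu> mod 2\<close>. What survives is a Pochhammer symbol of fixed length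
  \<open>\<mu> div 2\<close>, a polynomial in \<open>b\<close>, times the coefficient of an
  exponential.\<close>

lemma kernel_moment_factor:
  assumes k: "k \<ge> (0::real)"
  shows "y ^ (2*b + \<mu> mod 2) / dunkl_fact k (2*b + \<mu> mod 2) * pochhammer (k + 1/2) ((\<mu> + (2*b + \<mu> mod 2)) div 2)
    = (y/2) ^ (\<mu> mod 2) * (pochhammer (k + 1/2 + of_nat (\<mu> mod 2) + of_nat b) (\<mu> div 2) * fps_exp (y\<^sup>2 / 4) $ b)"
proof -
  define \<epsilon> where "\<epsilon> = \<mu> mod 2"
  define a where "a = \<mu> div 2"
  have \<mu>: "\<mu> = 2 * a + \<epsilon>" by (simp add: a_def \<epsilon>_def)
  have \<epsilon>: "\<epsilon> < 2" by (simp add: \<epsilon>_def)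
  have 1: "(\<mu> + (2*b + \<epsilon>)) div 2 = (b + \<epsilon>) + a" by (simp add: \<mu>)
  have 2: "(2*b + \<epsilon>) div 2 = b" "(2*b + \<epsilon> + 1) div 2 = b + \<epsilon>" using \<epsilon> by linarith+
  have 3: "pochhammer (k + 1/2) ((b + \<epsilon>) + a) = pochhammer (k + 1/2) (b + \<epsilon>) * pochhammer (k + 1/2 + of_nat \<epsilon> + of_nat b) a"
    by (subst pochhammer_product') (simp add: add_ac)
  have nz: "pochhammer (k + 1/2) (b + \<epsilon>) > 0" using k by (intro pochhammer_pos) auto
  have 4: "y ^ (2 * b + \<epsilon>) = y ^ \<epsilon> * (y\<^sup>2) ^ b" by (simp add: power_add power_mult[symmetric] mult.commute)
  have 5: "(2::real) ^ (2 * b + \<epsilon>) = 2 ^ \<epsilon> * 4 ^ b" by (simp add: power_add power_mult)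
  show ?thesis
    unfolding \<epsilon>_def[symmetric] a_def[symmetric] dunkl_fact_def 1 2 3 4 5
    using nz by (simp add: field_simps)
qed

text \<open>By parity the exponents are \<open>m = 2 b + \<mu> mod 2\<close>. Thus \<open>l\<close>
  is at least the number \<open>e\<close> of odd entries of \<open>\<mu>\<close> and has the same
  parity; the sum over \<open>b\<close> is a coefficient of a product of one series per
  coordinate.\<close>

lemma kernel_moment_eq:
  fixes k :: "'i::finite \<Rightarrow> real" and \<mu> :: "'i \<Rightarrow> nat"
  assumes k: "\<And>i. k i \<ge> 0"
  defines "e \<equiv> (\<Sum>i\<in>UNIV. \<mu> i mod 2)" and "E \<equiv> (\<Sum>i\<in>UNIV. \<mu> i div 2)"
  shows "kernel_moment a k \<mu> y l = (if e \<le> l \<and> even (l - e)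
      then (\<Prod>i\<in>UNIV. (y i / 2) ^ (\<mu> i mod 2)) / pochhammer (a + 1) (E + e + (l - e) div 2) * moment_fps k \<mu> y $ ((l - e) div 2)
      else 0)"
proof -
  define g where "g b = (\<lambda>i. 2 * b i + \<mu> i mod 2)" for b :: "'i \<Rightarrow> nat"
  have sum_g: "(\<Sum>i\<in>UNIV. g b i) = 2 * (sum b UNIV) + e" for b
    by (simp add: g_def sum.distrib sum_distrib_left e_def)
  have even_g: "\<exists>b. m = g b" if "\<forall>i. even (\<mu> i + m i)" for m
  proof
    show "m = g (\<lambda>i. m i div 2)"
    proof
      fix i
      have "even (\<mu> i + m i)" using that by auto
      then have "\<mu> i mod 2 = m i mod 2" by presburger
      then show "m i = g (\<lambda>i. m i div 2) i" by (simp add: g_def)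
    qed
  qed
  show ?thesis
  proof (cases "e \<le> l \<and> even (l - e)")
    case False
    have "sphere_moment a k (\<lambda>i. \<mu> i + m i) = 0" if "m \<in> multi_indices l" for m
    proof (rule ccontr)
      assume "sphere_moment a k (\<lambda>i. \<mu> i + m i) \<noteq> 0"
      then have "\<forall>i. even (\<mu> i + m i)" by (auto simp: sphere_moment_def split: if_splits)
      then obtain b where "m = g b" using even_g by blast
      then have "l = 2 * (sum b UNIV) + e" using that sum_g by (simp add: multi_indices_def)
      with False show False by simp
    qed
    with False show ?thesis by (auto simp: kernel_moment_def)
  next
    case True
    then obtain B where l: "l = e + 2 * B" by (metis evenE le_add_diff_inverse)
    let ?f = "\<lambda>b i. pochhammer (k i + 1/2 + of_nat (\<mu> i mod 2) + of_nat (b i)) (\<mu> i div 2) * fps_exp ((y i)\<^sup>2 / 4) $ (b i)"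
    let ?c = "(\<Prod>i\<in>UNIV. (y i / 2) ^ (\<mu> i mod 2)) / pochhammer (a + 1) (E + e + B)"
    let ?t = "\<lambda>m. (\<Prod>i\<in>UNIV. y i ^ m i / dunkl_fact (k i) (m i)) * sphere_moment a k (\<lambda>i. \<mu> i + m i)"
    have inj: "inj_on g (multi_indices B)"
      by (auto simp: inj_on_def g_def fun_eq_iff)
    have "kernel_moment a k \<mu> y l = (\<Sum>m\<in>g ` multi_indices B. ?t m)"
      unfolding kernel_moment_def
    proof (rule sum.mono_neutral_right)
      show "g ` multi_indices B \<subseteq> multi_indices l"
        using sum_g by (auto simp: multi_indices_def l)
      show "\<forall>m\<in>multi_indices l - g ` multi_indices B. ?t m = 0"
      proof
        fix m assume m: "m \<in> multi_indices l - g ` multi_indices B"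
        have "\<not> (\<forall>i. even (\<mu> i + m i))"
        proof
          assume "\<forall>i. even (\<mu> i + m i)"
          then obtain b where b: "m = g b" using even_g by blast
          then have "(sum b UNIV) = B" using m sum_g[of b] by (simp add: multi_indices_def l)
          with m b show False by (auto simp: multi_indices_def)
        qed
        then show "?t m = 0" unfolding sphere_moment_def by (simp only: if_False mult_zero_right)
      qed
    qed simp
    also have "\<dots> = (\<Sum>b\<in>multi_indices B. ?t (g b))"
      by (subst sum.reindex[OF inj]) simp
    also have "\<dots> = (\<Sum>b\<in>multi_indices B. ?c *
       (\<Prod>i\<in>UNIV. ?f b i))"
    proof (rule sum.cong)
      fix b :: "'i \<Rightarrow> nat" assume b: "b \<in> multi_indices B"
      have ev: "\<forall>i. even (\<mu> i + g b i)"
      proof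
        fix i
        show "even (\<mu> i + g b i)" unfolding g_def by presburger
      qed
      have "(sum \<mu> UNIV) = (\<Sum>i\<in>UNIV. 2 * (\<mu> i div 2) + \<mu> i mod 2)" by simp
      also have "\<dots> = 2 * E + e" by (simp only: sum.distrib sum_distrib_left E_def e_def)
      finally have "(\<Sum>i\<in>UNIV. \<mu> i + g b i) = 2 * (E + e + B)"
        using sum_g[of b] b by (simp add: sum.distrib multi_indices_def)
      then have h: "(\<Sum>i\<in>UNIV. \<mu> i + g b i) div 2 = E + e + B" by simp
      have "?t (g b) = (\<Prod>i\<in>UNIV. y i ^ g b i / dunkl_fact (k i) (g b i) * pochhammer (k i + 1/2) ((\<mu> i + g b i) div 2))
          / pochhammer (a + 1) (E + e + B)"
        unfolding sphere_moment_def h using ev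
        by (simp only: prod.distrib if_True times_divide_eq_right simp_thms)
      also have "\<dots> = (\<Prod>i\<in>UNIV. (y i / 2) ^ (\<mu> i mod 2) * (?f b i))
          / pochhammer (a + 1) (E + e + B)"
        unfolding g_def kernel_moment_factor[OF k] ..
      finally show "?t (g b) = ?c *
       (\<Prod>i\<in>UNIV. ?f b i)"
        by (simp only: prod.distrib times_divide_eq_left)
    qed auto
    also have "\<dots> = ?c * moment_fps k \<mu> y $ B"
      unfolding moment_fps_def fps_nth_prod_multi_indices sum_distrib_left by simp
    finally show ?thesis using l by simp
  qed
qed

text \<open>The exponents of the coordinates add up to a multiple of the squared norm of
  \<open>y\<close>, the only combination that the cone equation controls.\<close>

lemma exp_poly_moment_fps:
  fixes k :: "'i::finite \<Rightarrow> real"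
  shows "exp_poly ((\<Sum>i\<in>UNIV. (y i)\<^sup>2) / 4) (\<Sum>i\<in>UNIV. \<mu> i div 2) (\<Prod>i\<in>UNIV. ((y i)\<^sup>2 / 4) ^ (\<mu> i div 2)) (moment_fps k \<mu> y)"
proof -
  have "exp_poly ((y i)\<^sup>2 / 4) (\<mu> i div 2) (((y i)\<^sup>2 / 4) ^ (\<mu> i div 2))
     (Abs_fps (\<lambda>b. pochhammer (k i + 1/2 + of_nat (\<mu> i mod 2) + of_nat b) (\<mu> i div 2) * fps_exp ((y i)\<^sup>2 / 4) $ b))" for i
    using exp_poly_pochhammer[OF exp_poly_exp, of "(y i)\<^sup>2 / 4" "\<mu> i div 2" "k i + 1/2 + of_nat (\<mu> i mod 2)"]
    by simp
  from exp_poly_prod[OF finite_class.finite_UNIV this]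
  show ?thesis by (simp add: moment_fps_def sum_divide_distrib)
qed

text \<open>All powers of \<open>s\<close> combine to \<open>s ^ (k - m0)\<close>, because a step of
  two in \<open>l\<close> trades \<open>s^2\<close> against \<open>s^2 / 4\<close>. What remains is
  \<open>gauss_sum\<close> with parameter \<open>a + 1 + M\<close>.\<close>

lemma sum_exp_gauss:
  fixes a s :: real
  assumes a: "a > - 1/2"
  shows "(\<Sum>l\<le>k. s ^ (k - l) / fact (k - l) *
           (if m0 \<le> l \<and> even (l - m0) then (s\<^sup>2 / 4) ^ ((l - m0) div 2) / (fact ((l - m0) div 2) * pochhammer (a + 1) (M + (l - m0) div 2)) else 0))
    = (if m0 \<le> k then s ^ (k - m0) / fact (k - m0) * 2 ^ (k - m0) * pochhammer (a + 1/2 + of_nat M) (k - m0)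
           / (pochhammer (2 * a + 1 + 2 * of_nat M) (k - m0) * pochhammer (a + 1) M) else 0)"
  (is "(\<Sum>l\<le>k. ?f l) = _")
proof (cases "m0 \<le> k")
  case True
  define K where "K = k - m0"
  have k: "k = m0 + K" using True by (simp add: K_def)
  let ?q = "\<lambda>B. (1 / (fact (K - 2*B) * 4^B * fact B * pochhammer (a + 1 + of_nat M) B))"
  have "(\<Sum>l\<le>k. ?f l) = (\<Sum>l\<in>(\<lambda>B. m0 + 2 * B) ` {..K div 2}. ?f l)"
  proof (rule sum.mono_neutral_right)
    show "(\<lambda>B. m0 + 2 * B) ` {..K div 2} \<subseteq> {..k}" by (auto simp: k)
    show "\<forall>i\<in>{..k} - (\<lambda>B. m0 + 2 * B) ` {..K div 2}. ?f i = 0"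
    proof
      fix i assume i: "i \<in> {..k} - (\<lambda>B. m0 + 2 * B) ` {..K div 2}"
      have "\<not> (m0 \<le> i \<and> even (i - m0))"
      proof
        assume "m0 \<le> i \<and> even (i - m0)"
        then obtain B where "i = m0 + 2 * B" by (metis evenE le_add_diff_inverse)
        with i show False by (auto simp: k)
      qed
      then show "?f i = 0" by (simp only: if_False mult_zero_right)
    qed
  qed auto
  also have "\<dots> = (\<Sum>B\<le>K div 2. ?f (m0 + 2 * B))"
    by (subst sum.reindex) (simp_all add: inj_on_def o_def mult_ac)
  also have "\<dots> = (\<Sum>B\<le>K div 2. s ^ K / pochhammer (a + 1) M * ?q B)"
  proof (rule sum.cong)
    fix B assume "B \<in> {..K div 2}"
    then have "s ^ K = s ^ (K - 2*B) * (s\<^sup>2) ^ B"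
      by (simp add: power_mult[symmetric] power_add[symmetric])
    moreover have "pochhammer (a + 1) (M + B) = pochhammer (a + 1) M * pochhammer (a + 1 + of_nat M) B"
      by (rule pochhammer_product')
    ultimately show "?f (m0 + 2 * B) = s ^ K / pochhammer (a + 1) M * ?q B"
      by (simp add: k power_divide field_simps)
  qed auto
  also have "\<dots> = s ^ K / pochhammer (a + 1) M * (2^K * pochhammer (a + 1/2 + of_nat M) K / (pochhammer (2 * a + 1 + 2 * of_nat M) K * fact K))"
    unfolding sum_distrib_left[symmetric]
    by (subst gauss_sum) (use a in \<open>auto simp: algebra_simps\<close>)
  finally show ?thesis using True by (simp add: K_def field_simps)
qed (auto intro!: sum.neutral)

text \<open>The core of the proof, for monomials without a power of \<open>t\<close>. The
  exponential in \<open>s^2 / 4\<close> is split off, each coefficient of the remaining polynomial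
  gives one Gauss sum, and the prefactor is exactly what makes the outcome polynomial in
  \<open>n\<close>.\<close>

lemma exp_poly_kernel_moment_aux:
  fixes k :: "'i::finite \<Rightarrow> real" and \<mu> :: "'i \<Rightarrow> nat"
  assumes k: "\<And>i. k i \<ge> 0" and a: "a \<ge> 0" and s: "s\<^sup>2 = (\<Sum>i\<in>UNIV. (y i)\<^sup>2)"
  defines "N \<equiv> \<Sum>i\<in>UNIV. \<mu> i"
  shows "exp_poly s N (\<Prod>i\<in>UNIV. y i ^ \<mu> i)
    (Abs_fps (\<lambda>n. pochhammer (2 * a + 1) (N + n) / (2 ^ n * pochhammer (a + 1/2) n)
       * (\<Sum>l\<le>n. s ^ (n - l) / fact (n - l) * kernel_moment a k \<mu> y l)))"
proof -
  define e where "e = (\<Sum>i\<in>UNIV. \<mu> i mod 2)"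
  define E where "E = (\<Sum>i\<in>UNIV. \<mu> i div 2)"
  have N: "N = 2 * E + e"
  proof -
    have "N = (\<Sum>i\<in>UNIV. 2 * (\<mu> i div 2) + \<mu> i mod 2)" by (simp add: N_def)
    then show ?thesis by (simp only: sum.distrib sum_distrib_left E_def e_def)
  qed
  define y' where "y' = (\<Prod>i\<in>UNIV. (y i / 2) ^ (\<mu> i mod 2))"
  define q where "q = (\<Prod>i\<in>UNIV. ((y i)\<^sup>2 / 4) ^ (\<mu> i div 2))"
  have "exp_poly (s\<^sup>2 / 4) E q (moment_fps k \<mu> y)"
    unfolding s E_def q_def by (rule exp_poly_moment_fps)
  then obtain Q where Q: "moment_fps k \<mu> y = fps_exp (s\<^sup>2 / 4) * Q" "\<And>i. i > E \<Longrightarrow> Q $ i = 0" "Q $ E = q"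
    by (rule exp_polyE) blast
  \<comment> \<open>The length of the Pochhammer symbol at the first \<open>l\<close> that
    contributes to the summand \<open>C\<close>, namely \<open>l = e + 2 * C\<close>.\<close>
  define M where "M C = E + e + C" for C
  define g where "g C l = (if e + 2*C \<le> l \<and> even (l - (e + 2*C)) then (s\<^sup>2 / 4) ^ ((l - (e + 2*C)) div 2) / (fact ((l - (e + 2*C)) div 2) * pochhammer (a + 1) (M C + (l - (e + 2*C)) div 2)) else 0)" for C l
  have dual: "kernel_moment a k \<mu> y l = (\<Sum>C\<le>E. y' * Q $ C * g C l)" for l
  proof (cases "e \<le> l \<and> even (l - e)")
    case False
    then have "g C l = 0" for C by (auto simp: g_def)
    then show ?thesis using False by (auto simp: kernel_moment_eq[OF k] e_def[symmetric])
  next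
    case True
    then obtain B where l: "l = e + 2 * B" by (metis evenE le_add_diff_inverse)
    have "moment_fps k \<mu> y $ B = (\<Sum>C=0..B. Q $ C * ((s\<^sup>2 / 4) ^ (B - C) / fact (B - C)))"
      unfolding Q(1) by (subst mult.commute) (simp add: fps_mult_nth)
    also have "\<dots> = (\<Sum>C\<le>E. Q $ C * (if C \<le> B then (s\<^sup>2 / 4) ^ (B - C) / fact (B - C) else 0))"
    proof -
      have "(\<Sum>C=0..B. Q $ C * ((s\<^sup>2 / 4) ^ (B - C) / fact (B - C))) = (\<Sum>C\<le>max B E. Q $ C * (if C \<le> B then (s\<^sup>2 / 4) ^ (B - C) / fact (B - C) else 0))"
        by (rule sum.mono_neutral_cong_left) auto
      also have "\<dots> = (\<Sum>C\<le>E. Q $ C * (if C \<le> B then (s\<^sup>2 / 4) ^ (B - C) / fact (B - C) else 0))"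
        by (rule sum.mono_neutral_right) (auto simp: Q(2))
      finally show ?thesis .
    qed
    finally have "kernel_moment a k \<mu> y l = (\<Sum>C\<le>E. y' * Q $ C * ((if C \<le> B then (s\<^sup>2 / 4) ^ (B - C) / fact (B - C) else 0) / pochhammer (a + 1) (E + e + B)))"
      by (simp add: kernel_moment_eq[OF k] e_def[symmetric] E_def[symmetric] y'_def[symmetric] l
           sum_distrib_left sum_divide_distrib mult_ac)
    also have "\<dots> = (\<Sum>C\<le>E. y' * Q $ C * g C l)"
    proof (rule sum.cong)
      fix C
      have "(if C \<le> B then (s\<^sup>2 / 4) ^ (B - C) / fact (B - C) else 0) / pochhammer (a + 1) (E + e + B) = g C l"
      proof (cases "C \<le> B")
        case True
        then obtain D where "B = C + D" using le_Suc_ex by blast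
        then show ?thesis by (simp add: g_def l M_def add.assoc)
      qed (auto simp: g_def l)
      then show "y' * Q $ C * ((if C \<le> B then (s\<^sup>2 / 4) ^ (B - C) / fact (B - C) else 0) / pochhammer (a + 1) (E + e + B)) = y' * Q $ C * g C l"
        by simp
    qed simp
    finally show ?thesis .
  qed
  \<comment> \<open>The expected result of the Gauss sum for \<open>C\<close>, without the factor
    \<open>2 ^ N\<close>: a shift by \<open>e + 2 * C\<close> and a Pochhammer factor of degree
    \<open>E - C\<close> in the index.\<close>
  define T where "T C = fps_X ^ (e + 2*C) * Abs_fps (\<lambda>n. pochhammer (a + 1/2 + of_nat (e + 2*C) + of_nat n) (E - C) * fps_exp s $ n)" for C
  have T: "exp_poly s (E - C + (e + 2*C)) (s ^ (E - C)) (T C)" for C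
    unfolding T_def
    using exp_poly_X_power[OF exp_poly_pochhammer[OF exp_poly_exp, of s "E - C" "a + 1/2 + of_nat (e + 2*C)"], of "e + 2*C"]
    by simp
  let ?r = "\<lambda>n. pochhammer (2 * a + 1) (N + n) / (2 ^ n * pochhammer (a + 1/2) n)"
  let ?K = "\<lambda>n. (\<Sum>l\<le>n. s ^ (n - l) / fact (n - l) * kernel_moment a k \<mu> y l)"
  let ?S = "\<lambda>C n. (\<Sum>l\<le>n. s ^ (n - l) / fact (n - l) * g C l)"
  have key: "?r n *
      ?S C n = 2 ^ N * T C $ n" if "C \<le> E" for C n
  proof (cases "e + 2*C \<le> n")
    case True
    define n' where "n' = n - (e + 2*C)"
    have n: "n = n' + (e + 2*C)" using True by (simp add: n'_def)
    obtain D where D: "E = C + D" using \<open>C \<le> E\<close> le_Suc_ex by blast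
    have 1: "N + n = 2 * M C + n'" by (simp add: N n M_def)
    have 2: "pochhammer (2 * a + 1) (N + n) = pochhammer (2 * a + 1) (2 * M C) * pochhammer (2 * a + 1 + 2 * of_nat (M C)) n'"
      unfolding 1 by (subst pochhammer_product') simp
    \<comment> \<open>The duplication formula. Its second factor cancels the denominator left by
      \<open>sum_exp_gauss\<close>; its first factor is absorbed in the next step.\<close>
    have 3: "pochhammer (2 * a + 1) (2 * M C) = 4 ^ M C * pochhammer (a + 1/2) (M C) * pochhammer (a + 1) (M C)"
      proof -
      have *: "2 * (a + 1/2) = 2 * a + 1" "(a + 1/2) + 1/2 = a + 1" "real (2 ^ (2 * M C)) = 4 ^ M C"
        by (simp, simp, simp only: power_mult of_nat_power, simp)
      show ?thesis using pochhammer_double[of "a + 1/2" "M C"] unfolding * by simp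
    qed
    \<comment> \<open>Both sides are the Pochhammer symbol of \<open>a + 1/2\<close> of length
      \<open>M C + n' = n + (E - C)\<close>, split at different places. The factor of length
      \<open>n\<close> cancels the denominator of the prefactor.\<close>
    have 4: "pochhammer (a + 1/2) (M C) * pochhammer (a + 1/2 + of_nat (M C)) n' = pochhammer (a + 1/2) n * pochhammer (a + 1/2 + of_nat n) (E - C)"
    proof -
      have "M C + n' = n + (E - C)" by (simp add: M_def D n)
      then show ?thesis by (metis pochhammer_product')
    qed
    have 5: "(4::real) ^ M C * 2 ^ n' = 2 ^ N * 2 ^ n"
    proof -
      have "(4::real) ^ M C = 2 ^ (2 * M C)" by (simp add: power_mult)
      moreover have "2 * M C + n' = N + n" by (simp add: 1)
      ultimately show ?thesis by (simp add: power_add[symmetric])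
    qed
    have pos: "pochhammer (2 * a + 1 + 2 * of_nat (M C)) n' > 0" "pochhammer (a + 1) (M C) > 0" "pochhammer (a + 1/2) n > 0"
      using a by (intro pochhammer_pos; linarith)+
    have "?r n *
      ?S C n
      = ?r n *
        (s ^ n' / fact n' * 2 ^ n' * pochhammer (a + 1/2 + of_nat (M C)) n'
           / (pochhammer (2 * a + 1 + 2 * of_nat (M C)) n' * pochhammer (a + 1) (M C)))"
      unfolding g_def by (subst sum_exp_gauss) (use a True in \<open>auto simp: n'_def\<close>)
    also have "\<dots> = (4 ^ M C * 2 ^ n') * (pochhammer (a + 1/2) (M C) * pochhammer (a + 1/2 + of_nat (M C)) n') * s ^ n' / (fact n' * 2 ^ n * pochhammer (a + 1/2) n)"
      unfolding 2 3 using pos by (simp add: divide_simps)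
    also have "\<dots> = 2 ^ N * pochhammer (a + 1/2 + of_nat n) (E - C) * s ^ n' / fact n'"
      unfolding 4 5 using pos by (simp add: divide_simps)
    also have "\<dots> = 2 ^ N * T C $ n"
      using True by (simp add: T_def fps_X_power_mult_nth n'_def[symmetric]) (simp add: n add_ac)
    finally show ?thesis .
  next
    case False
    then have "g C l = 0" if "l \<le> n" for l using that by (auto simp: g_def)
    with False show ?thesis by (simp add: T_def fps_X_power_mult_nth)
  qed
  have H: "Abs_fps (\<lambda>n. ?r n
       * ?K n)
     = (\<Sum>C\<le>E. fps_const (2 ^ N * y' * Q $ C) * T C)"
  proof (rule fps_ext)
    fix n
    have "?K n = (\<Sum>C\<le>E. y' * Q $ C * ?S C n)"
      unfolding dual sum_distrib_left by (subst sum.swap) (simp add: mult_ac)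
    then have "?r n
       * ?K n
       = (\<Sum>C\<le>E. y' * Q $ C * (?r n * ?S C n))"
      by (simp add: sum_distrib_left mult_ac)
    also have "\<dots> = (\<Sum>C\<le>E. y' * Q $ C * (2 ^ N * T C $ n))"
    proof (rule sum.cong[OF refl])
      fix C assume "C \<in> {..E}"
      then show "y' * Q $ C * (?r n * ?S C n) = y' * Q $ C * (2 ^ N * T C $ n)"
        by (subst key) simp_all
    qed
    finally show "Abs_fps (\<lambda>n. ?r n
       * ?K n) $ n
       = (\<Sum>C\<le>E. fps_const (2 ^ N * y' * Q $ C) * T C) $ n"
      by (simp add: fps_sum_nth mult_ac)
  qed
  \<comment> \<open>The degree bound of \<open>T C\<close> is \<open>E + e + C\<close>, which
    reaches \<open>N = 2 * E + e\<close> only for \<open>C = E\<close>; hence the leading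
    coefficient sees only \<open>Q $ E = q\<close>.\<close>
  have "exp_poly s N (\<Sum>C\<le>E. (2 ^ N * y' * Q $ C) * (if C = E then 1 else 0)) (\<Sum>C\<le>E. fps_const (2 ^ N * y' * Q $ C) * T C)"
  proof (intro exp_poly_sum exp_poly_cmult)
    fix C assume "C \<in> {..E}"
    show "exp_poly s N (if C = E then 1 else 0) (T C)"
    proof (cases "C = E")
      case True
      then show ?thesis using T[of E] by (simp add: N add_ac)
    next
      case False
      then show ?thesis using exp_poly_degree_mono[OF T[of C], of N] \<open>C \<in> {..E}\<close> by (simp add: N)
    qed
  qed simp
  moreover have "(\<Sum>C\<le>E. (2 ^ N * y' * Q $ C) * (if C = E then 1 else 0)) = (\<Prod>i\<in>UNIV. y i ^ \<mu> i)"
  proof -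
    have "(\<Sum>C\<le>E. (2 ^ N * y' * Q $ C) * (if C = E then 1 else 0)) = (\<Sum>C\<in>{E}. (2 ^ N * y' * Q $ C) * (if C = E then 1 else 0))"
      by (rule sum.mono_neutral_right) auto
    also have "\<dots> = 2 ^ N * y' * q" by (simp add: Q(3))
    also have "\<dots> = (\<Prod>i\<in>UNIV. 2 ^ \<mu> i * ((y i / 2) ^ (\<mu> i mod 2) * ((y i)\<^sup>2 / 4) ^ (\<mu> i div 2)))"
      by (simp add: y'_def q_def N_def prod.distrib power_sum)
    also have "\<dots> = (\<Prod>i\<in>UNIV. y i ^ \<mu> i)"
    proof (rule prod.cong)
      fix i
      have "((y i)\<^sup>2 / 4) ^ (\<mu> i div 2) = (y i / 2) ^ (2 * (\<mu> i div 2))"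
        by (simp add: power_mult power_divide)
      then have "(y i / 2) ^ (\<mu> i mod 2) * ((y i)\<^sup>2 / 4) ^ (\<mu> i div 2) = (y i / 2) ^ \<mu> i"
        by (simp add: power_add[symmetric])
      then show "2 ^ \<mu> i * ((y i / 2) ^ (\<mu> i mod 2) * ((y i)\<^sup>2 / 4) ^ (\<mu> i div 2)) = y i ^ \<mu> i"
        by (simp add: power_mult_distrib[symmetric])
    qed simp
    finally show ?thesis .
  qed
  ultimately show ?thesis unfolding H by simp
qed

text \<open>The additional power \<open>t ^ j\<close> only lengthens the Pochhammer symbol of
  \<open>2 * a + 1\<close> by \<open>j\<close>. This is a polynomial factor of degree
  \<open>j\<close> in \<open>n\<close>, and \<open>exp_poly_pochhammer\<close> turns it into
  \<open>s ^ j\<close> at the top.\<close>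

lemma exp_poly_kernel_moment:
  fixes k :: "'i::finite \<Rightarrow> real"
  assumes k: "\<And>i. k i \<ge> 0" and a: "a \<ge> 0" and s: "s\<^sup>2 = (\<Sum>i\<in>UNIV. (y i)\<^sup>2)"
    and N: "N = (sum \<mu> UNIV) + j"
  shows "exp_poly s N ((\<Prod>i\<in>UNIV. y i ^ \<mu> i) * s ^ j)
    (Abs_fps (\<lambda>n. pochhammer (2 * a + 1) (N + n) / (2 ^ n * pochhammer (a + 1/2) n)
       * (\<Sum>l\<le>n. s ^ (n - l) / fact (n - l) * kernel_moment a k \<mu> y l)))"
proof -
  define N' where "N' = (sum \<mu> UNIV)"
  have *: "pochhammer (2 * a + 1) (N + n) = pochhammer (2 * a + 1 + of_nat N' + of_nat n) j * pochhammer (2 * a + 1) (N' + n)" for n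
  proof -
    have "N + n = (N' + n) + j" by (simp add: N N'_def)
    moreover have "2 * a + 1 + real (N' + n) = 2 * a + 1 + real N' + real n" by simp
    ultimately show ?thesis by (metis pochhammer_product' mult.commute)
  qed
  have NN: "N = N' + j" by (simp add: N N'_def)
  show ?thesis
    using exp_poly_pochhammer[OF exp_poly_kernel_moment_aux[of k a s y \<mu>, OF k a s], of j "2 * a + 1 + of_nat N'"]
    unfolding N'_def[symmetric] * NN[symmetric]
    by (simp add: mult.assoc mult.commute[of "s ^ j"])
qed

section \<open>Laguerre polynomials of a sum and integration over t\<close>

lemma mult_compose_geo_nth: "(A * (F oo geo_fps)) $ n = (\<Sum>i\<le>n. F $ i * (A * geo_fps ^ i) $ n)"
proof -
  have "(A * (F oo geo_fps)) $ n = (\<Sum>j=0..n. A $ j * (\<Sum>i\<le>n. F $ i * (geo_fps ^ i) $ (n - j)))"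
    unfolding fps_mult_nth
  proof (rule sum.cong[OF refl])
    fix j assume "j \<in> {0..n}"
    have "(F oo geo_fps) $ (n - j) = (\<Sum>i\<le>n. F $ i * (geo_fps ^ i) $ (n - j))"
      unfolding compose_geo_fps_nth
      by (rule sum.mono_neutral_left) (auto simp: geo_fps_power_nth)
    then show "A $ j * (F oo geo_fps) $ (n - j) = A $ j * (\<Sum>i\<le>n. F $ i * (geo_fps ^ i) $ (n - j))"
      by simp
  qed
  also have "\<dots> = (\<Sum>i\<le>n. F $ i * (A * geo_fps ^ i) $ n)"
    unfolding fps_mult_nth sum_distrib_left by (subst sum.swap) (simp only: mult_ac)
  finally show ?thesis .
qed

text \<open>Splitting \<open>exp (- (t + s) w)\<close> and expanding the part in \<open>t\<close>
  gives the Laguerre polynomial as a polynomial in \<open>t\<close> with these coefficients, up to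
  \<open>(- t) ^ i / i!\<close>. The factor \<open>X ^ k\<close> keeps the index at \<open>n\<close>
  instead of \<open>n - k\<close>.\<close>

definition laguerre_shift_coeff :: "real \<Rightarrow> real \<Rightarrow> nat \<Rightarrow> nat \<Rightarrow> nat \<Rightarrow> real" where
  "laguerre_shift_coeff a s n k i =
     (fps_X ^ k * one_minus_X_powr (- 2 * a - 1 - 2 * of_nat k) * (fps_exp (- s) oo geo_fps) * geo_fps ^ i) $ n"

lemma laguerre_shift_coeff_eq_0: "n < k + i \<Longrightarrow> laguerre_shift_coeff a s n k i = 0"
proof -
  assume *: "n < k + i"
  have "laguerre_shift_coeff a s n k i = (fps_X ^ (k + i) * (one_minus_X_powr (- of_nat i) * one_minus_X_powr (- 2 * a - 1 - 2 * of_nat k) * (fps_exp (- s) oo geo_fps))) $ n"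
    unfolding laguerre_shift_coeff_def geo_fps_power by (simp only: power_add mult_ac)
  then show ?thesis using * by (simp only: fps_X_power_mult_nth if_True)
qed

lemma laguerre_shift:
  assumes "k \<le> n"
  shows "laguerre (n - k) (2 * a + 2 * of_nat k) (t + s) = (\<Sum>i\<le>n - k. (- t) ^ i / fact i * laguerre_shift_coeff a s n k i)"
proof -
  have 1: "- (2 * a + 2 * of_nat k) - 1 = - 2 * a - 1 - 2 * of_nat k" by simp
  have "laguerre (n - k) (2 * a + 2 * of_nat k) (t + s)
     = (fps_X ^ k * (one_minus_X_powr (- 2 * a - 1 - 2 * of_nat k) * (fps_exp (- (t + s)) oo geo_fps))) $ n"
    unfolding laguerre_altdef 1 using assms by (simp only: fps_X_power_mult_nth not_less if_False)
      (simp only: not_less[symmetric] if_False)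
  also have "fps_exp (- (t + s)) = fps_exp (- s) * fps_exp (- t)"
    by (simp add: fps_exp_add_mult[symmetric])
  also have "(fps_X ^ k * (one_minus_X_powr (- 2 * a - 1 - 2 * of_nat k) * ((fps_exp (- s) * fps_exp (- t)) oo geo_fps))) $ n
    = ((fps_X ^ k * one_minus_X_powr (- 2 * a - 1 - 2 * of_nat k) * (fps_exp (- s) oo geo_fps)) * (fps_exp (- t) oo geo_fps)) $ n"
    by (simp only: fps_compose_mult_distrib[OF geo_fps_0] mult.assoc)
  also have "\<dots> = (\<Sum>i\<le>n. (- t) ^ i / fact i * laguerre_shift_coeff a s n k i)"
    unfolding mult_compose_geo_nth laguerre_shift_coeff_def[symmetric] by (simp add: mult.assoc)
  also have "\<dots> = (\<Sum>i\<le>n - k. (- t) ^ i / fact i * laguerre_shift_coeff a s n k i)"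
    by (rule sum.mono_neutral_right) (use assms in \<open>auto intro!: laguerre_shift_coeff_eq_0\<close>)
  finally show ?thesis .
qed

text \<open>Integrating \<open>t ^ i\<close> against a Gamma weight puts a Pochhammer symbol in its
  place; the sum over \<open>i\<close> then becomes the binomial series
  \<open>(1 + w) ^ (- c) = (1 - X) ^ c\<close>.\<close>

lemma sum_laguerre_shift_coeff:
  "(\<Sum>i\<le>n. pochhammer c i * (- 1) ^ i / fact i * laguerre_shift_coeff a s n k i)
   = (one_minus_X_powr (c - 2 * a - 1 - of_nat k) * (fps_exp (- s) oo geo_fps) * geo_fps ^ k) $ n"
proof -
  define A where "A = fps_X ^ k * one_minus_X_powr (- 2 * a - 1 - 2 * of_nat k) * (fps_exp (- s) oo geo_fps)"
  have "(\<Sum>i\<le>n. pochhammer c i * (- 1) ^ i / fact i * laguerre_shift_coeff a s n k i)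
     = (\<Sum>i\<le>n. fps_binomial (- c) $ i * (A * geo_fps ^ i) $ n)"
    by (rule sum.cong[OF refl])
      (simp add: laguerre_shift_coeff_def A_def gbinomial_pochhammer mult_ac)
  also have "\<dots> = (A * one_minus_X_powr c) $ n"
    unfolding mult_compose_geo_nth[symmetric] fps_binomial_compose_geo by simp
  also have "A * one_minus_X_powr c = fps_X ^ k * (one_minus_X_powr (- 2 * a - 1 - 2 * of_nat k) * one_minus_X_powr c) * (fps_exp (- s) oo geo_fps)"
    by (simp only: A_def mult_ac)
  also have "one_minus_X_powr (- 2 * a - 1 - 2 * of_nat k) * one_minus_X_powr c
    = one_minus_X_powr (c - 2 * a - 1 - of_nat k) * one_minus_X_powr (- of_nat k)"
    unfolding one_minus_X_powr_add[symmetric] by (simp add: algebra_simps)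
  finally show ?thesis by (simp only: geo_fps_power mult_ac)
qed

text \<open>The normalized moments on the cone: a Gamma integral in \<open>t\<close>, depending on
  the total degree only, times a moment on the sphere.\<close>

definition cone_moment :: "real \<Rightarrow> ('i::finite \<Rightarrow> real) \<Rightarrow> ('i \<Rightarrow> nat) \<Rightarrow> nat \<Rightarrow> real" where
  "cone_moment a k m j = pochhammer (2 * a + 1) ((sum m UNIV) + j) * sphere_moment a k m"

text \<open>The left side is the inner product of a monomial with the kernel, written in moments.
  The total degree in each term is \<open>N + p + i\<close>, independent of \<open>l\<close> and
  \<open>m\<close>, so the sum over \<open>i\<close> can be evaluated separately, with
  \<open>c = 2 * a + 1 + N + p\<close>. It yields \<open>(1 - X) ^ N * w ^ p\<close> together with
  \<open>exp (- s w)\<close>.\<close>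

lemma kernel_cone_moment:
  fixes k :: "'i::finite \<Rightarrow> real" and \<mu> :: "'i \<Rightarrow> nat" and j :: nat
  defines "N \<equiv> (sum \<mu> UNIV) + j"
  shows "(\<Sum>p\<le>n. \<Sum>i\<le>n - p. \<Sum>l\<le>p. \<Sum>m\<in>multi_indices l.
           (- 1) ^ i / fact i * laguerre_shift_coeff a s n p i / (2 ^ p * pochhammer (a + 1/2) p)
           * (s ^ (p - l) / fact (p - l)) * (\<Prod>i\<in>UNIV. y i ^ m i / dunkl_fact (k i) (m i))
           * cone_moment a k (\<lambda>i. \<mu> i + m i) (j + i + (p - l)))
     = (one_minus_X_powr (of_nat N) * (fps_exp (- s) oo geo_fps) *
        (Abs_fps (\<lambda>n. pochhammer (2 * a + 1) (N + n) / (2 ^ n * pochhammer (a + 1/2) n)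
       * (\<Sum>l\<le>n. s ^ (n - l) / fact (n - l) * kernel_moment a k \<mu> y l)) oo geo_fps)) $ n"
    (is "?L = (_ * (?H oo geo_fps)) $ n")
proof -
  have 1: "(\<Sum>m\<in>multi_indices l. (\<Prod>i\<in>UNIV. y i ^ m i / dunkl_fact (k i) (m i)) * cone_moment a k (\<lambda>i. \<mu> i + m i) (j + i + (p - l)))
     = pochhammer (2 * a + 1) (N + p + i) * kernel_moment a k \<mu> y l" if "l \<le> p" for l p i
    unfolding kernel_moment_def sum_distrib_left
  proof (rule sum.cong[OF refl])
    fix m :: "'i \<Rightarrow> nat" assume "m \<in> multi_indices l"
    then have "(\<Sum>i\<in>UNIV. \<mu> i + m i) + (j + i + (p - l)) = N + p + i"
      using that by (simp add: multi_indices_def sum.distrib N_def)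
    then show "(\<Prod>i\<in>UNIV. y i ^ m i / dunkl_fact (k i) (m i)) * cone_moment a k (\<lambda>i. \<mu> i + m i) (j + i + (p - l))
      = pochhammer (2 * a + 1) (N + p + i) * ((\<Prod>i\<in>UNIV. y i ^ m i / dunkl_fact (k i) (m i)) * sphere_moment a k (\<lambda>i. \<mu> i + m i))"
      by (simp only: cone_moment_def mult_ac)
  qed
  have "?L = (\<Sum>p\<le>n. \<Sum>i\<le>n - p. \<Sum>l\<le>p.
           (- 1) ^ i / fact i * laguerre_shift_coeff a s n p i / (2 ^ p * pochhammer (a + 1/2) p)
           * (s ^ (p - l) / fact (p - l)) * (pochhammer (2 * a + 1) (N + p + i) * kernel_moment a k \<mu> y l))"
  proof (intro sum.cong refl)
    fix p i l :: nat assume "l \<in> {..p}"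
    then have "l \<le> p" by simp
    show "(\<Sum>m\<in>multi_indices l.
           (- 1) ^ i / fact i * laguerre_shift_coeff a s n p i / (2 ^ p * pochhammer (a + 1/2) p)
           * (s ^ (p - l) / fact (p - l)) * (\<Prod>i\<in>UNIV. y i ^ m i / dunkl_fact (k i) (m i))
           * cone_moment a k (\<lambda>i. \<mu> i + m i) (j + i + (p - l)))
      = (- 1) ^ i / fact i * laguerre_shift_coeff a s n p i / (2 ^ p * pochhammer (a + 1/2) p)
           * (s ^ (p - l) / fact (p - l)) * (pochhammer (2 * a + 1) (N + p + i) * kernel_moment a k \<mu> y l)"
      unfolding 1[OF \<open>l \<le> p\<close>, symmetric] sum_distrib_left by (simp only: mult.assoc)
  qed
  also have "\<dots> = (\<Sum>p\<le>n. \<Sum>i\<le>n - p.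
       (pochhammer (2 * a + 1 + of_nat (N + p)) i * (- 1) ^ i / fact i * laguerre_shift_coeff a s n p i) * ?H $ p)"
    by (intro sum.cong refl) (simp add: pochhammer_product'[of _ "N + _"] sum_distrib_left sum_divide_distrib mult_ac)
  also have "\<dots> = (\<Sum>p\<le>n. (\<Sum>i\<le>n - p.
       pochhammer (2 * a + 1 + of_nat (N + p)) i * (- 1) ^ i / fact i * laguerre_shift_coeff a s n p i) * ?H $ p)"
    by (simp only: sum_distrib_right)
  \<comment> \<open>The new terms vanish, as \<open>X ^ p * w ^ i\<close> starts at degree
    \<open>p + i > n\<close>; the full range is the form required by
    \<open>sum_laguerre_shift_coeff\<close>.\<close>
  also have "\<dots> = (\<Sum>p\<le>n. (\<Sum>i\<le>n.
       pochhammer (2 * a + 1 + of_nat (N + p)) i * (- 1) ^ i / fact i * laguerre_shift_coeff a s n p i) * ?H $ p)"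
  proof (rule sum.cong[OF refl], rule arg_cong2[where f="(*)", OF _ refl])
    fix p
    show "(\<Sum>i\<le>n - p. pochhammer (2 * a + 1 + of_nat (N + p)) i * (- 1) ^ i / fact i * laguerre_shift_coeff a s n p i)
      = (\<Sum>i\<le>n. pochhammer (2 * a + 1 + of_nat (N + p)) i * (- 1) ^ i / fact i * laguerre_shift_coeff a s n p i)"
      by (rule sum.mono_neutral_left) (auto intro!: laguerre_shift_coeff_eq_0)
  qed
  also have "\<dots> = (\<Sum>p\<le>n. ?H $ p * (one_minus_X_powr (of_nat N) * (fps_exp (- s) oo geo_fps) * geo_fps ^ p) $ n)"
    unfolding sum_laguerre_shift_coeff by (intro sum.cong refl) (simp add: add.assoc mult.commute)
  also have "\<dots> = (one_minus_X_powr (of_nat N) * (fps_exp (- s) oo geo_fps) * (?H oo geo_fps)) $ n"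
    by (simp only: mult_compose_geo_nth)
  finally show ?thesis .
qed

unbundle no fps_syntax
unbundle vec_syntax

section \<open>The integral over the angle\<close>

unbundle no vec_syntax
unbundle fps_syntax

section \<open>Beta integrals and series in cosine and sine\<close>

lemma has_bochner_integral_of_has_integral:
  fixes f :: "real \<Rightarrow> real"
  assumes I: "(f has_integral I) A" and A: "A \<in> sets borel"
    and meas: "f \<in> borel_measurable borel" and nonneg: "\<And>x. x \<in> A \<Longrightarrow> f x \<ge> 0"
  shows "has_bochner_integral lborel (\<lambda>x. indicator A x *\<^sub>R f x) I"
proof -
  have eq: "(\<lambda>x. indicator A x *\<^sub>R f x) = (\<lambda>x. if x \<in> A then f x else 0)"
    by (auto simp: fun_eq_iff)
  have "((\<lambda>x. indicator A x *\<^sub>R f x) has_integral I) UNIV"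
    unfolding eq using I by (simp add: has_integral_restrict_UNIV)
  moreover have m: "(\<lambda>x. indicator A x *\<^sub>R f x) \<in> borel_measurable borel"
    using meas A by measurable
  moreover have n: "0 \<le> indicator A x *\<^sub>R f x" for x
    using nonneg by (auto simp: indicator_def)
  ultimately have "(\<integral>\<^sup>+x. ennreal (indicator A x *\<^sub>R f x) \<partial>lborel) = ennreal I"
    by (intro nn_integral_has_integral_lborel)
  moreover have "I \<ge> 0"
    using I nonneg by (rule has_integral_nonneg)
  ultimately show ?thesis
    using m n by (intro has_bochner_integral_nn_integral) auto
qed

text \<open>The substitution \<open>t = u^2\<close> in the Beta integral.\<close>

lemma has_bochner_integral_half_symmetric_beta:
  assumes y: "y > 0"
  shows "has_bochner_integral lborel (\<lambda>u::real. indicator {0..1} u *\<^sub>R (u ^ m * (1 - u\<^sup>2) powr (y - 1))) (Beta ((real m + 1) / 2) y / 2)"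
proof -
  define x where "x = (real m + 1) / 2"
  have x: "x > 0" by (simp add: x_def)
  define f where "f t = t powr (x - 1) * (1 - t) powr (y - 1)" for t :: real
  have meas: "f \<in> borel_measurable borel" unfolding f_def by measurable
  have f: "has_bochner_integral lborel (\<lambda>t. indicator {0..1} t *\<^sub>R f t) (Beta x y)"
    using has_integral_Beta_real[OF x y] meas
    by (intro has_bochner_integral_of_has_integral) (auto simp: f_def)
  have d: "((\<lambda>u. u\<^sup>2) has_real_derivative 2 * u) (at u)" for u :: real
    by (auto intro!: derivative_eq_intros)
  have int: "set_integrable lborel {(0::real)\<^sup>2..1\<^sup>2} f"
    using f by (simp add: set_integrable_def has_bochner_integral_iff)
  have 1: "set_integrable lborel {0..1::real} (\<lambda>u. f (u\<^sup>2) * (2 * u))"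
    and 2: "(LBINT x. f x * indicator {0\<^sup>2..1\<^sup>2} x) = (LBINT u. f (u\<^sup>2) * (2 * u) * indicator {0..1} u)"
    by (rule integral_substitution[OF int d]; auto intro!: continuous_intros)+
  have "has_bochner_integral lborel (\<lambda>u. indicator {0..1} u *\<^sub>R (f (u\<^sup>2) * (2 * u))) (Beta x y)"
    using 1 2 f by (simp add: has_bochner_integral_iff set_integrable_def mult.commute)
  then have "has_bochner_integral lborel (\<lambda>u. (indicator {0..1} u *\<^sub>R (f (u\<^sup>2) * (2 * u))) / 2) (Beta x y / 2)"
    by (intro has_bochner_integral_divide) auto
  moreover have "AE u in lborel. (indicator {0..1} u *\<^sub>R (f (u\<^sup>2) * (2 * u))) / 2
        = indicator {0..1} u *\<^sub>R (u ^ m * (1 - u\<^sup>2) powr (y - 1))"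
  \<comment> \<open>At \<open>u = 0\<close> the two sides differ if \<open>m = 0\<close>: the left
    one is 0, the right one is 1.\<close>
  proof (rule AE_mp[OF AE_lborel_singleton[of "0::real"]], rule AE_I2, rule impI)
    fix u :: real assume "u \<noteq> 0"
    show "(indicator {0..1} u *\<^sub>R (f (u\<^sup>2) * (2 * u))) / 2
        = indicator {0..1} u *\<^sub>R (u ^ m * (1 - u\<^sup>2) powr (y - 1))"
    proof (cases "u \<in> {0..1}")
      case True
      with \<open>u \<noteq> 0\<close> have u: "u > 0" by auto
      have "u\<^sup>2 = u powr 2" using u by simp
      then have "u\<^sup>2 powr (x - 1) * u = u powr (2 * (x - 1) + 1)"
        using u by (simp only: powr_add powr_powr powr_one)
      also have "2 * (x - 1) + 1 = real m" by (simp add: x_def field_simps)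
      finally show ?thesis using True u by (simp add: f_def powr_realpow mult_ac)
    qed simp
  qed
  ultimately show ?thesis
    unfolding x_def[symmetric]
    by (subst has_bochner_integral_cong_AE[symmetric]) (auto simp: f_def)
qed

lemma has_bochner_integral_symmetric_beta:
  assumes y: "y > 0"
  shows "has_bochner_integral lborel (\<lambda>u::real. indicator {-1..1} u *\<^sub>R (u ^ m * (1 - u\<^sup>2) powr (y - 1)))
           (if even m then Beta ((real m + 1) / 2) y else 0)"
proof -
  let ?f = "\<lambda>u::real. u ^ m * (1 - u\<^sup>2) powr (y - 1)"
  let ?I = "Beta ((real m + 1) / 2) y / 2"
  have 1: "has_bochner_integral lborel (\<lambda>u. indicator {0..1} u *\<^sub>R ?f u) ?I"
    using y by (rule has_bochner_integral_half_symmetric_beta)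
  have "has_bochner_integral lborel (\<lambda>u. indicator {0..1} (0 + (-1) * u) *\<^sub>R ?f (0 + (-1) * u)) (?I /\<^sub>R \<bar>-1\<bar>)"
    using 1 by (subst lborel_has_bochner_integral_real_affine_iff[symmetric]) auto
  then have "has_bochner_integral lborel (\<lambda>u. (-1) ^ m * (indicator {0..1} (0 + (-1) * u) *\<^sub>R ?f (0 + (-1) * u))) ((-1) ^ m * (?I /\<^sub>R \<bar>-1\<bar>))"
    by (intro has_bochner_integral_mult_right) auto
  also have "(\<lambda>u. (-1) ^ m * (indicator {0..1} (0 + (-1) * u) *\<^sub>R ?f (0 + (-1) * u))) = (\<lambda>u. indicator {-1..0} u *\<^sub>R ?f u)"
    by (rule ext, cases "even m") (auto simp: indicator_def)
  finally have 2: "has_bochner_integral lborel (\<lambda>u. indicator {-1..0} u *\<^sub>R ?f u) ((-1) ^ m * ?I)"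
    by simp
  have 3: "has_bochner_integral lborel (\<lambda>u. indicator {0..1} u *\<^sub>R ?f u + indicator {-1..0} u *\<^sub>R ?f u) (?I + (-1) ^ m * ?I)"
    using 1 2 by (rule has_bochner_integral_add)
  have "AE u in lborel. indicator {0..1} u *\<^sub>R ?f u + indicator {-1..0} u *\<^sub>R ?f u = indicator {-1..1} u *\<^sub>R ?f u"
    by (rule AE_mp[OF AE_lborel_singleton[of "0::real"]], rule AE_I2) (auto simp: indicator_def)
  with 3 have "has_bochner_integral lborel (\<lambda>u. indicator {-1..1} u *\<^sub>R ?f u) (?I + (-1) ^ m * ?I)"
    by (subst has_bochner_integral_cong_AE[symmetric]) auto
  then show ?thesis by (cases "even m") auto
qed

lemma has_bochner_integral_cos_sin:
  assumes s: "s > -1"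
  shows "has_bochner_integral lborel (\<lambda>\<theta>::real. indicator {0..pi} \<theta> *\<^sub>R (cos \<theta> ^ m * sin \<theta> powr s))
           (if even m then Beta ((real m + 1) / 2) ((s + 1) / 2) else 0)"
proof -
  let ?V = "(if even m then Beta ((real m + 1) / 2) ((s + 1) / 2) else 0)"
  \<comment> \<open>The substitution is \<open>u = - cos \<theta>\<close>, which is increasing on
    the interval; hence the sign in \<open>(- u) ^ m\<close>.\<close>
  define f where "f u = (- u) ^ m * (1 - u\<^sup>2) powr ((s + 1) / 2 - 1)" for u :: real
  have f: "has_bochner_integral lborel (\<lambda>u. indicator {-1..1} u *\<^sub>R f u) ?V"
  proof -
    have "has_bochner_integral lborel (\<lambda>u. (-1) ^ m * (indicator {-1..1} u *\<^sub>R (u ^ m * (1 - u\<^sup>2) powr ((s + 1) / 2 - 1))))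
       ((-1) ^ m * ?V)"
      using s by (intro has_bochner_integral_mult_right has_bochner_integral_symmetric_beta) auto
    also have "(\<lambda>u. (-1) ^ m * (indicator {-1..1} u *\<^sub>R (u ^ m * (1 - u\<^sup>2) powr ((s + 1) / 2 - 1)))) = (\<lambda>u. indicator {-1..1} u *\<^sub>R f u)"
    proof (rule ext)
      fix u :: real
      show "(-1) ^ m * (indicator {-1..1} u *\<^sub>R (u ^ m * (1 - u\<^sup>2) powr ((s + 1) / 2 - 1))) = indicator {-1..1} u *\<^sub>R f u"
        unfolding f_def power_minus[of u m] by (simp only: real_scaleR_def mult_ac)
    qed
    also have "((-1) ^ m * ?V) = ?V"
      by auto
    finally show ?thesis .
  qed
  have d: "((\<lambda>\<theta>. - cos \<theta>) has_real_derivative sin \<theta>) (at \<theta>)" for \<theta> :: real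
    by (auto intro!: derivative_eq_intros)
  have int: "set_integrable lborel {- cos 0..- cos pi} f"
    using f by (simp add: set_integrable_def has_bochner_integral_iff)
  have 1: "set_integrable lborel {0..pi} (\<lambda>\<theta>. f (- cos \<theta>) * sin \<theta>)"
    and 2: "(LBINT x. f x * indicator {- cos 0..- cos pi} x) = (LBINT \<theta>. f (- cos \<theta>) * sin \<theta> * indicator {0..pi} \<theta>)"
    by (rule integral_substitution[OF int d]; auto intro!: continuous_intros sin_ge_zero)+
  have "has_bochner_integral lborel (\<lambda>\<theta>. indicator {0..pi} \<theta> *\<^sub>R (f (- cos \<theta>) * sin \<theta>)) ?V"
    using 1 2 f by (simp add: has_bochner_integral_iff set_integrable_def mult.commute)
  also have "(\<lambda>\<theta>. indicator {0..pi} \<theta> *\<^sub>R (f (- cos \<theta>) * sin \<theta>)) = (\<lambda>\<theta>. indicator {0..pi} \<theta> *\<^sub>R (cos \<theta> ^ m * sin \<theta> powr s))"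
  proof (rule ext)
    fix \<theta> :: real
    \<comment> \<open>Where the sine is zero both sides vanish, the right one because
      \<open>0 powr s = 0\<close>.\<close>
    show "indicator {0..pi} \<theta> *\<^sub>R (f (- cos \<theta>) * sin \<theta>) = indicator {0..pi} \<theta> *\<^sub>R (cos \<theta> ^ m * sin \<theta> powr s)"
    proof (cases "\<theta> \<in> {0..pi} \<and> sin \<theta> \<noteq> 0")
      case True
      then have pos: "sin \<theta> > 0" using sin_ge_zero[of \<theta>] by auto
      have "1 - (cos \<theta>)\<^sup>2 = sin \<theta> powr 2" using pos by (simp add: sin_squared_eq)
      then have "(1 - (cos \<theta>)\<^sup>2) powr ((s + 1) / 2 - 1) * sin \<theta> = sin \<theta> powr (2 * ((s + 1) / 2 - 1) + 1)"
        using pos by (simp only: powr_powr powr_add powr_one)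
      also have "2 * ((s + 1) / 2 - 1) + 1 = s" by (simp add: field_simps)
      finally show ?thesis by (simp add: f_def mult.assoc)
    next
      case False
      then show ?thesis by auto
    qed
  qed
  finally show ?thesis .
qed

lemma sums_even_iff:
  fixes f :: "nat \<Rightarrow> 'a::real_normed_vector"
  assumes "\<And>n. odd n \<Longrightarrow> f n = 0"
  shows "(\<lambda>n. f (2 * n)) sums c \<longleftrightarrow> f sums c"
proof (rule sums_mono_reindex)
  fix n :: nat assume "n \<notin> range ((*) 2)"
  then have "odd n" by (metis evenE rangeI)
  then show "f n = 0" by (rule assms)
qed (simp add: strict_mono_def)

text \<open>The Cauchy product sorts the double series by total degree and each term is a Beta
  integral. Terms with an odd power of the cosine integrate to zero, so only even total degree
  remains.\<close>

lemma sums_integral_cos_sin_series: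
  fixes A b :: "nat \<Rightarrow> real"
  assumes s: "s > -1" and A: "summable (\<lambda>p. \<bar>A p\<bar>)" and b: "summable (\<lambda>m. \<bar>b m\<bar>)"
  shows "(\<lambda>k. \<Sum>m\<le>k. A (2 * (k - m)) * b m * Beta (real (k - m) + 1/2) (real m + (s + 1) / 2))
    sums (LINT \<theta>:{0..pi}|lborel. (\<Sum>p. A p * cos \<theta> ^ p) * (\<Sum>m. b m * sin \<theta> ^ (2 * m)) * sin \<theta> powr s)"
proof -
  let ?v = "\<lambda>N i. Beta ((real i + 1) / 2) ((real (N - i) + s + 1) / 2)"
  let ?g = "\<lambda>x. (\<Sum>p. A p * cos x ^ p) * (\<Sum>m. b m * sin x ^ (2 * m)) * sin x powr s"
  \<comment> \<open>Spreads \<open>b\<close> over the even indices, so that both factors are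
    ordinary power series.\<close>
  define B where "B q = (if even q then b (q div 2) else 0)" for q
  have B: "summable (\<lambda>q. \<bar>B q\<bar>)"
  proof -
    have "(\<lambda>n. \<bar>B (2 * n)\<bar>) sums (\<Sum>m. \<bar>b m\<bar>)"
      using b by (simp add: B_def summable_sums)
    then have "(\<lambda>q. \<bar>B q\<bar>) sums (\<Sum>m. \<bar>b m\<bar>)"
      by (subst (asm) sums_even_iff) (auto simp: B_def)
    then show ?thesis by (rule sums_summable)
  qed
  define T where "T N \<theta> = (\<Sum>i\<le>N. A i * cos \<theta> ^ i * (B (N - i) * sin \<theta> ^ (N - i)))" for N and \<theta> :: real
  define F where "F N \<theta> = indicator {0..pi} \<theta> *\<^sub>R (T N \<theta> * sin \<theta> powr s)" for N \<theta>
  \<comment> \<open>A summable majorant independent of \<theta>; what it leaves is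
    \<open>sin \<theta> powr s\<close>, integrable since \<open>s > -1\<close>.\<close>
  define D where "D N = (\<Sum>i\<le>N. \<bar>A i\<bar> * \<bar>B (N - i)\<bar>)" for N
  define V where "V N = (\<Sum>i\<le>N. A i * B (N - i) * (if even i then ?v N i else 0))" for N
  have D: "summable D"
    unfolding D_def by (rule summable_Cauchy_product) (use A B in simp_all)
  have T_le: "\<bar>T N \<theta>\<bar> \<le> D N" for N \<theta>
    unfolding T_def D_def
  proof (rule order.trans[OF sum_abs sum_mono])
    fix i
    have "\<bar>cos \<theta> ^ i\<bar> \<le> 1" "\<bar>sin \<theta> ^ (N - i)\<bar> \<le> 1"
      by (simp_all add: power_abs power_le_one)
    then have "\<bar>A i\<bar> * \<bar>cos \<theta> ^ i\<bar> * (\<bar>B (N - i)\<bar> * \<bar>sin \<theta> ^ (N - i)\<bar>) \<le> \<bar>A i\<bar> * 1 * (\<bar>B (N - i)\<bar> * 1)"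
      by (intro mult_mono mult_nonneg_nonneg order.refl) auto
    then show "\<bar>A i * cos \<theta> ^ i * (B (N - i) * sin \<theta> ^ (N - i))\<bar> \<le> \<bar>A i\<bar> * \<bar>B (N - i)\<bar>"
      by (simp add: abs_mult)
  qed
  have HF: "has_bochner_integral lborel (F N) (V N)" for N
  proof -
    have "has_bochner_integral lborel (\<lambda>\<theta>. \<Sum>i\<le>N. A i * B (N - i) * (indicator {0..pi} \<theta> *\<^sub>R (cos \<theta> ^ i * sin \<theta> powr (real (N - i) + s)))) (V N)"
      unfolding V_def
      by (intro has_bochner_integral_sum has_bochner_integral_mult_right has_bochner_integral_cos_sin)
        (use s in auto)
    also have "(\<lambda>\<theta>. \<Sum>i\<le>N. A i * B (N - i) * (indicator {0..pi} \<theta> *\<^sub>R (cos \<theta> ^ i * sin \<theta> powr (real (N - i) + s)))) = F N"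
    proof (rule ext)
      fix \<theta>
      show "(\<Sum>i\<le>N. A i * B (N - i) * (indicator {0..pi} \<theta> *\<^sub>R (cos \<theta> ^ i * sin \<theta> powr (real (N - i) + s)))) = F N \<theta>"
      proof (cases "\<theta> \<in> {0..pi}")
        case True
        then have "sin \<theta> \<ge> 0" using sin_ge_zero by auto
        then have "sin \<theta> powr (real q + s) = sin \<theta> ^ q * sin \<theta> powr s" for q
          by (cases "sin \<theta> = 0") (auto simp: powr_add powr_realpow)
        then show ?thesis using True
          by (simp add: F_def T_def sum_distrib_right sum_distrib_left mult_ac del: of_nat_diff)
      qed (simp add: F_def)
    qed
    finally show ?thesis .
  qed
  have W: "has_bochner_integral lborel (\<lambda>\<theta>::real. indicator {0..pi} \<theta> *\<^sub>R (sin \<theta> powr s)) (Beta (1 / 2) ((s + 1) / 2))"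
    using has_bochner_integral_cos_sin[OF s, of 0] by simp
  have F_le: "norm (F N \<theta>) \<le> D N * (indicator {0..pi} \<theta> *\<^sub>R (sin \<theta> powr s))" for N \<theta>
    using mult_right_mono[OF T_le[of N \<theta>], of "sin \<theta> powr s"] by (simp add: F_def abs_mult indicator_def)
  have "(\<lambda>N. integral\<^sup>L lborel (F N)) sums (LINT \<theta>|lborel. (\<Sum>N. F N \<theta>))"
  proof (rule sums_integral)
    show "integrable lborel (F N)" for N using HF by (simp add: has_bochner_integral_iff)
    show "AE \<theta> in lborel. summable (\<lambda>N. norm (F N \<theta>))"
      by (rule AE_I2, rule summable_comparison_test'[OF summable_mult2[OF D], of 0]) (use F_le in auto)
    show "summable (\<lambda>N. LINT \<theta>|lborel. norm (F N \<theta>))"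
    proof (rule summable_comparison_test'[OF summable_mult2[OF D], of 0])
      fix N
      have "(LINT \<theta>|lborel. norm (F N \<theta>)) \<le> (LINT \<theta>|lborel. D N * (indicator {0..pi} \<theta> *\<^sub>R (sin \<theta> powr s)))"
        using HF W F_le by (intro integral_mono integrable_norm integrable_mult_right) (auto simp: has_bochner_integral_iff)
      then show "norm (LINT \<theta>|lborel. norm (F N \<theta>)) \<le> D N * Beta (1 / 2) ((s + 1) / 2)"
        using W by (simp add: has_bochner_integral_iff)
    qed
  qed
  moreover have "integral\<^sup>L lborel (F N) = V N" for N
    using HF by (simp add: has_bochner_integral_iff)
  moreover have "(\<lambda>\<theta>. \<Sum>N. F N \<theta>) = (\<lambda>\<theta>. indicator {0..pi} \<theta> *\<^sub>R (?g \<theta>))"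
  proof (rule ext)
    fix \<theta>
    have a1: "summable (\<lambda>p. norm (A p * cos \<theta> ^ p))"
    proof (rule summable_comparison_test'[OF A, of 0])
      fix p
      have "\<bar>cos \<theta> ^ p\<bar> \<le> 1" by (simp add: power_abs power_le_one)
      then show "norm (norm (A p * cos \<theta> ^ p)) \<le> \<bar>A p\<bar>"
        by (simp add: abs_mult mult_left_le)
    qed
    have b1: "summable (\<lambda>p. norm (B p * sin \<theta> ^ p))"
    proof (rule summable_comparison_test'[OF B, of 0])
      fix p
      have "\<bar>sin \<theta> ^ p\<bar> \<le> 1" by (simp add: power_abs power_le_one)
      then show "norm (norm (B p * sin \<theta> ^ p)) \<le> \<bar>B p\<bar>"
        by (simp add: abs_mult mult_left_le)
    qed
    have "(\<lambda>N. T N \<theta>) sums ((\<Sum>p. A p * cos \<theta> ^ p) * (\<Sum>q. B q * sin \<theta> ^ q))"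
      unfolding T_def by (rule Cauchy_product_sums[OF a1 b1])
    moreover have "(\<Sum>q. B q * sin \<theta> ^ q) = (\<Sum>m. b m * sin \<theta> ^ (2 * m))"
    proof -
      have "(\<lambda>q. B q * sin \<theta> ^ q) sums (\<Sum>q. B q * sin \<theta> ^ q)"
        by (rule summable_sums[OF summable_norm_cancel[OF b1]])
      then have "(\<lambda>m. B (2 * m) * sin \<theta> ^ (2 * m)) sums (\<Sum>q. B q * sin \<theta> ^ q)"
        by (subst sums_even_iff) (auto simp: B_def)
      then show ?thesis by (simp add: B_def sums_iff)
    qed
    ultimately have "(\<lambda>N. F N \<theta>) sums (indicator {0..pi} \<theta> *\<^sub>R (?g \<theta>))"
      unfolding F_def by (intro sums_scaleR_right sums_mult2) simp
    then show "(\<Sum>N. F N \<theta>) = indicator {0..pi} \<theta> *\<^sub>R (?g \<theta>)"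
      by (simp only: sums_iff)
  qed
  ultimately have sV: "V sums (LINT \<theta>:{0..pi}|lborel. ?g \<theta>)"
    by (simp only: set_lebesgue_integral_def)
  have "V N = 0" if "odd N" for N
    unfolding V_def by (rule sum.neutral) (use that in \<open>auto simp: B_def\<close>)
  with sV have "(\<lambda>k. V (2 * k)) sums (LINT \<theta>:{0..pi}|lborel. ?g \<theta>)"
    by (subst sums_even_iff) auto
  moreover have "V (2 * k) = (\<Sum>m\<le>k. A (2 * (k - m)) * b m * Beta (real (k - m) + 1/2) (real m + (s + 1) / 2))" for k
  proof -
    let ?w = "\<lambda>m. A (2 * (k - m)) * b m * Beta (real (k - m) + 1/2) (real m + (s + 1) / 2)"
    \<comment> \<open>Reindexed by \<open>i = 2 * (k - m)\<close>, which leaves the power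
      \<open>2 * m\<close> to the sine.\<close>
    have "V (2 * k) = (\<Sum>i\<in>(\<lambda>m. 2 * (k - m)) ` {..k}. A i * B (2 * k - i) * (if even i then ?v (2 * k) i else 0))"
      unfolding V_def
    proof (rule sum.mono_neutral_right)
      show "\<forall>i\<in>{..2 * k} - (\<lambda>m. 2 * (k - m)) ` {..k}. A i * B (2 * k - i) * (if even i then ?v (2 * k) i else 0) = 0"
      proof
        fix i assume i: "i \<in> {..2 * k} - (\<lambda>m. 2 * (k - m)) ` {..k}"
        have "odd i"
        proof
          assume "even i"
          then obtain j where "i = 2 * j" by (elim evenE)
          then have "i = 2 * (k - (k - j))" using i by auto
          moreover have "k - j \<in> {..k}" by simp
          ultimately have 1: "i \<in> (\<lambda>m. 2 * (k - m)) ` {..k}" by (rule image_eqI[where x = "k - j"])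
          have 2: "i \<notin> (\<lambda>m. 2 * (k - m)) ` {..k}" using i by (simp only: Diff_iff simp_thms)
          show False by (rule notE[OF 2 1])
        qed
        then show "A i * B (2 * k - i) * (if even i then ?v (2 * k) i else 0) = 0"
          by (simp only: if_False mult_zero_right)
      qed
    qed auto
    also have "\<dots> = (\<Sum>m\<le>k. A (2 * (k - m)) * B (2 * k - 2 * (k - m)) * Beta ((real (2 * (k - m)) + 1) / 2) ((real (2 * k - 2 * (k - m)) + s + 1) / 2))"
    proof (subst sum.reindex)
      show "inj_on (\<lambda>m. 2 * (k - m)) {..k}" by (auto simp: inj_on_def)
    qed (simp only: o_def dvd_triv_left if_True)
    also have "\<dots> = (\<Sum>m\<le>k. ?w m)"
    proof (rule sum.cong[OF refl])
      fix m assume "m \<in> {..k}"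
      then have 1: "2 * k - 2 * (k - m) = 2 * m" by auto
      have B2: "B (2 * m) = b m" by (simp add: B_def)
      have h: "(real (2 * i) + c) / 2 = real i + c / 2" for i c by (simp add: add_divide_distrib)
      have 2: "(real (2 * (k - m)) + 1) / 2 = real (k - m) + 1/2" "(real (2 * m) + s + 1) / 2 = real m + (s + 1) / 2"
        using h[of "k - m" 1] h[of m "s + 1"] by (simp_all only: add.assoc)
      show "A (2 * (k - m)) * B (2 * k - 2 * (k - m)) * Beta ((real (2 * (k - m)) + 1) / 2) ((real (2 * k - 2 * (k - m)) + s + 1) / 2)
        = ?w m"
        unfolding 1 2 by (simp only: B2)
    qed
    finally show ?thesis .
  qed
  ultimately show ?thesis by simp
qed


section \<open>Power series of the Bessel and Laguerre factors\<close>

text \<open>The coefficients of \<open>bessel_j a z\<close> in powers of \<open>(z / 2)^2\<close>;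
  the factor \<open>2 powr (- a)\<close> is what remains of \<open>(z / 2) powr a\<close> after
  removal of \<open>z powr a\<close>.\<close>

definition bessel_coeff :: "real \<Rightarrow> nat \<Rightarrow> real" where
  "bessel_coeff a m = 2 powr (- a) * ((- 1) ^ m / fact m * rGamma (real m + a + 1))"

text \<open>\<open>rGamma (m + a + 1)\<close> is \<open>rGamma (a + 1)\<close> divided by a
  Pochhammer symbol. The latter is bounded below by \<open>min 1 (a + 1)\<close>; the minimum
  matters for negative \<open>a\<close>, where the first factor is less than 1.\<close>

lemma abs_rGamma_bounded:
  assumes a: "a > (-1::real)"
  obtains K where "\<And>m. \<bar>rGamma (real m + a + 1)\<bar> \<le> K"
proof -
  define d where "d = min 1 (a + 1)"
  have d: "d > 0" using a by (simp add: d_def)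
  have poch: "pochhammer (a + 1) m \<ge> d" for m
  proof (cases m)
    case (Suc n)
    have "pochhammer (a + 1 + 1) n \<ge> 1"
    proof (induction n)
      case (Suc n)
      have "1 * 1 \<le> pochhammer (a + 1 + 1) n * (a + 1 + 1 + real n)"
        using Suc a by (intro mult_mono) auto
      then show ?case by (simp add: pochhammer_Suc)
    qed simp
    then have "(a + 1) * 1 \<le> (a + 1) * pochhammer (a + 1 + 1) n"
      using a by (intro mult_left_mono) auto
    then have "a + 1 \<le> pochhammer (a + 1) m"
      unfolding Suc pochhammer_rec by simp
    moreover have "d \<le> a + 1" by (simp add: d_def)
    ultimately show ?thesis by linarith
  qed (simp add: d_def)
  have "\<bar>rGamma (real m + a + 1)\<bar> \<le> \<bar>rGamma (a + 1)\<bar> / d" for m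
  proof -
    have "rGamma (a + 1) = pochhammer (a + 1) m * rGamma (real m + a + 1)"
      using pochhammer_rGamma[of "a + 1" m] by (simp add: add_ac)
    then have "\<bar>rGamma (a + 1)\<bar> = pochhammer (a + 1) m * \<bar>rGamma (real m + a + 1)\<bar>"
      using poch[of m] d by (simp add: abs_mult)
    also have "\<dots> \<ge> d * \<bar>rGamma (real m + a + 1)\<bar>"
      using poch[of m] by (intro mult_right_mono) auto
    finally show ?thesis using d by (simp add: field_simps)
  qed
  then show ?thesis using that by blast
qed

lemma summable_bessel_coeff:
  assumes a: "a > -1"
  shows "summable (\<lambda>m. \<bar>bessel_coeff a m * x ^ m\<bar>)"
proof -
  obtain K where K: "\<And>m. \<bar>rGamma (real m + a + 1)\<bar> \<le> K"
    using abs_rGamma_bounded[OF a] by blast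
  have "summable (\<lambda>m. 2 powr (- a) * K * (\<bar>x\<bar> ^ m /\<^sub>R fact m))"
    by (intro summable_mult summable_exp_generic)
  then show ?thesis
  proof (rule summable_comparison_test'[of _ 0])
    fix m
    have "\<bar>bessel_coeff a m * x ^ m\<bar> = 2 powr (- a) * \<bar>rGamma (real m + a + 1)\<bar> * (\<bar>x\<bar> ^ m / fact m)"
      by (simp add: bessel_coeff_def abs_mult power_abs)
    also have "\<dots> \<le> 2 powr (- a) * K * (\<bar>x\<bar> ^ m / fact m)"
      using K by (intro mult_right_mono mult_left_mono) auto
    finally show "norm \<bar>bessel_coeff a m * x ^ m\<bar> \<le> 2 powr (- a) * K * (\<bar>x\<bar> ^ m /\<^sub>R fact m)"
      by (simp add: field_simps)
  qed
qed

lemma bessel_j_eq_suminf: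
  assumes a: "a > -1" and z: "z \<ge> 0"
  shows "bessel_j a z = (\<Sum>m. bessel_coeff a m * ((z / 2)\<^sup>2) ^ m)"
proof -
  have sm: "summable (\<lambda>m. bessel_coeff a m * x ^ m)" for x
    by (rule summable_rabs_cancel[OF summable_bessel_coeff[OF a]])
  have pos: "z powr (- a) * bessel_J a z = (\<Sum>m. bessel_coeff a m * ((z / 2)\<^sup>2) ^ m)" if "z > 0" for z
  proof -
    have "bessel_J a z = (\<Sum>m. z powr a * (bessel_coeff a m * ((z / 2)\<^sup>2) ^ m))"
      unfolding bessel_J_def
    proof (rule suminf_cong)
      fix m
      have "(z / 2) powr (2 * real m + a) = (z / 2) powr (real (2 * m)) * (z powr a / 2 powr a)"
        using that by (simp add: powr_add powr_divide)
      also have "(z / 2) powr (real (2 * m)) = ((z / 2)\<^sup>2) ^ m"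
        using that by (subst powr_realpow) (auto simp: power_mult)
      finally have *: "(z / 2) powr (2 * real m + a) = ((z / 2)\<^sup>2) ^ m * (z powr a / 2 powr a)" .
      show "(- 1) ^ m / fact m * rGamma (real m + a + 1) * (z / 2) powr (2 * real m + a) =
        z powr a * (bessel_coeff a m * ((z / 2)\<^sup>2) ^ m)"
        unfolding * bessel_coeff_def powr_minus by (simp only: divide_inverse mult_ac)
    qed
    also have "\<dots> = z powr a * (\<Sum>m. bessel_coeff a m * ((z / 2)\<^sup>2) ^ m)"
      by (rule suminf_mult[OF sm])
    finally show ?thesis using that by (simp add: powr_minus field_simps)
  qed
  show ?thesis
  proof (cases "z = 0")
    case True
    \<comment> \<open>At zero, \<open>bessel_j\<close> is a one-sided limit by definition, and
      continuity of the power series evaluates it.\<close>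
    have "isCont (\<lambda>x. \<Sum>m. bessel_coeff a m * x ^ m) 0"
      by (rule isCont_powser[OF sm[of 1]]) simp
    then have "((\<lambda>x. \<Sum>m. bessel_coeff a m * x ^ m) \<longlongrightarrow> (\<Sum>m. bessel_coeff a m * 0 ^ m)) (at 0)"
      by (simp add: isCont_def)
    moreover have "filterlim (\<lambda>w. (w / 2)\<^sup>2) (at 0) (at_right (0::real))"
      unfolding filterlim_at by (auto intro!: tendsto_eq_intros simp: eventually_at_filter)
    ultimately have "((\<lambda>w. \<Sum>m. bessel_coeff a m * ((w / 2)\<^sup>2) ^ m) \<longlongrightarrow> (\<Sum>m. bessel_coeff a m * 0 ^ m)) (at_right 0)"
      by (rule filterlim_compose)
    moreover have "eventually (\<lambda>w. (\<Sum>m. bessel_coeff a m * ((w / 2)\<^sup>2) ^ m) = w powr (- a) * bessel_J a w) (at_right 0)"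
      by (auto simp: eventually_at_filter pos)
    ultimately have "((\<lambda>w. w powr (- a) * bessel_J a w) \<longlongrightarrow> (\<Sum>m. bessel_coeff a m * 0 ^ m)) (at_right 0)"
      by (rule Lim_transform_eventually)
    then have "Lim (at_right 0) (\<lambda>w. w powr (- a) * bessel_J a w) = (\<Sum>m. bessel_coeff a m * 0 ^ m)"
      by (intro tendsto_Lim) auto
    then show ?thesis by (simp only: bessel_j_def True if_True) simp
  next
    case False
    with z pos[of z] show ?thesis by (simp add: bessel_j_def)
  qed
qed

text \<open>The coefficient of \<open>c ^ p\<close> in
  \<open>L(X + 2 \<rho> c) exp (- \<rho> c)\<close>, where \<open>c\<close> will be the
  cosine.\<close>

definition laguerre_exp_coeff :: "real \<Rightarrow> real \<Rightarrow> nat \<Rightarrow> real \<Rightarrow> nat \<Rightarrow> real" where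
  "laguerre_exp_coeff a X n \<rho> p =
     (\<Sum>j\<le>n. laguerre_shift_coeff a X n 0 j * (real (p choose j) * 2 ^ j * (- \<rho>) ^ p / fact p))"

text \<open>The Laguerre factor is a polynomial in \<open>- 2 * \<rho> * c\<close>, and
  \<open>x ^ j / j! * exp x\<close> has the coefficients \<open>(p choose j) / p!\<close>.\<close>

lemma laguerre_exp_sums:
  "(\<lambda>p. laguerre_exp_coeff a X n \<rho> p * c ^ p) sums (laguerre n (2 * a) (X + 2 * \<rho> * c) * exp (- \<rho> * c))"
proof -
  have 1: "(\<lambda>p. real (p choose j) * x ^ p / fact p) sums (x ^ j / fact j * exp x)" for j and x :: real
  proof -
    have "(\<lambda>p. x ^ j / fact j * (x ^ p /\<^sub>R fact p)) sums (x ^ j / fact j * exp x)"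
      by (intro sums_mult exp_converges)
    also have "(\<lambda>p. x ^ j / fact j * (x ^ p /\<^sub>R fact p)) = (\<lambda>p. real ((p + j) choose j) * x ^ (p + j) / fact (p + j))"
      by (rule ext) (simp add: binomial_fact power_add field_simps)
    finally show ?thesis
      by (subst (asm) sums_zero_iff_shift) auto
  qed
  let ?l = "\<lambda>j. laguerre_shift_coeff a X n 0 j"
  have "(\<lambda>p. \<Sum>j\<le>n. ?l j * 2 ^ j * (real (p choose j) * (- \<rho> * c) ^ p / fact p))
      sums (\<Sum>j\<le>n. ?l j * 2 ^ j * ((- \<rho> * c) ^ j / fact j * exp (- \<rho> * c)))"
    by (intro sums_sum sums_mult 1)
  also have "(\<lambda>p. \<Sum>j\<le>n. ?l j * 2 ^ j * (real (p choose j) * (- \<rho> * c) ^ p / fact p))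
     = (\<lambda>p. laguerre_exp_coeff a X n \<rho> p * c ^ p)"
    unfolding laguerre_exp_coeff_def sum_distrib_right power_mult_distrib
    by (simp only: mult_ac times_divide_eq_left times_divide_eq_right)
  also have "(\<Sum>j\<le>n. ?l j * 2 ^ j * ((- \<rho> * c) ^ j / fact j * exp (- \<rho> * c)))
    = (\<Sum>j\<le>n. (- (2 * \<rho> * c)) ^ j / fact j * ?l j) * exp (- \<rho> * c)"
    unfolding sum_distrib_right
  proof (rule sum.cong[OF refl])
    fix j
    have "- (2 * \<rho> * c) = 2 * (- \<rho> * c)" by simp
    then have "(- (2 * \<rho> * c)) ^ j = 2 ^ j * (- \<rho> * c) ^ j" by (simp only: power_mult_distrib)
    then show "?l j * 2 ^ j * ((- \<rho> * c) ^ j / fact j * exp (- \<rho> * c))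
      = (- (2 * \<rho> * c)) ^ j / fact j * ?l j * exp (- \<rho> * c)"
      by (simp only:) (simp only: mult_ac times_divide_eq_left times_divide_eq_right)
  qed
  also have "(\<Sum>j\<le>n. (- (2 * \<rho> * c)) ^ j / fact j * ?l j) = laguerre n (2 * a) (X + 2 * \<rho> * c)"
    using laguerre_shift[of 0 n a "2 * \<rho> * c" X] by (simp add: add.commute)
  finally show ?thesis .
qed

lemma summable_laguerre_exp_coeff: "summable (\<lambda>p. \<bar>laguerre_exp_coeff a X n \<rho> p\<bar>)"
  using powser_insidea[OF sums_summable[OF laguerre_exp_sums[of a X n \<rho> 2]], of 1] by simp

text \<open>The binomial expansion of \<open>(Y - 1) ^ k\<close> with
  \<open>Y = (1 + 2 X)^2\<close>, whose powers have the coefficients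
  \<open>((2 i) choose j) * 2 ^ j\<close>.\<close>

lemma sum_binomial_shift:
  "(\<Sum>m\<le>k. (- 1) ^ m / (fact m * fact (k - m)) * real ((2 * (k - m)) choose j) * 2 ^ j)
     = 4 ^ k / fact k * (((fps_X + fps_X ^ 2) ^ k :: real fps) $ j)"
proof -
  define Y :: "real fps" where "Y = (1 + 2 * fps_X) ^ 2"
  have "4 * (fps_X + fps_X ^ 2) = Y - (1 :: real fps)"
    by (simp add: Y_def algebra_simps power2_eq_square)
  then have "(4 * (fps_X + fps_X ^ 2)) ^ k = ((-1) + Y) ^ k" by simp
  also have "\<dots> = (\<Sum>m\<le>k. of_nat (k choose m) * (-1) ^ m * Y ^ (k - m))"
    by (rule binomial_ring)
  finally have 1: "(4 * (fps_X + fps_X ^ 2)) ^ k = (\<Sum>m\<le>k. of_nat (k choose m) * (-1) ^ m * Y ^ (k - m))" .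
  have Y: "(Y ^ i) $ j = real ((2 * i) choose j) * 2 ^ j" for i
  proof -
    have "Y ^ i = fps_binomial (of_nat (2 * i)) oo (fps_const 2 * fps_X)"
      unfolding Y_def fps_binomial_of_nat
      by (simp add: fps_compose_power[symmetric] fps_compose_add_distrib power_mult numeral_fps_const)
    then show ?thesis
      by (simp add: fps_compose_linear binomial_gbinomial del: of_nat_mult)
  qed
  have "4 ^ k * (((fps_X + fps_X ^ 2) ^ k :: real fps) $ j) = ((4 * (fps_X + fps_X ^ 2)) ^ k :: real fps) $ j"
    by (simp add: power_mult_distrib numeral_fps_const fps_const_power)
  also have "\<dots> = (\<Sum>m\<le>k. real (k choose m) * (-1) ^ m * (real ((2 * (k - m)) choose j) * 2 ^ j))"
    unfolding 1 fps_sum_nth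
  proof (rule sum.cong[OF refl])
    fix m
    have "of_nat (k choose m) * (-1) ^ m * Y ^ (k - m) = fps_const (real (k choose m) * (-1) ^ m) * Y ^ (k - m)"
    proof -
      have "fps_const (real (k choose m) * (-1) ^ m) = fps_const (real (k choose m)) * fps_const (-1) ^ m"
        by (simp only: fps_const_power fps_const_mult)
      also have "fps_const (-1 :: real) = -1" by (metis fps_const_neg fps_const_1_eq_1)
      finally show ?thesis by (simp only: fps_of_nat)
    qed
    then have "(of_nat (k choose m) * (-1) ^ m * Y ^ (k - m)) $ j = (fps_const (real (k choose m) * (-1) ^ m) * Y ^ (k - m)) $ j"
      by (simp only:)
    then show "(of_nat (k choose m) * (-1) ^ m * Y ^ (k - m)) $ j = real (k choose m) * (-1) ^ m * (real ((2 * (k - m)) choose j) * 2 ^ j)"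
      by (simp only: fps_mult_left_const_nth Y)
  qed
  also have "\<dots> = fact k * (\<Sum>m\<le>k. (- 1) ^ m / (fact m * fact (k - m)) * real ((2 * (k - m)) choose j) * 2 ^ j)"
    unfolding sum_distrib_left by (rule sum.cong[OF refl]) (simp add: binomial_fact field_simps)
  finally show ?thesis by (simp add: field_simps)
qed

lemma geo_fps_add_square: "geo_fps + geo_fps ^ 2 = fps_X * one_minus_X_powr (- 2)"
proof -
  define J where "J = one_minus_X_powr (-1)"
  have J: "(1 - fps_X) * J = 1"
    using one_minus_X_powr_add[of 1 "-1"] by (simp add: one_minus_X_powr_1 J_def)
  have w: "geo_fps = fps_X * J" by (simp add: geo_fps_altdef J_def)
  have "one_minus_X_powr (- 2) = J * J"
    using one_minus_X_powr_add[of "-1" "-1"] by (simp add: J_def)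
  moreover have "1 + fps_X * J = J" using J by (simp add: algebra_simps)
  then have "J * (fps_X * J) + J = J * J" by (metis distrib_left mult.right_neutral add.commute)
  then have "fps_X * (J * (fps_X * J) + J) = fps_X * (J * J)" by (simp only:)
  ultimately show ?thesis unfolding w by (simp add: algebra_simps power2_eq_square)
qed

lemma one_minus_X_powr_power: "one_minus_X_powr c ^ k = one_minus_X_powr (of_nat k * c)"
  by (induction k) (simp_all add: one_minus_X_powr_add algebra_simps)

text \<open>Substituting \<open>w\<close> for the variable turns \<open>w + w^2\<close> into
  \<open>X / (1 - X)^2\<close>. Its \<open>k\<close>-th power lowers the degree of the Laguerre
  polynomial by \<open>k\<close> and raises its parameter by \<open>2 * k\<close>.\<close>

lemma sum_laguerre_shift_coeff_power:
  assumes "k \<le> n"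
  shows "(\<Sum>j\<le>n. laguerre_shift_coeff a X n 0 j * (((fps_X + fps_X ^ 2) ^ k :: real fps) $ j))
    = laguerre (n - k) (2 * a + 2 * of_nat k) X"
proof -
  have "(\<Sum>j\<le>n. laguerre_shift_coeff a X n 0 j * (((fps_X + fps_X ^ 2) ^ k :: real fps) $ j))
    = ((one_minus_X_powr (- 2 * a - 1) * (fps_exp (- X) oo geo_fps)) * ((fps_X + fps_X ^ 2) ^ k oo geo_fps)) $ n"
    unfolding mult_compose_geo_nth laguerre_shift_coeff_def
    by (rule sum.cong[OF refl]) simp
  also have "(fps_X + fps_X ^ 2) ^ k oo geo_fps = (geo_fps + geo_fps ^ 2) ^ k"
    by (simp add: fps_compose_power[symmetric] fps_compose_add_distrib)
  also have "\<dots> = fps_X ^ k * one_minus_X_powr (- 2 * of_nat k)"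
    unfolding geo_fps_add_square power_mult_distrib one_minus_X_powr_power by (simp add: mult.commute)
  also have "one_minus_X_powr (- 2 * a - 1) * (fps_exp (- X) oo geo_fps) * (fps_X ^ k * one_minus_X_powr (- 2 * of_nat k))
     = fps_X ^ k * (one_minus_X_powr (- 2 * a - 1) * one_minus_X_powr (- 2 * of_nat k)) * (fps_exp (- X) oo geo_fps) * geo_fps ^ 0"
    by (simp only: mult_ac power_0 mult_1_right mult_1_left)
  also have "one_minus_X_powr (- 2 * a - 1) * one_minus_X_powr (- 2 * of_nat k) = one_minus_X_powr (- 2 * a - 1 - 2 * of_nat k)"
    by (simp add: one_minus_X_powr_add[symmetric] algebra_simps)
  finally have "(\<Sum>j\<le>n. laguerre_shift_coeff a X n 0 j * (((fps_X + fps_X ^ 2) ^ k :: real fps) $ j))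
    = laguerre_shift_coeff a X n k 0"
    by (simp only: laguerre_shift_coeff_def)
  \<comment> \<open>With argument shift \<open>t = 0\<close>, only \<open>i = 0\<close> survives in
    \<open>laguerre_shift\<close>, because \<open>0 ^ 0 = 1\<close>.\<close>
  moreover have "(\<Sum>i\<le>N. (- 0) ^ i / fact i * f i) = f 0" for N and f :: "nat \<Rightarrow> real"
    by (induction N) auto
  ultimately show ?thesis
    using laguerre_shift[OF assms, of a 0 X] by (simp only: add_0_left)
qed

text \<open>
  Up to a constant, the left-hand side is the coefficient of \<open>\<rho>\<^sup>2\<^sup>k\<close> in the \<open>\<theta>\<close>-integral; the inner alternating sum
  over \<open>m\<close> is a coefficient of \<open>((1 + 2w)\<^sup>2 - 1)\<^sup>k = 4\<^sup>k (w + w\<^sup>2)\<^sup>k\<close>.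
\<close>

lemma laguerre_bessel_coeff_sum:
  assumes a: "a \<ge> 0"
  shows "(\<Sum>m\<le>k. laguerre_exp_coeff a X n \<rho> (2 * (k - m)) * ((- 1) ^ m * (\<rho>\<^sup>2 / 4) ^ m / fact m)
            * (Gamma (real (k - m) + 1/2) / Gamma (real k + a + 1/2)))
     = (if k \<le> n then sqrt pi / Gamma (a + 1/2) * (laguerre (n - k) (2 * a + 2 * of_nat k) X * \<rho> ^ (2 * k) / (fact k * pochhammer (a + 1/2) k)) else 0)"
proof -
  \<comment> \<open>The \<open>(2 * i)!\<close> cancels the factorial in
    \<open>laguerre_exp_coeff\<close>; the \<open>4 ^ i\<close> matches the powers of
    \<open>\<rho>^2 / 4\<close>.\<close>
  have G: "Gamma (real i + 1/2) = sqrt pi * fact (2 * i) / (4 ^ i * fact i)" for i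
  proof -
    have "Gamma (1/2 + real i) = pochhammer (1/2) i * Gamma (1/2 :: real)"
      by (subst pochhammer_Gamma) (auto simp: Gamma_one_half_real dest!: nonpos_Ints_nonpos)
    moreover have "(fact (2 * i) :: real) = 4 ^ i * pochhammer (1/2) i * fact i"
      using fact_double[of i, where 'a=real] by (simp add: power_mult)
    ultimately show ?thesis by (simp add: Gamma_one_half_real add.commute)
  qed
  have Gk: "Gamma (real k + a + 1/2) = pochhammer (a + 1/2) k * Gamma (a + 1/2)"
  proof -
    have "a + 1/2 \<notin> \<int>\<^sub>\<le>\<^sub>0" using a by (auto elim!: nonpos_Ints_cases)
    then show ?thesis by (subst pochhammer_Gamma) (auto simp: Gamma_eq_zero_iff add_ac)
  qed
  let ?l = "\<lambda>m. laguerre_exp_coeff a X n \<rho> (2 * (k - m)) * ((- 1) ^ m * (\<rho>\<^sup>2 / 4) ^ m / fact m) * (Gamma (real (k - m) + 1/2) / Gamma (real k + a + 1/2))"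
  let ?c = "\<lambda>m j. ((- 1) ^ m / (fact m * fact (k - m)) * real ((2 * (k - m)) choose j) * 2 ^ j)"
  define S where "S = sqrt pi / Gamma (real k + a + 1/2) * (\<rho>\<^sup>2 / 4) ^ k"
  have "(\<Sum>m\<le>k. ?l m) = (\<Sum>m\<le>k. S * (\<Sum>j\<le>n. laguerre_shift_coeff a X n 0 j * ?c m j))"
  proof (rule sum.cong[OF refl])
    fix m assume "m \<in> {..k}"
    then have k: "(\<rho>\<^sup>2 / 4) ^ k = (\<rho>\<^sup>2 / 4) ^ m * (\<rho>\<^sup>2 / 4) ^ (k - m)" by (simp flip: power_add)
    have e: "(- \<rho>) ^ (2 * (k - m)) = (\<rho>\<^sup>2 / 4) ^ (k - m) * 4 ^ (k - m)"
      by (simp add: power_mult power_divide)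
    show "?l m = S * (\<Sum>j\<le>n. laguerre_shift_coeff a X n 0 j * ?c m j)"
      unfolding laguerre_exp_coeff_def S_def G k e sum_distrib_left sum_distrib_right
      by (intro sum.cong refl) (simp add: field_simps)
  qed
  also have "\<dots> = S * (\<Sum>j\<le>n. laguerre_shift_coeff a X n 0 j * (\<Sum>m\<le>k. (- 1) ^ m / (fact m * fact (k - m)) * real ((2 * (k - m)) choose j) * 2 ^ j))"
    unfolding sum_distrib_left by (rule sum.swap)
  also have "\<dots> = S * 4 ^ k / fact k * (\<Sum>j\<le>n. laguerre_shift_coeff a X n 0 j * (((fps_X + fps_X ^ 2) ^ k :: real fps) $ j))"
    unfolding sum_binomial_shift sum_distrib_left by (simp add: mult_ac)
  also have "\<dots> = (if k \<le> n then sqrt pi / Gamma (a + 1/2) * (laguerre (n - k) (2 * a + 2 * of_nat k) X * \<rho> ^ (2 * k) / (fact k * pochhammer (a + 1/2) k)) else 0)"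
  proof (cases "k \<le> n")
    case True
    have "S * 4 ^ k = sqrt pi / (pochhammer (a + 1/2) k * Gamma (a + 1/2)) * \<rho> ^ (2 * k)"
      by (simp add: S_def Gk power_mult power_divide)
    with True show ?thesis by (simp add: sum_laguerre_shift_coeff_power mult_ac)
  next
    case False
    \<comment> \<open>\<open>(X + X^2) ^ k\<close> starts at degree \<open>k > n\<close>. This is
      why the series for the \<theta>-integral terminates.\<close>
    have "((fps_X + fps_X ^ 2) ^ k :: real fps) $ j = 0" if "j \<le> n" for j
    proof -
      have "(fps_X + fps_X ^ 2) ^ k = fps_X ^ k * (1 + fps_X :: real fps) ^ k"
      proof -
        have "fps_X + fps_X ^ 2 = fps_X * (1 + fps_X :: real fps)"
          by (simp add: algebra_simps power2_eq_square)
        then show ?thesis by (simp only: power_mult_distrib)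
      qed
      then show ?thesis using that False by (simp only:) (simp add: fps_X_power_mult_nth)
    qed
    with False show ?thesis by simp
  qed
  finally show ?thesis .
qed

text \<open>The Bessel order \<open>c\<close> and the exponent \<open>s\<close> are kept independent
  because two pairs occur: \<open>a - 1\<close> with \<open>2 * a - 1\<close>, and \<open>1\<close>
  with \<open>1\<close>.\<close>

lemma sums_laguerre_bessel_integral:
  assumes c: "c > -1" and s: "s > -1" and \<rho>: "\<rho> \<ge> 0"
  shows "(\<lambda>k. \<Sum>m\<le>k. laguerre_exp_coeff a X n \<rho> (2 * (k - m)) * (bessel_coeff c m * (\<rho>\<^sup>2 / 4) ^ m)
            * Beta (real (k - m) + 1/2) (real m + (s + 1) / 2))
    sums (LINT \<theta>:{0..pi}|lborel. laguerre n (2 * a) (X + 2 * \<rho> * cos \<theta>) * exp (- \<rho> * cos \<theta>)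
            * bessel_j c (\<rho> * sin \<theta>) * sin \<theta> powr s)"
proof -
  let ?A = "laguerre_exp_coeff a X n \<rho>"
  let ?b = "\<lambda>m. bessel_coeff c m * (\<rho>\<^sup>2 / 4) ^ m"
  have "(LINT \<theta>:{0..pi}|lborel. (\<Sum>p. ?A p * cos \<theta> ^ p) * (\<Sum>m. ?b m * sin \<theta> ^ (2 * m)) * sin \<theta> powr s)
    = (LINT \<theta>:{0..pi}|lborel. laguerre n (2 * a) (X + 2 * \<rho> * cos \<theta>) * exp (- \<rho> * cos \<theta>)
            * bessel_j c (\<rho> * sin \<theta>) * sin \<theta> powr s)"
  proof (rule set_lebesgue_integral_cong, simp, intro allI impI)
    fix \<theta> :: real assume "\<theta> \<in> {0..pi}"
    then have z: "\<rho> * sin \<theta> \<ge> 0" using \<rho> sin_ge_zero[of \<theta>] by auto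
    have "?b m * sin \<theta> ^ (2 * m) = bessel_coeff c m * ((\<rho> * sin \<theta> / 2)\<^sup>2) ^ m" for m
      by (simp add: power_mult power_mult_distrib[symmetric] power_divide)
    then have "(\<Sum>m. ?b m * sin \<theta> ^ (2 * m)) = bessel_j c (\<rho> * sin \<theta>)"
      by (simp only: bessel_j_eq_suminf[OF c z])
    moreover have "(\<Sum>p. ?A p * cos \<theta> ^ p) = laguerre n (2 * a) (X + 2 * \<rho> * cos \<theta>) * exp (- \<rho> * cos \<theta>)"
      using laguerre_exp_sums[of a X n \<rho> "cos \<theta>"] by (simp only: sums_iff)
    ultimately show "(\<Sum>p. ?A p * cos \<theta> ^ p) * (\<Sum>m. ?b m * sin \<theta> ^ (2 * m)) * sin \<theta> powr s
      = laguerre n (2 * a) (X + 2 * \<rho> * cos \<theta>) * exp (- \<rho> * cos \<theta>) * bessel_j c (\<rho> * sin \<theta>) * sin \<theta> powr s"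
      by (simp only:)
  qed
  then show ?thesis
    using sums_integral_cos_sin_series[OF s summable_laguerre_exp_coeff summable_bessel_coeff[OF c], of a X n \<rho> "\<rho>\<^sup>2 / 4"]
    by (simp only:)
qed

lemma theta_integral:
  assumes a: "a > 0" and \<rho>: "\<rho> \<ge> 0"
  shows "(LINT \<theta>:{0..pi}|lborel. laguerre n (2 * a) (X + 2 * \<rho> * cos \<theta>) * exp (- \<rho> * cos \<theta>)
            * bessel_j (a - 1) (\<rho> * sin \<theta>) * sin \<theta> powr (2 * a - 1))
     = 2 powr (1 - a) * sqrt pi / Gamma (a + 1/2)
        * (\<Sum>k\<le>n. laguerre (n - k) (2 * a + 2 * of_nat k) X * \<rho> ^ (2 * k) / (fact k * pochhammer (a + 1/2) k))"
    (is "?I = _")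
proof -
  define A where "A = laguerre_exp_coeff a X n \<rho>"
  define b where "b m = bessel_coeff (a - 1) m * (\<rho>\<^sup>2 / 4) ^ m" for m
  let ?f = "\<lambda>k. 2 powr (1 - a) * (if k \<le> n then sqrt pi / Gamma (a + 1/2) * (laguerre (n - k) (2 * a + 2 * of_nat k) X * \<rho> ^ (2 * k) / (fact k * pochhammer (a + 1/2) k)) else 0)"
  let ?w = "\<lambda>k m. A (2 * (k - m)) * b m * Beta (real (k - m) + 1/2) (real m + ((2 * a - 1) + 1) / 2)"
  have "(\<lambda>k. \<Sum>m\<le>k. ?w k m) sums ?I"
    unfolding A_def b_def using a by (intro sums_laguerre_bessel_integral \<rho>) auto
  moreover have "(\<Sum>m\<le>k. ?w k m) = ?f k" for k
  proof -
    let ?e = "\<lambda>m. 2 powr (1 - a) * (A (2 * (k - m)) * ((- 1) ^ m * (\<rho>\<^sup>2 / 4) ^ m / fact m) * (Gamma (real (k - m) + 1/2) / Gamma (real k + a + 1/2)))"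
    have "(\<Sum>m\<le>k. ?w k m) = (\<Sum>m\<le>k. ?e m)"
    proof (rule sum.cong[OF refl])
      fix m assume "m \<in> {..k}"
      then have 1: "real (k - m) + 1/2 + (real m + a) = real k + a + 1/2" by auto
      have 2: "((2 * a - 1) + 1) / 2 = a" by simp
      \<comment> \<open>Here order and exponent are matched: the Gamma value in the numerator of the
        Beta function cancels the reciprocal Gamma value of the Bessel coefficient.\<close>
      have "Gamma (real m + a) \<noteq> 0" using a Gamma_real_pos[of "real m + a"] by linarith
      then have 3: "rGamma (real m + (a - 1) + 1) * Gamma (real m + a) = 1"
        by (simp add: rGamma_inverse_Gamma)
      have "?w k m = ?e m * (rGamma (real m + (a - 1) + 1) * Gamma (real m + a))"
        unfolding 2 Beta_def 1 b_def bessel_coeff_def minus_diff_eq by (simp only: divide_inverse mult_ac)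
      then show "?w k m = ?e m"
        unfolding 3 by simp
    qed
    then show ?thesis
      using laguerre_bessel_coeff_sum[of a X n \<rho> k] a unfolding A_def sum_distrib_left[symmetric]
      by (simp del: of_nat_diff)
  qed
  ultimately have "?f sums ?I" by (simp only:)
  moreover have "?f sums (\<Sum>k\<le>n. ?f k)" by (rule sums_finite) auto
  ultimately have "?I = (\<Sum>k\<le>n. ?f k)" by (rule sums_unique2)
  then show ?thesis by (simp add: sum_distrib_left mult_ac)
qed

text \<open>For \<open>a = 0\<close> the weight \<open>sin \<theta> powr (2a - 1) / Gamma a\<close> degenerates to point masses at \<open>0\<close> and \<open>\<pi>\<close>.\<close>

lemma theta_integral_0:
  assumes \<rho>: "\<rho> \<ge> 0"
  shows "1 / 2 * (exp (- \<rho>) * laguerre n 0 (X + 2 * \<rho>) + exp \<rho> * laguerre n 0 (X - 2 * \<rho>))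
     - 1 / 2 * \<rho>\<^sup>2 * (LINT \<theta>:{0..pi}|lborel. laguerre n 0 (X + 2 * \<rho> * cos \<theta>) * exp (- \<rho> * cos \<theta>)
            * bessel_j 1 (\<rho> * sin \<theta>) * sin \<theta>)
     = (\<Sum>k\<le>n. laguerre (n - k) (2 * of_nat k) X * \<rho> ^ (2 * k) / (fact k * pochhammer (1/2) k))"
proof -
  define A where "A = laguerre_exp_coeff 0 X n \<rho>"
  define b where "b m = bessel_coeff 1 m * (\<rho>\<^sup>2 / 4) ^ m" for m
  let ?c = "\<lambda>k. (if k \<le> n then laguerre (n - k) (2 * of_nat k) X * \<rho> ^ (2 * k) / (fact k * pochhammer (1/2) k) else 0)"
  let ?w = "\<lambda>k m. A (2 * (k - m)) * b m * Beta (real (k - m) + 1/2) (real m + (1 + 1) / 2)"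
  define I where "I = (LINT \<theta>:{0..pi}|lborel. laguerre n 0 (X + 2 * \<rho> * cos \<theta>) * exp (- \<rho> * cos \<theta>)
            * bessel_j 1 (\<rho> * sin \<theta>) * sin \<theta>)"
  define G where "G k m = A (2 * (k - m)) * ((- 1) ^ m * (\<rho>\<^sup>2 / 4) ^ m / fact m) * (Gamma (real (k - m) + 1/2) / Gamma (real k + 1/2))" for k m
  have "(\<lambda>k. \<Sum>m\<le>k. ?w k m) sums (LINT \<theta>:{0..pi}|lborel. laguerre n (2 * 0) (X + 2 * \<rho> * cos \<theta>) * exp (- \<rho> * cos \<theta>)
            * bessel_j 1 (\<rho> * sin \<theta>) * sin \<theta> powr 1)"
    unfolding A_def b_def by (intro sums_laguerre_bessel_integral \<rho>) auto
  moreover have "\<dots> = I"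
    unfolding I_def mult_zero_right
    by (rule set_lebesgue_integral_cong) (auto simp: sin_ge_zero)
  \<comment> \<open>The factor \<open>- \<rho>^2 / 2\<close> moves the term \<open>m\<close> of the
    series of \<open>bessel_j 1\<close> to the term \<open>m + 1\<close> of the sum for
    \<open>a = 0\<close>. The missing terms \<open>m = 0\<close> are supplied by the two endpoint
    values.\<close>
  moreover have "(\<Sum>m\<le>k. ?w k m) * (- 1 / 2 * \<rho>\<^sup>2)
     = (\<Sum>m\<le>k. G (Suc k) (Suc m))" for k
    unfolding sum_distrib_right
  proof (rule sum.cong[OF refl])
    fix m assume "m \<in> {..k}"
    then have 1: "real (k - m) + 1/2 + (real m + 1) = real (Suc k) + 1/2" by auto
    have 2: "((1::real) + 1) / 2 = 1" by simp
    have 3: "Gamma (real m + 1) = fact m" using Gamma_fact[of m, where 'a=real] by (simp add: add.commute)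
    have 4: "rGamma (real m + 1 + 1) = 1 / fact (Suc m)"
      using Gamma_fact[of "Suc m", where 'a=real] by (simp add: rGamma_inverse_Gamma add_ac inverse_eq_divide del: fact_Suc)
    have 5: "2 powr (-1 :: real) = 1 / 2" by (simp add: powr_minus)
    show "?w k m * (- 1 / 2 * \<rho>\<^sup>2) = G (Suc k) (Suc m)"
      unfolding 2 Beta_def 1 b_def bessel_coeff_def 3 4 5 G_def diff_Suc_Suc by (simp add: field_simps del: fact_Suc of_nat_Suc of_nat_diff)
  qed
  ultimately have "(\<lambda>k. \<Sum>m\<le>k. G (Suc k) (Suc m)) sums (I * (- 1 / 2 * \<rho>\<^sup>2))"
    using sums_mult2[of "\<lambda>k. \<Sum>m\<le>k. ?w k m" I "- 1 / 2 * \<rho>\<^sup>2"] by (simp only:)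
  \<comment> \<open>A zero term at \<open>k = 0\<close> is put in front of the shifted
    series.\<close>
  then have s1: "(\<lambda>k. if k = 0 then 0 else \<Sum>m=1..k. G k m) sums (I * (- 1 / 2 * \<rho>\<^sup>2))"
    by (subst sums_Suc_iff[where f = "\<lambda>k. if k = 0 then 0 else \<Sum>m=1..k. G k m", symmetric, simplified])
      (simp add: sum.atLeast1_atMost_eq flip: lessThan_Suc_atMost)
  have sA: "(\<lambda>p. A p * c ^ p) sums (laguerre n 0 (X + 2 * \<rho> * c) * exp (- \<rho> * c))" for c
    using laguerre_exp_sums[of 0 X n \<rho> c] by (simp only: A_def mult_zero_right)
  \<comment> \<open>The mean of the values at cosine \<open>1\<close> and \<open>-1\<close> keeps
    the even coefficients, which are the terms \<open>G k 0\<close>.\<close>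
  have "(\<lambda>p. 1 / 2 * (A p * 1 ^ p + A p * (- 1) ^ p)) sums (1 / 2 * (laguerre n 0 (X + 2 * \<rho> * 1) * exp (- \<rho> * 1) + laguerre n 0 (X + 2 * \<rho> * (-1)) * exp (- \<rho> * (-1))))"
    by (intro sums_mult sums_add sA)
  then have "(\<lambda>k. 1 / 2 * (A (2 * k) * 1 ^ (2 * k) + A (2 * k) * (- 1) ^ (2 * k))) sums (1 / 2 * (laguerre n 0 (X + 2 * \<rho> * 1) * exp (- \<rho> * 1) + laguerre n 0 (X + 2 * \<rho> * (-1)) * exp (- \<rho> * (-1))))"
    by (subst sums_even_iff) auto
  then have s2: "(\<lambda>k. A (2 * k)) sums (1 / 2 * (exp (- \<rho>) * laguerre n 0 (X + 2 * \<rho>) + exp \<rho> * laguerre n 0 (X - 2 * \<rho>)))"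
    by (simp add: mult.commute)
  have "(\<lambda>k. A (2 * k) + (if k = 0 then 0 else \<Sum>m=1..k. G k m)) sums
     (1 / 2 * (exp (- \<rho>) * laguerre n 0 (X + 2 * \<rho>) + exp \<rho> * laguerre n 0 (X - 2 * \<rho>)) + I * (- 1 / 2 * \<rho>\<^sup>2))"
    by (rule sums_add[OF s2 s1])
  moreover have "A (2 * k) + (if k = 0 then 0 else \<Sum>m=1..k. G k m) = ?c k" for k
  proof -
    have "Gamma (real k + 1/2) \<noteq> 0" using Gamma_real_pos[of "real k + 1/2"] by linarith
    then have "G k 0 = A (2 * k)" by (simp add: G_def)
    then have "A (2 * k) + (if k = 0 then 0 else \<Sum>m=1..k. G k m) = (\<Sum>m\<le>k. G k m)"
      by (simp add: atMost_atLeast0 sum.atLeast_Suc_atMost)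
    also have "\<dots> = ?c k"
      using laguerre_bessel_coeff_sum[of 0 X n \<rho> k] unfolding G_def A_def
      by (simp add: Gamma_one_half_real del: of_nat_diff)
    finally show ?thesis .
  qed
  ultimately have "(\<lambda>k. if k \<le> n then laguerre (n - k) (2 * of_nat k) X * \<rho> ^ (2 * k) / (fact k * pochhammer (1/2) k) else 0) sums
     (1 / 2 * (exp (- \<rho>) * laguerre n 0 (X + 2 * \<rho>) + exp \<rho> * laguerre n 0 (X - 2 * \<rho>)) + I * (- 1 / 2 * \<rho>\<^sup>2))" (is "?f sums ?J")
    by (simp only:)
  moreover have "?f sums (\<Sum>k\<le>n. ?f k)" by (rule sums_finite) auto
  ultimately have "?J = (\<Sum>k\<le>n. ?f k)" by (rule sums_unique2)
  then show ?thesis by (simp add: I_def mult.commute)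
qed

unbundle no fps_syntax
unbundle vec_syntax

section \<open>Moments of the surface measure on the sphere\<close>

lemma nn_integral_even:
  fixes f :: "real \<Rightarrow> ennreal"
  assumes [measurable]: "f \<in> borel_measurable borel" and even: "\<And>x. f (- x) = f x"
  shows "(\<integral>\<^sup>+x. f x \<partial>lborel) = 2 * (\<integral>\<^sup>+x. f x * indicator {0..} x \<partial>lborel)"
proof -
  have "(\<integral>\<^sup>+x. f x \<partial>lborel) = (\<integral>\<^sup>+x. f x * indicator {0..} x + f x * indicator {..0} x \<partial>lborel)"
    by (rule nn_integral_cong_AE, rule AE_mp[OF AE_lborel_singleton[of "0::real"]], rule AE_I2)
      (auto simp: indicator_def)
  also have "\<dots> = (\<integral>\<^sup>+x. f x * indicator {0..} x \<partial>lborel) + (\<integral>\<^sup>+x. f x * indicator {..0} x \<partial>lborel)"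
    by (rule nn_integral_add) auto
  also have "(\<integral>\<^sup>+x. f x * indicator {..0} x \<partial>lborel) = ennreal \<bar>-1\<bar> * (\<integral>\<^sup>+x. f (0 + (-1) * x) * indicator {..0} (0 + (-1) * x) \<partial>lborel)"
    by (rule nn_integral_real_affine[where f = "\<lambda>x. f x * indicator {..0} x"]) auto
  also have "\<dots> = (\<integral>\<^sup>+x. f x * indicator {0..} x \<partial>lborel)"
    by (auto simp: even indicator_def intro!: nn_integral_cong)
  finally show ?thesis by (simp add: mult_2)
qed

text \<open>The substitution \<open>t = r^2\<close> in the Gamma integral.\<close>

lemma gaussian_half_moment:
  assumes q: "q > 0"
  shows "(\<integral>\<^sup>+r. ennreal (r powr (q - 1) * exp (- r\<^sup>2)) * indicator {0..} r \<partial>lborel) = ennreal (Gamma (q / 2) / 2)"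
proof -
  define f where "f t = t powr (q / 2 - 1) / exp t" for t :: real
  have G: "(f has_integral Gamma (q / 2)) {0..}"
    unfolding f_def using q by (intro Gamma_integral_real) auto
  have "(f has_integral Gamma (q / 2)) {0<..}"
    by (rule has_integral_spike_set_eq[THEN iffD2, OF _ _ G]) (auto intro: negligible_subset[of "{0}"])
  then have "f absolutely_integrable_on {0<..} \<and> integral {0<..} f = Gamma (q / 2)"
    by (auto simp: f_def integral_unique has_integral_integrable intro!: nonnegative_absolutely_integrable_1)
  moreover have "(\<lambda>r. r\<^sup>2) ` {0<..} = ({0<..} :: real set)"
  proof (intro set_eqI iffI)
    fix t :: real assume "t \<in> {0<..}"
    then show "t \<in> (\<lambda>r. r\<^sup>2) ` {0<..}"
      by (intro image_eqI[where x="sqrt t"]) auto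
  qed auto
  moreover have "(\<lambda>r. \<bar>2 * r\<bar> * f (r\<^sup>2)) absolutely_integrable_on {0<..} \<and> integral {0<..} (\<lambda>r. \<bar>2 * r\<bar> * f (r\<^sup>2)) = Gamma (q / 2)
    \<longleftrightarrow> f absolutely_integrable_on ((\<lambda>r. r\<^sup>2) ` {0<..}) \<and> integral ((\<lambda>r. r\<^sup>2) ` {0<..}) f = Gamma (q / 2)"
  proof (rule has_absolute_integral_change_of_variables_1')
    show "((\<lambda>r. r\<^sup>2) has_real_derivative 2 * x) (at x within {0<..})" for x :: real
      by (auto intro!: derivative_eq_intros)
    show "inj_on (\<lambda>r. r\<^sup>2) ({0<..} :: real set)"
      by (rule inj_onI) (simp add: power2_eq_iff_nonneg)
  qed simp
  ultimately have "(\<lambda>r. \<bar>2 * r\<bar> * f (r\<^sup>2)) absolutely_integrable_on {0<..} \<and> integral {0<..} (\<lambda>r. \<bar>2 * r\<bar> * f (r\<^sup>2)) = Gamma (q / 2)"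
    by (simp only:)
  then have "((\<lambda>r. \<bar>2 * r\<bar> * f (r\<^sup>2)) has_integral Gamma (q / 2)) {0<..}"
    using has_integral_integral set_lebesgue_integral_eq_integral(1) by metis
  then have "((\<lambda>r. \<bar>2 * r\<bar> * f (r\<^sup>2) / 2) has_integral (Gamma (q / 2) / 2)) {0<..}"
    by (rule has_integral_divide)
  then have "((\<lambda>r. r powr (q - 1) * exp (- r\<^sup>2)) has_integral (Gamma (q / 2) / 2)) {0<..}"
  proof (rule has_integral_eq[rotated])
    fix r :: real assume "r \<in> {0<..}"
    then have r: "r > 0" by simp
    have "r\<^sup>2 = r powr 2" using r by simp
    then have "r * r\<^sup>2 powr (q / 2 - 1) = r powr (1 + 2 * (q / 2 - 1))"
      using r by (simp only: powr_powr powr_add powr_one)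
    also have "1 + 2 * (q / 2 - 1) = q - 1" by simp
    finally have *: "r * r\<^sup>2 powr (q / 2 - 1) = r powr (q - 1)" .
    have "\<bar>2 * r\<bar> * f (r\<^sup>2) / 2 = (r * r\<^sup>2 powr (q / 2 - 1)) * exp (- r\<^sup>2)"
      using r unfolding f_def exp_minus divide_inverse by simp
    then show "\<bar>2 * r\<bar> * f (r\<^sup>2) / 2 = r powr (q - 1) * exp (- r\<^sup>2)"
      unfolding * .
  qed
  then have 1: "((\<lambda>r. r powr (q - 1) * exp (- r\<^sup>2)) has_integral (Gamma (q / 2) / 2)) {0..}"
    by (rule has_integral_spike_set_eq[THEN iffD1, rotated 2]) (auto intro: negligible_subset[of "{0}"])
  have "(\<integral>\<^sup>+r. ennreal (r powr (q - 1) * exp (- r\<^sup>2)) * indicator {0..} r \<partial>lborel) = (\<integral>\<^sup>+r. ennreal (if r \<in> {0..} then r powr (q - 1) * exp (- r\<^sup>2) else 0) \<partial>lborel)"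
    by (rule nn_integral_cong) (auto simp: indicator_def)
  also have "\<dots> = ennreal (Gamma (q / 2) / 2)"
    by (intro nn_integral_has_integral_lborel has_integral_restrict_UNIV[THEN iffD2, OF 1]) auto
  finally show ?thesis .
qed

text \<open>A dilation leaves \<open>sgn\<close> unchanged and scales Lebesgue measure by a power of
  \<open>r\<close>.\<close>

lemma nn_integral_sgn_cball:
  fixes F :: "'a::euclidean_space \<Rightarrow> ennreal"
  assumes [measurable]: "F \<in> borel_measurable borel" and r: "r > 0"
  shows "(\<integral>\<^sup>+x. F (sgn x) * indicator (cball 0 r) x \<partial>lborel) = ennreal (r ^ DIM('a)) * (\<integral>\<^sup>+x. F (sgn x) * indicator (cball 0 1) x \<partial>lborel)"
proof -
  have [measurable]: "cball (0::'a) r \<in> sets borel" for r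
    by (rule borel_closed) simp
  have "(\<integral>\<^sup>+x. F (sgn x) * indicator (cball 0 r) x \<partial>lborel)
     = (\<integral>\<^sup>+x. F (sgn x) * indicator (cball 0 r) x \<partial>density (distr lborel borel (\<lambda>x::'a. 0 + r *\<^sub>R x)) (\<lambda>_. \<bar>r\<bar> ^ DIM('a)))"
    using lborel_affine[of r "0::'a"] r by simp
  also have "\<dots> = (\<integral>\<^sup>+x. ennreal (r ^ DIM('a)) * (F (sgn x) * indicator (cball 0 1) x) \<partial>lborel)"
    using r by (subst nn_integral_density, measurable, subst nn_integral_distr)
      (auto simp: sgn_scaleR indicator_def intro!: nn_integral_cong)
  also have "\<dots> = ennreal (r ^ DIM('a)) * (\<integral>\<^sup>+x. F (sgn x) * indicator (cball 0 1) x \<partial>lborel)"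
    by (rule nn_integral_cmult) measurable
  finally show ?thesis .
qed

text \<open>The image under the norm of the measure with density \<open>F (sgn x)\<close> is
  compared with \<open>J * d * r ^ (d - 1) dr\<close> on the half-lines \<open>{..r}\<close>.
  Finiteness of \<open>J\<close> makes these sets of finite measure, so that agreement on them
  determines the measure.\<close>

lemma nn_integral_polar:
  fixes F :: "'a::euclidean_space \<Rightarrow> ennreal"
  assumes F[measurable]: "F \<in> borel_measurable borel" and \<phi>[measurable]: "\<phi> \<in> borel_measurable borel"
  assumes J: "J = (\<integral>\<^sup>+x. F (sgn x) * indicator (cball 0 1) x \<partial>lborel)" "J \<noteq> \<infinity>"
  shows "(\<integral>\<^sup>+x. F (sgn x) * \<phi> (norm x) \<partial>lborel)
     = J * (\<integral>\<^sup>+r. ennreal (real DIM('a) * r ^ (DIM('a) - 1)) * \<phi> r * indicator {0..} r \<partial>lborel)"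
proof -
  have [measurable]: "cball (0::'a) r \<in> sets borel" for r
    by (rule borel_closed) simp
  define M where "M = distr (density lborel (\<lambda>x. F (sgn x))) borel (norm :: 'a \<Rightarrow> real)"
  define g where "g r = J * (ennreal (real DIM('a) * r ^ (DIM('a) - 1)) * indicator {0..} r)" for r
  have [measurable]: "g \<in> borel_measurable borel" unfolding g_def by measurable
  define N where "N = density lborel g"
  have eq: "emeasure M {..r} = emeasure N {..r}" and fin: "emeasure M {..r} \<noteq> \<infinity>" for r
  proof -
    have nv: "norm -` {..r} = cball (0::'a) r" by auto
    have M: "emeasure M {..r} = (\<integral>\<^sup>+x. F (sgn x) * indicator (cball 0 r) x \<partial>lborel)"
      unfolding M_def by (subst emeasure_distr, measurable, subst emeasure_density)
        (auto simp: nv indicator_def intro!: nn_integral_cong)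
    have N: "emeasure N {..r} = J * (\<integral>\<^sup>+x. ennreal (real DIM('a) * x ^ (DIM('a) - 1)) * indicator {0..r} x \<partial>lborel)"
      unfolding N_def g_def by (subst emeasure_density, simp, simp, subst nn_integral_cmult[symmetric])
        (auto simp: indicator_def intro!: nn_integral_cong)
    have "emeasure M {..r} = emeasure N {..r} \<and> emeasure M {..r} \<noteq> \<infinity>"
    proof (cases "r > 0")
      case True
      have "(\<integral>\<^sup>+x. ennreal (real DIM('a) * x ^ (DIM('a) - 1)) * indicator {0..r} x \<partial>lborel) = ennreal (r ^ DIM('a) - 0 ^ DIM('a))"
        using True by (intro nn_integral_FTC_Icc) (auto intro!: derivative_eq_intros)
      also have "\<dots> = ennreal (r ^ DIM('a))" by (simp add: power_0_left)
      finally have "emeasure N {..r} = ennreal (r ^ DIM('a)) * J" unfolding N by (simp only: mult.commute)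
      moreover have "emeasure M {..r} = ennreal (r ^ DIM('a)) * J"
        unfolding M J(1) using True by (intro nn_integral_sgn_cball) auto
      ultimately show ?thesis using J(2) by (simp add: ennreal_mult_eq_top_iff)
    next
      case False
      have z: "x = 0" if "norm x \<le> r" for x :: 'a
        using False that by (metis linorder_not_less norm_le_zero_iff order_trans)
      have "emeasure M {..r} = 0"
        unfolding M
        by (subst nn_integral_0_iff_AE, measurable, rule AE_mp[OF AE_lborel_singleton[of "0::'a"]], rule AE_I2)
          (auto simp: indicator_def dest: z)
      moreover have "emeasure N {..r} = 0"
      proof -
        have "(\<integral>\<^sup>+x. ennreal (real DIM('a) * x ^ (DIM('a) - 1)) * indicator {0..r} x \<partial>lborel) = 0"
          by (subst nn_integral_0_iff_AE, simp, rule AE_mp[OF AE_lborel_singleton[of "0::real"]], rule AE_I2)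
            (use False in \<open>auto simp: indicator_def\<close>)
        then show ?thesis unfolding N by simp
      qed
      ultimately show ?thesis by simp
    qed
    then show "emeasure M {..r} = emeasure N {..r}" "emeasure M {..r} \<noteq> \<infinity>" by auto
  qed
  have MN: "M = N"
  proof (rule measure_eqI_generator_eq[where E="range (\<lambda>a::real. {..a})" and \<Omega>=UNIV and A="\<lambda>i. {..real i}"])
    show "Int_stable (range (\<lambda>a::real. {..a}))"
      by (auto simp: Int_stable_def)
    have "sets (borel :: real measure) = sigma_sets UNIV (range (\<lambda>a::real. {..a}))"
      unfolding borel_eq_atMost by simp
    then show "sets M = sigma_sets UNIV (range (\<lambda>a::real. {..a}))" "sets N = sigma_sets UNIV (range (\<lambda>a::real. {..a}))"
      by (simp_all add: M_def N_def)
    show "(\<Union>i. {..real i}) = UNIV"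
      by (auto intro: real_arch_simple)
  qed (use eq fin in auto)
  have "(\<integral>\<^sup>+x. F (sgn x) * \<phi> (norm x) \<partial>lborel) = (\<integral>\<^sup>+r. \<phi> r \<partial>M)"
    unfolding M_def by (subst nn_integral_distr, simp, simp, subst nn_integral_density) auto
  also have "\<dots> = (\<integral>\<^sup>+r. J * (ennreal (real DIM('a) * r ^ (DIM('a) - 1)) * \<phi> r * indicator {0..} r) \<partial>lborel)"
    unfolding MN N_def by (subst nn_integral_density) (auto simp: g_def mult_ac intro!: nn_integral_cong)
  also have "\<dots> = J * (\<integral>\<^sup>+r. ennreal (real DIM('a) * r ^ (DIM('a) - 1)) * \<phi> r * indicator {0..} r \<partial>lborel)"
    by (rule nn_integral_cmult) measurable
  finally show ?thesis .
qed

lemma sets_sphere_measure [measurable_cong]: "sets (sphere_measure :: (real ^ 'd) measure) = sets (restrict_space borel (sphere 0 1))"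
  by (simp add: sphere_measure_def)

lemma space_sphere_measure: "space (sphere_measure :: (real ^ 'd) measure) = sphere 0 1"
  by (simp add: sphere_measure_def space_scale_measure space_restrict_space)

lemma nn_integral_sphere_measure:
  fixes F :: "real ^ 'd \<Rightarrow> ennreal"
  assumes [measurable]: "F \<in> borel_measurable borel"
  shows "(\<integral>\<^sup>+x. F x \<partial>sphere_measure) = ennreal (real CARD('d)) * (\<integral>\<^sup>+x. F (sgn x) * indicator (cball 0 1) x \<partial>lborel)"
proof -
  have [measurable]: "F \<in> borel_measurable (restrict_space borel (sphere 0 1))"
    by (rule measurable_restrict_space1) simp
  have sgn: "sgn \<in> restrict_space lborel (cball 0 1 - {0}) \<rightarrow>\<^sub>M restrict_space borel (sphere 0 (1::real) :: (real ^ 'd) set)"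
    by (rule measurable_restrict_space2)
      (auto simp: space_restrict_space norm_sgn intro!: measurable_restrict_space1)
  have "(\<integral>\<^sup>+x. F x \<partial>sphere_measure) = ennreal (real CARD('d)) * (\<integral>\<^sup>+x. F (sgn x) \<partial>restrict_space lborel (cball 0 1 - {0}))"
    unfolding sphere_measure_def
    by (subst nn_integral_scale_measure, simp, subst nn_integral_distr[OF sgn]) simp_all
  also have "(\<integral>\<^sup>+x. F (sgn x) \<partial>restrict_space lborel (cball 0 1 - {0})) = (\<integral>\<^sup>+x. F (sgn x) * indicator (cball 0 1 - {0}) x \<partial>lborel)"
    by (rule nn_integral_restrict_space) simp
  also have "\<dots> = (\<integral>\<^sup>+x. F (sgn x) * indicator (cball 0 1) x \<partial>lborel)"
    by (rule nn_integral_cong_AE, rule AE_mp[OF AE_lborel_singleton[of "0"]], rule AE_I2) (auto simp: indicator_def)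
  finally show ?thesis .
qed

lemma gaussian_line_moment:
  assumes k: "k \<ge> 0" and m: "even m"
  shows "(\<integral>\<^sup>+x. ennreal (x ^ m * (if k = 0 then 1 else \<bar>x\<bar> powr k)\<^sup>2 * exp (- x\<^sup>2)) \<partial>lborel) = ennreal (Gamma ((real m + 1) / 2 + k))"
proof -
  let ?f = "\<lambda>x. x ^ m * (if k = 0 then 1 else \<bar>x\<bar> powr k)\<^sup>2"
  define q where "q = real m + 2 * k + 1"
  have q: "q > 0" using k by (simp add: q_def)
  have q2: "q / 2 = (real m + 1) / 2 + k" by (simp add: q_def field_simps)
  have "(\<integral>\<^sup>+x. ennreal (?f x * exp (- x\<^sup>2)) \<partial>lborel)
    = 2 * (\<integral>\<^sup>+x. ennreal (?f x * exp (- x\<^sup>2)) * indicator {0..} x \<partial>lborel)"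
    by (rule nn_integral_even) (use m in \<open>auto simp: power_minus_even\<close>)
  also have "(\<integral>\<^sup>+x. ennreal (?f x * exp (- x\<^sup>2)) * indicator {0..} x \<partial>lborel)
    = (\<integral>\<^sup>+x. ennreal (x powr (q - 1) * exp (- x\<^sup>2)) * indicator {0..} x \<partial>lborel)"
  \<comment> \<open>The origin is excluded because for \<open>m = 0\<close> and \<open>k = 0\<close>
    the left integrand is 1 there, whereas \<open>0 powr 0 = 0\<close>.\<close>
  proof (rule nn_integral_cong_AE, rule AE_mp[OF AE_lborel_singleton[of "0::real"]], rule AE_I2, rule impI)
    fix x :: real assume "x \<noteq> 0"
    show "ennreal (?f x * exp (- x\<^sup>2)) * indicator {0..} x = ennreal (x powr (q - 1) * exp (- x\<^sup>2)) * indicator {0..} x"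
    proof (cases "x > 0")
      case True
      have "(x powr k)\<^sup>2 = x powr (2 * k)" by (simp only: powr_add power2_eq_square mult_2)
      then have "?f x = x powr (q - 1)"
        using True by (simp add: q_def powr_add powr_realpow)
      then show ?thesis by simp
    qed (use \<open>x \<noteq> 0\<close> in \<open>auto simp: indicator_def\<close>)
  qed
  also have "\<dots> = ennreal (Gamma (q / 2) / 2)" by (rule gaussian_half_moment[OF q])
  also have "2 * \<dots> = ennreal (2 * (Gamma (q / 2) / 2))"
    by (subst ennreal_mult') auto
  finally show ?thesis by (simp add: q2)
qed

section \<open>Weighted monomials on the sphere\<close>

definition weighted_monomial :: "real ^ 'd \<Rightarrow> ('d \<Rightarrow> nat) \<Rightarrow> real ^ 'd \<Rightarrow> real" where
  "weighted_monomial k m x = (\<Prod>i\<in>UNIV. (x $ i) ^ m i) * (h_weight k x)\<^sup>2"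

lemma weighted_monomial_prod:
  "weighted_monomial k m x = (\<Prod>i\<in>UNIV. (x $ i) ^ m i * (if k $ i = 0 then 1 else \<bar>x $ i\<bar> powr (k $ i))\<^sup>2)"
  by (simp add: weighted_monomial_def h_weight_def prod.distrib prod_power_distrib)

lemma borel_measurable_weighted_monomial [measurable]: "weighted_monomial k m \<in> borel_measurable borel"
  unfolding weighted_monomial_prod[abs_def] by measurable

lemma h_weight_scale:
  assumes c: "c > 0"
  shows "h_weight k (c *\<^sub>R x) = c powr abs_mult k * h_weight k x"
proof -
  have "c powr abs_mult k = (\<Prod>i\<in>UNIV. c powr (k $ i))"
    unfolding abs_mult_def using c by (subst powr_sum) auto
  then show ?thesis
    using c by (auto simp: h_weight_def prod.distrib[symmetric] abs_mult powr_mult intro!: prod.cong)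
qed

lemma weighted_monomial_scale:
  assumes c: "c > 0"
  shows "weighted_monomial k m (c *\<^sub>R x) = c powr (real (sum m UNIV) + 2 * abs_mult k) * weighted_monomial k m x"
proof -
  have "(\<Prod>i\<in>UNIV. ((c *\<^sub>R x) $ i) ^ m i) = c ^ (sum m UNIV) * (\<Prod>i\<in>UNIV. (x $ i) ^ m i)"
    by (simp add: power_mult_distrib prod.distrib power_sum)
  moreover have "c powr (real (sum m UNIV) + 2 * abs_mult k) = c ^ (sum m UNIV) * (c powr abs_mult k)\<^sup>2"
    using c by (simp only: powr_add powr_realpow power2_eq_square mult_2)
  ultimately show ?thesis
    unfolding weighted_monomial_def h_weight_scale[OF c] by (simp only: power_mult_distrib mult_ac)
qed

lemma h_weight_nonneg: "h_weight k x \<ge> 0"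
  unfolding h_weight_def by (intro prod_nonneg) auto

text \<open>The first bound gives integrability of odd monomials by comparison with the weight; both
  together make \<open>J\<close> in \<open>sphere_integral_even\<close> finite.\<close>

lemma weighted_monomial_le:
  assumes x: "norm x \<le> 1" and k: "\<And>i. k $ i \<ge> 0"
  shows "\<bar>weighted_monomial k m x\<bar> \<le> weighted_monomial k (\<lambda>_. 0) x" and "weighted_monomial k (\<lambda>_. 0) x \<le> 1"
proof -
  have xi: "\<bar>x $ i\<bar> \<le> 1" for i using component_le_norm_cart[of x i] x by linarith
  have "\<bar>\<Prod>i\<in>UNIV. (x $ i) ^ m i\<bar> \<le> 1"
    unfolding abs_prod power_abs by (intro prod_le_1) (auto intro!: power_le_one xi)
  then show "\<bar>weighted_monomial k m x\<bar> \<le> weighted_monomial k (\<lambda>_. 0) x"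
    unfolding weighted_monomial_def by (simp add: abs_mult mult_le_cancel_right1) (simp add: mult_left_le_one_le)
  have "h_weight k x \<le> 1"
    unfolding h_weight_def using k xi by (intro prod_le_1) (auto intro!: powr_le1)
  then show "weighted_monomial k (\<lambda>_. 0) x \<le> 1"
    unfolding weighted_monomial_def using h_weight_nonneg[of k x] by (simp add: power_le_one)
qed

lemma nn_integral_gaussian_weighted_monomial:
  fixes k :: "real ^ 'd"
  assumes k: "\<And>i. k $ i \<ge> 0" and m: "\<And>i. even (m i)"
  shows "(\<integral>\<^sup>+x. ennreal (weighted_monomial k m x * exp (- (norm x)\<^sup>2)) \<partial>lborel)
    = ennreal (\<Prod>i\<in>UNIV. Gamma ((real (m i) + 1) / 2 + k $ i))"
proof -
  define q where "q i t = t ^ m i * (if k $ i = 0 then 1 else \<bar>t\<bar> powr (k $ i))\<^sup>2 * exp (- t\<^sup>2)" for i and t :: real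
  define e where "e i = (axis i 1 :: real ^ 'd)" for i
  have inj: "inj e" unfolding e_def by (auto simp: inj_def axis_eq_axis)
  have B: "Basis = range e" unfolding e_def by (auto simp: Basis_vec_def)
  have q0: "q i t \<ge> 0" for i t
    using m[of i] by (auto simp: q_def zero_le_even_power)
  have [measurable]: "q i \<in> borel_measurable borel" for i unfolding q_def by measurable
  have xe: "x \<bullet> e i = x $ i" for x i by (simp add: e_def inner_axis)
  have "weighted_monomial k m x * exp (- (norm x)\<^sup>2) = (\<Prod>i\<in>UNIV. q i (x $ i))" for x
  proof -
    have "(norm x)\<^sup>2 = (\<Sum>i\<in>UNIV. (x $ i)\<^sup>2)"
      unfolding power2_norm_eq_inner inner_vec_def by (simp add: power2_eq_square)
    then have "exp (- (norm x)\<^sup>2) = (\<Prod>i\<in>UNIV. exp (- (x $ i)\<^sup>2))"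
      by (simp add: exp_sum sum_negf[symmetric])
    then show ?thesis by (simp add: weighted_monomial_prod q_def prod.distrib)
  qed
  then have "(\<integral>\<^sup>+x. ennreal (weighted_monomial k m x * exp (- (norm x)\<^sup>2)) \<partial>lborel)
    = (\<integral>\<^sup>+x. (\<Prod>b\<in>Basis. ennreal (q (inv e b) (x \<bullet> b))) \<partial>lborel)"
    using q0 by (simp add: B prod.reindex[OF inj] inv_f_f[OF inj] xe prod_ennreal)
  also have "\<dots> = (\<Prod>b\<in>Basis. (\<integral>\<^sup>+x. ennreal (q (inv e b) x) \<partial>lborel))"
    by (rule nn_integral_lborel_prod) auto
  also have "\<dots> = (\<Prod>i\<in>UNIV. (\<integral>\<^sup>+x. ennreal (q i x) \<partial>lborel))"
    by (simp add: B prod.reindex[OF inj] inv_f_f[OF inj])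
  also have "\<dots> = (\<Prod>i\<in>UNIV. ennreal (Gamma ((real (m i) + 1) / 2 + k $ i)))"
    unfolding q_def by (intro prod.cong refl gaussian_line_moment k m)
  also have "\<dots> = ennreal (\<Prod>i\<in>UNIV. Gamma ((real (m i) + 1) / 2 + k $ i))"
    using k by (intro prod_ennreal) (auto intro!: Gamma_real_nonneg add_pos_nonneg)
  finally show ?thesis .
qed

text \<open>The Gaussian integral of the weighted monomial is evaluated twice: over the coordinates
  it is a product of Gamma values; in polar coordinates, by homogeneity of degree \<open>D\<close>,
  it is \<open>J\<close> times a radial Gamma integral. Division gives \<open>J\<close>.\<close>

lemma sphere_integral_even:
  fixes k :: "real ^ 'd"
  assumes k: "\<And>i. k $ i \<ge> 0" and m: "\<And>i. even (m i)"
  shows "has_bochner_integral sphere_measure (weighted_monomial k m)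
    (2 * (\<Prod>i\<in>UNIV. Gamma ((real (m i) + 1) / 2 + k $ i))
      / Gamma ((real (sum m UNIV) + real CARD('d)) / 2 + abs_mult k))"
proof -
  let ?P = "(\<Prod>i\<in>UNIV. Gamma ((real (m i) + 1) / 2 + k $ i))"
  let ?F = "\<lambda>x. ennreal (weighted_monomial k m x)"
  define J where "J = (\<integral>\<^sup>+x. ?F (sgn x) * indicator (cball 0 1) x \<partial>lborel)"
  define D where "D = real (sum m UNIV) + 2 * abs_mult k"
  define q where "q = D + real CARD('d)"
  have "CARD('d) > 0" by simp
  moreover have "D \<ge> 0" using k unfolding D_def abs_mult_def by (intro add_nonneg_nonneg) (auto intro: sum_nonneg)
  ultimately have q: "q > 0" unfolding q_def by linarith
  have nonneg: "weighted_monomial k m x \<ge> 0" for x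
    unfolding weighted_monomial_prod using m by (intro prod_nonneg) (auto simp: zero_le_even_power)
  have [measurable]: "cball (0 :: real ^ 'd) r \<in> sets borel" for r
    by (rule borel_closed) simp
  have Jfin: "J \<noteq> \<infinity>"
  proof -
    have "J \<le> (\<integral>\<^sup>+x. indicator (cball 0 1) (x :: real ^ 'd) \<partial>lborel)"
      unfolding J_def
    proof (rule nn_integral_mono)
      fix x :: "real ^ 'd"
      have "norm (sgn x) \<le> 1" by (simp add: norm_sgn)
      then have "\<bar>weighted_monomial k m (sgn x)\<bar> \<le> 1"
        using weighted_monomial_le(1)[of "sgn x" k m, OF _ k] weighted_monomial_le(2)[of "sgn x" k, OF _ k] by linarith
      then have "?F (sgn x) \<le> 1" by simp
      then show "?F (sgn x) * indicator (cball 0 1) x \<le> indicator (cball 0 1) x"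
        by (simp add: indicator_def)
    qed
    also have "\<dots> = emeasure lborel (cball (0 :: real ^ 'd) 1)" by simp
    also have "\<dots> < \<infinity>" by (rule emeasure_lborel_cball_finite)
    finally show ?thesis by simp
  qed
  let ?R = "\<lambda>r. ennreal (real DIM(real ^ 'd) * r ^ (DIM(real ^ 'd) - 1)) * ennreal (r powr D * exp (- r\<^sup>2)) * indicator {0..} r"
  have "ennreal ?P = (\<integral>\<^sup>+x. ennreal (weighted_monomial k m x * exp (- (norm x)\<^sup>2)) \<partial>lborel)"
    using nn_integral_gaussian_weighted_monomial[OF k m] by simp
  also have "\<dots> = (\<integral>\<^sup>+x. ?F (sgn x) * ennreal (norm x powr D * exp (- (norm x)\<^sup>2)) \<partial>lborel)"
  proof (rule nn_integral_cong_AE, rule AE_mp[OF AE_lborel_singleton[of "0"]], rule AE_I2, rule impI)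
    fix x :: "real ^ 'd" assume x: "x \<noteq> 0"
    then have "weighted_monomial k m x = weighted_monomial k m (norm x *\<^sub>R sgn x)" by (simp add: sgn_div_norm)
    also have "\<dots> = norm x powr D * weighted_monomial k m (sgn x)"
      unfolding D_def by (rule weighted_monomial_scale) (use x in simp)
    finally show "ennreal (weighted_monomial k m x * exp (- (norm x)\<^sup>2)) = ?F (sgn x) * ennreal (norm x powr D * exp (- (norm x)\<^sup>2))"
      by (simp add: ennreal_mult'[symmetric] nonneg mult_ac)
  qed
  also have "\<dots> = J * (\<integral>\<^sup>+r. ?R r \<partial>lborel)"
    by (rule nn_integral_polar[OF _ _ J_def Jfin]) auto
  also have "(\<integral>\<^sup>+r. ?R r \<partial>lborel)
     = (\<integral>\<^sup>+r. ennreal (real CARD('d)) * (ennreal (r powr (q - 1) * exp (- r\<^sup>2)) * indicator {0..} r) \<partial>lborel)"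
  proof (rule nn_integral_cong_AE, rule AE_mp[OF AE_lborel_singleton[of "0"]], rule AE_I2, rule impI)
    fix r :: real assume "r \<noteq> 0"
    show "?R r = ennreal (real CARD('d)) * (ennreal (r powr (q - 1) * exp (- r\<^sup>2)) * indicator {0..} r)"
    proof (cases "r > 0")
      case True
      have "r ^ (CARD('d) - 1) * r powr D = r powr (real (CARD('d) - 1) + D)"
        using True by (simp only: powr_add powr_realpow)
      also have "real (CARD('d) - 1) + D = q - 1"
        using \<open>CARD('d) > 0\<close> unfolding q_def by (subst of_nat_diff) linarith+
      finally have "real CARD('d) * r ^ (CARD('d) - 1) * (r powr D * exp (- r\<^sup>2)) = real CARD('d) * (r powr (q - 1) * exp (- r\<^sup>2))"
        by (metis mult.assoc)
      then show ?thesis using True by (simp add: ennreal_mult'[symmetric] ennreal_mult''[symmetric])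
    qed (use \<open>r \<noteq> 0\<close> in \<open>auto simp: indicator_def\<close>)
  qed
  also have "\<dots> = ennreal (real CARD('d)) * ennreal (Gamma (q / 2) / 2)"
    by (subst nn_integral_cmult) (auto simp: gaussian_half_moment[OF q])
  finally have 1: "ennreal ?P = J * (ennreal (real CARD('d)) * ennreal (Gamma (q / 2) / 2))" .
  define P where "P = ?P"
  have P: "P > 0" unfolding P_def using k by (intro prod_pos) (auto intro!: Gamma_real_pos add_pos_nonneg)
  have G: "Gamma (q / 2) > 0" using q by (intro Gamma_real_pos) auto
  obtain j where j: "J = ennreal j" "j \<ge> 0" using Jfin by (cases J) auto
  have "P = j * (real CARD('d) * (Gamma (q / 2) / 2))"
    using 1 P G j by (simp add: P_def[symmetric] ennreal_mult'[symmetric] ennreal_mult''[symmetric])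
  then have "real CARD('d) * j = 2 * P / Gamma (q / 2)" using G by (simp add: field_simps)
  then have "ennreal (real CARD('d)) * J = ennreal (2 * P / Gamma (q / 2))"
    using j by (simp add: ennreal_mult'[symmetric])
  moreover have "(\<integral>\<^sup>+x. ?F x \<partial>sphere_measure) = ennreal (real CARD('d)) * J"
    unfolding J_def by (rule nn_integral_sphere_measure) simp
  ultimately have "(\<integral>\<^sup>+x. ?F x \<partial>sphere_measure) = ennreal (2 * P / Gamma (q / 2))" by simp
  moreover have "weighted_monomial k m \<in> borel_measurable sphere_measure"
    unfolding measurable_cong_sets[OF sets_sphere_measure refl] by (intro measurable_restrict_space1) simp
  ultimately have "has_bochner_integral sphere_measure (weighted_monomial k m) (2 * P / Gamma (q / 2))"
    using P G nonneg by (intro has_bochner_integral_nn_integral) (auto intro!: divide_nonneg_pos)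
  moreover have "q / 2 = (real (sum m UNIV) + real CARD('d)) / 2 + abs_mult k"
    unfolding q_def D_def by (simp add: field_simps)
  ultimately show ?thesis by (simp only: P_def)
qed

lemma nn_integral_lborel_reflect:
  fixes f :: "real ^ 'd \<Rightarrow> ennreal"
  assumes [measurable]: "f \<in> borel_measurable borel"
  shows "(\<integral>\<^sup>+x. f x \<partial>lborel) = (\<integral>\<^sup>+x. f (\<chi> i. if i = i0 then - x $ i else x $ i) \<partial>lborel)"
proof -
  define c :: "real ^ 'd \<Rightarrow> real" where "c j = (if j = axis i0 1 then -1 else 1)" for j
  define T :: "real ^ 'd \<Rightarrow> real ^ 'd" where "T x = 0 + (\<Sum>j\<in>Basis. (c j * (x \<bullet> j)) *\<^sub>R j)" for x
  have T: "T x = (\<chi> i. if i = i0 then - x $ i else x $ i)" for x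
  proof -
    have "T x = (\<Sum>i\<in>UNIV. (c (axis i 1) * (x \<bullet> axis i 1)) *\<^sub>R axis i 1)"
    proof -
      have B: "Basis = range (\<lambda>i. axis i 1 :: real ^ 'd)" by (auto simp: Basis_vec_def)
      have inj: "inj (\<lambda>i. axis i 1 :: real ^ 'd)" by (auto simp: inj_def axis_eq_axis)
      show ?thesis unfolding T_def B by (simp add: sum.reindex[OF inj])
    qed
    also have "\<dots> = (\<Sum>i\<in>UNIV. ((if i = i0 then -1 else 1) * (x $ i)) *\<^sub>R axis i 1)"
      by (intro sum.cong refl) (simp add: c_def inner_axis axis_eq_axis)
    also have "\<dots> = (\<chi> i. if i = i0 then - x $ i else x $ i)"
    proof (subst vec_eq_iff, rule allI)
      fix j
      have "(\<Sum>i\<in>UNIV. ((if i = i0 then -1 else 1) * (x $ i)) *\<^sub>R (axis i 1 :: real ^ 'd)) $ j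
        = (\<Sum>i\<in>UNIV. if i = j then (if i = i0 then -1 else 1) * (x $ i) else 0)"
        unfolding sum_component by (intro sum.cong refl) (simp add: axis_def)
      then show "(\<Sum>i\<in>UNIV. ((if i = i0 then -1 else 1) * (x $ i)) *\<^sub>R (axis i 1 :: real ^ 'd)) $ j = (\<chi> i. if i = i0 then - x $ i else x $ i) $ j"
        by simp
    qed
    finally show ?thesis .
  qed
  have "(lborel :: (real ^ 'd) measure) = density (distr lborel borel T) (\<lambda>_. (\<Prod>j\<in>Basis. \<bar>c j\<bar>))"
    unfolding T_def by (rule lborel_affine_euclidean) (simp add: c_def)
  also have "(\<Prod>j\<in>Basis. \<bar>c j\<bar>) = 1" by (rule prod.neutral) (simp add: c_def)
  finally have eq: "(lborel :: (real ^ 'd) measure) = distr lborel borel T" by (simp add: density_1)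
  have [measurable]: "T \<in> borel \<rightarrow>\<^sub>M borel" unfolding T_def by measurable
  have "(\<integral>\<^sup>+x. f x \<partial>lborel) = (\<integral>\<^sup>+x. f x \<partial>distr lborel borel T)" using eq by simp
  also have "\<dots> = (\<integral>\<^sup>+x. f (T x) \<partial>lborel)" by (rule nn_integral_distr) auto
  finally show ?thesis by (simp only: T)
qed

text \<open>Reflection in the coordinate \<open>i0\<close> preserves the weight and changes the sign
  of the monomial, hence exchanges the integrals of its positive and negative parts.\<close>

lemma sphere_integral_odd:
  fixes k :: "real ^ 'd"
  assumes k: "\<And>i. k $ i \<ge> 0" and m: "odd (m i0)"
  shows "has_bochner_integral sphere_measure (weighted_monomial k m) 0"
proof -
  let ?T = "\<lambda>x :: real ^ 'd. (\<chi> i. if i = i0 then - x $ i else x $ i) :: real ^ 'd"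
  have int: "integrable sphere_measure (weighted_monomial k m)"
  proof (rule Bochner_Integration.integrable_bound)
    show "integrable sphere_measure (weighted_monomial k (\<lambda>_. 0))"
      using sphere_integral_even[OF k, of "\<lambda>_. 0"] by (simp add: has_bochner_integral_iff)
    show "weighted_monomial k m \<in> borel_measurable sphere_measure"
      unfolding measurable_cong_sets[OF sets_sphere_measure refl] by (intro measurable_restrict_space1) simp
    show "AE x in sphere_measure. norm (weighted_monomial k m x) \<le> norm (weighted_monomial k (\<lambda>_. 0) x)"
    proof (rule AE_I2)
      fix x :: "real ^ 'd" assume "x \<in> space sphere_measure"
      then have "norm x \<le> 1" by (simp add: space_sphere_measure)
      then have "\<bar>weighted_monomial k m x\<bar> \<le> weighted_monomial k (\<lambda>_. 0) x"
        by (rule weighted_monomial_le(1)[OF _ k])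
      then show "norm (weighted_monomial k m x) \<le> norm (weighted_monomial k (\<lambda>_. 0) x)" by simp
    qed
  qed
  have odd: "weighted_monomial k m (?T x) = - weighted_monomial k m x" for x
  proof -
    have "h_weight k (?T x) = h_weight k x" unfolding h_weight_def by (intro prod.cong) auto
    moreover have "(\<Prod>i\<in>UNIV. (?T x $ i) ^ m i) = (\<Prod>i\<in>UNIV. (if i = i0 then -1 else 1) * (x $ i) ^ m i)"
      using m by (intro prod.cong) auto
    moreover have "\<dots> = - (\<Prod>i\<in>UNIV. (x $ i) ^ m i)"
      by (simp add: prod.distrib prod.delta)
    ultimately show ?thesis by (simp add: weighted_monomial_def)
  qed
  have nT: "norm (?T x) = norm x" for x
    by (simp add: norm_eq_sqrt_inner inner_vec_def) (rule sum.cong, auto)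
  have sT: "sgn (?T x) = ?T (sgn x)" for x
    unfolding sgn_div_norm nT by (simp add: vec_eq_iff)
  have [measurable]: "cball (0 :: real ^ 'd) r \<in> sets borel" for r
    by (rule borel_closed) simp
  have "(\<integral>\<^sup>+x. ennreal (weighted_monomial k m x) \<partial>sphere_measure)
     = ennreal (real CARD('d)) * (\<integral>\<^sup>+x. ennreal (weighted_monomial k m (sgn x)) * indicator (cball 0 1) x \<partial>lborel)"
    by (rule nn_integral_sphere_measure) simp
  also have "(\<integral>\<^sup>+x. ennreal (weighted_monomial k m (sgn x)) * indicator (cball 0 1) x \<partial>lborel)
     = (\<integral>\<^sup>+x. ennreal (weighted_monomial k m (sgn (?T x))) * indicator (cball 0 1) (?T x) \<partial>lborel)"
    by (rule nn_integral_lborel_reflect) measurable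
  also have "\<dots> = (\<integral>\<^sup>+x. ennreal (- weighted_monomial k m (sgn x)) * indicator (cball 0 1) x \<partial>lborel)"
    unfolding sT odd by (rule nn_integral_cong) (simp add: indicator_def nT)
  also have "ennreal (real CARD('d)) * \<dots> = (\<integral>\<^sup>+x. ennreal (- weighted_monomial k m x) \<partial>sphere_measure)"
    by (rule nn_integral_sphere_measure[symmetric]) simp
  finally have "(\<integral>x. weighted_monomial k m x \<partial>sphere_measure) = 0"
    using real_lebesgue_integral_def[OF int] by simp
  with int show ?thesis by (simp add: has_bochner_integral_iff)
qed

lemma alpha_plus_one_pos:
  fixes k :: "real ^ 'd"
  assumes k: "\<And>i. k $ i \<ge> 0"
  shows "alpha k + 1 > 0"
proof -
  have "abs_mult k \<ge> 0" using k unfolding abs_mult_def by (intro sum_nonneg) auto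
  moreover have "alpha k + 1 = abs_mult k + real CARD('d) / 2" unfolding alpha_def by (simp add: field_simps)
  moreover have "real CARD('d) > 0" by simp
  ultimately show ?thesis by linarith
qed

text \<open>The integral of \<open>h^2\<close> over the unit sphere.\<close>

definition sphere_mass :: "real ^ 'd \<Rightarrow> real" where
  "sphere_mass k = 2 * (\<Prod>i\<in>UNIV. Gamma (k $ i + 1/2)) / Gamma (alpha k + 1)"

lemma sphere_integral:
  fixes k :: "real ^ 'd"
  assumes k: "\<And>i. k $ i \<ge> 0"
  shows "has_bochner_integral sphere_measure (weighted_monomial k m) (sphere_mass k * sphere_moment (alpha k) (($) k) m)"
proof (cases "\<forall>i. even (m i)")
  case True
  define h where "h i = m i div 2" for i
  have m: "m i = 2 * h i" for i using True by (simp add: h_def)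
  have S: "(sum m UNIV) = 2 * (sum h UNIV)" by (simp add: m sum_distrib_left)
  have a: "alpha k + 1 > 0" using k by (rule alpha_plus_one_pos)
  have 1: "Gamma ((real (m i) + 1) / 2 + k $ i) = pochhammer (k $ i + 1/2) (h i) * Gamma (k $ i + 1/2)" for i
  proof -
    have p: "k $ i + 1/2 > 0" using k[of i] by linarith
    then have "k $ i + 1/2 \<notin> \<int>\<^sub>\<le>\<^sub>0" by (auto dest: nonpos_Ints_nonpos)
    moreover have e: "(real (m i) + 1) / 2 + k $ i = k $ i + 1/2 + of_nat (h i)" unfolding m by (simp add: field_simps)
    ultimately show ?thesis unfolding e using Gamma_real_pos[OF p] by (simp add: pochhammer_Gamma)
  qed
  have 2: "Gamma ((real (sum m UNIV) + real CARD('d)) / 2 + abs_mult k) = pochhammer (alpha k + 1) (sum h UNIV) * Gamma (alpha k + 1)"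
  proof -
    have "alpha k + 1 \<notin> \<int>\<^sub>\<le>\<^sub>0" using a by (auto dest: nonpos_Ints_nonpos)
    moreover have e: "(real (sum m UNIV) + real CARD('d)) / 2 + abs_mult k = alpha k + 1 + of_nat (sum h UNIV)"
      unfolding S alpha_def by (simp add: field_simps)
    ultimately show ?thesis unfolding e using Gamma_real_pos[OF a] by (simp add: pochhammer_Gamma del: of_nat_sum)
  qed
  have "2 * (\<Prod>i\<in>UNIV. Gamma ((real (m i) + 1) / 2 + k $ i)) / Gamma ((real (sum m UNIV) + real CARD('d)) / 2 + abs_mult k)
    = sphere_mass k * sphere_moment (alpha k) (($) k) m"
    unfolding 1 2 sphere_mass_def sphere_moment_def using True
    by (simp add: S prod.distrib h_def[symmetric] mult_ac)
  then show ?thesis using sphere_integral_even[OF k, of m] True by simp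
next
  case False
  then obtain i0 where i0: "odd (m i0)" by auto
  have "has_bochner_integral sphere_measure (weighted_monomial k m) 0"
    by (rule sphere_integral_odd[where m=m and ?i0.0=i0, OF k i0])
  moreover from False have "sphere_moment (alpha k) (($) k) m = 0" unfolding sphere_moment_def by (simp only: if_False)
  ultimately show ?thesis by (simp only: mult_zero_right)
qed

lemma sphere_mass_pos:
  fixes k :: "real ^ 'd"
  assumes k: "\<And>i. k $ i \<ge> 0"
  shows "sphere_mass k > 0"
proof -
  have "alpha k + 1 > 0" using k by (rule alpha_plus_one_pos)
  then show ?thesis unfolding sphere_mass_def using k
    by (intro divide_pos_pos mult_pos_pos prod_pos Gamma_real_pos) (auto intro!: Gamma_real_pos add_nonneg_pos)
qed

section \<open>The reproducing kernel\<close>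

definition cone_monomial :: "('d \<Rightarrow> nat) \<Rightarrow> nat \<Rightarrow> (real ^ 'd) \<times> real \<Rightarrow> real" where
  "cone_monomial m j z = (\<Prod>i\<in>UNIV. (fst z $ i) ^ m i) * snd z ^ j"

lemma cone_monomial_mult:
  "cone_monomial m j z * cone_monomial m' j' z = cone_monomial (\<lambda>i. m i + m' i) (j + j') z"
  by (simp add: cone_monomial_def power_add prod.distrib mult_ac)

lemma cone_integral_cong:
  assumes "\<And>z. z \<in> conic_surface \<Longrightarrow> f z = g z"
  shows "cone_integral f = cone_integral g"
  unfolding cone_integral_def
proof (rule set_lebesgue_integral_cong, simp, intro allI impI)
  fix t :: real assume "t \<in> {0..}"
  then have "(LINT \<xi>|sphere_measure. f (t *\<^sub>R \<xi>, t)) = (LINT \<xi>|sphere_measure. g (t *\<^sub>R \<xi>, t))"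
    by (intro Bochner_Integration.integral_cong refl assms) (simp add: space_sphere_measure conic_surface_def)
  then show "t ^ (CARD('a) - 1) * (LINT \<xi>|sphere_measure. f (t *\<^sub>R \<xi>, t)) = t ^ (CARD('a) - 1) * (LINT \<xi>|sphere_measure. g (t *\<^sub>R \<xi>, t))"
    by simp
qed

lemma cone_inner_cong:
  assumes "\<And>z. z \<in> conic_surface \<Longrightarrow> f z = f' z" "\<And>z. z \<in> conic_surface \<Longrightarrow> g z = g' z"
  shows "cone_inner k f g = cone_inner k f' g'"
  unfolding cone_inner_def using assms by (intro arg_cong2[where f="(*)"] refl cone_integral_cong) simp

lemma cone_inner_commute: "cone_inner k f g = cone_inner k g f"
  unfolding cone_inner_def by (simp only: mult.commute[of "f _"])

lemma alpha_nonneg: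
  fixes k :: "real ^ 'd"
  assumes "CARD('d) \<ge> 2" "\<And>i. k $ i \<ge> 0"
  shows "alpha k \<ge> 0"
  unfolding alpha_def abs_mult_def using assms by (intro add_nonneg_nonneg sum_nonneg) auto

lemma cone_integrand_scale:
  fixes k :: "real ^ 'd"
  assumes d: "CARD('d) \<ge> 2" and t: "t \<ge> 0"
  shows "t ^ (CARD('d) - 1) * (cone_monomial m j (t *\<^sub>R \<xi>, t) * cone_weight k (t *\<^sub>R \<xi>, t))
    = (t powr (2 * alpha k + real ((sum m UNIV) + j)) / exp t) * weighted_monomial k m \<xi>"
proof (cases "t = 0")
  \<comment> \<open>At the apex \<open>0 ^ (d - 1) = 0\<close> since the dimension is at least two,
    and the right side vanishes by \<open>0 powr b = 0\<close>.\<close>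
  case True
  then show ?thesis using d by (simp add: power_0_left)
next
  case False
  with t have t: "t > 0" by simp
  have "t ^ (CARD('d) - 1) = t powr (real CARD('d) - 1)"
    using t d by (simp add: powr_realpow[symmetric] of_nat_diff)
  moreover have "t ^ j = t powr real j" using t by (simp add: powr_realpow)
  moreover have "inverse t = t powr (-1)" using t by (simp add: powr_minus)
  ultimately have "t ^ (CARD('d) - 1) * t ^ j * inverse t * t powr (real (sum m UNIV) + 2 * abs_mult k)
    = t powr (real CARD('d) - 1 + real j + (-1) + (real (sum m UNIV) + 2 * abs_mult k))"
    by (simp only: powr_add)
  also have "real CARD('d) - 1 + real j + (-1) + (real (sum m UNIV) + 2 * abs_mult k) = 2 * alpha k + real ((sum m UNIV) + j)"
    unfolding alpha_def by (simp add: field_simps)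
  finally have e: "t ^ (CARD('d) - 1) * t ^ j * inverse t * t powr (real (sum m UNIV) + 2 * abs_mult k) = t powr (2 * alpha k + real ((sum m UNIV) + j))" .
  have "t ^ (CARD('d) - 1) * (cone_monomial m j (t *\<^sub>R \<xi>, t) * cone_weight k (t *\<^sub>R \<xi>, t))
    = t ^ (CARD('d) - 1) * t ^ j * inverse t * exp (- t) * weighted_monomial k m (t *\<^sub>R \<xi>)"
    unfolding weighted_monomial_def cone_monomial_def cone_weight_def by (simp only: prod.case fst_conv snd_conv mult_ac)
  also have "\<dots> = (t ^ (CARD('d) - 1) * t ^ j * inverse t * t powr (real (sum m UNIV) + 2 * abs_mult k)) * exp (- t) * weighted_monomial k m \<xi>"
    unfolding weighted_monomial_scale[OF t] by (simp only: mult_ac)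
  finally show ?thesis unfolding e exp_minus divide_inverse .
qed

text \<open>Homogeneity separates the variables: a sphere moment times a Gamma integral in
  \<open>t\<close>. The exponent \<open>2 * alpha k\<close> collects \<open>t ^ (d - 1)\<close>, the
  factor \<open>inverse t\<close> and the homogeneity of \<open>h^2\<close>.\<close>

lemma cone_integral_sum_monomials:
  fixes k :: "real ^ 'd"
  assumes d: "CARD('d) \<ge> 2" and k: "\<And>i. k $ i \<ge> 0"
  shows "cone_integral (\<lambda>z. (\<Sum>e\<in>I. c e * cone_monomial (m e) (j e) z) * cone_weight k z)
    = sphere_mass k * Gamma (2 * alpha k + 1) * (\<Sum>e\<in>I. c e * cone_moment (alpha k) (($) k) (m e) (j e))"
proof -
  define N where "N e = (\<Sum>i\<in>UNIV. m e i) + j e" for e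
  define \<sigma> where "\<sigma> e = sphere_mass k * sphere_moment (alpha k) (($) k) (m e)" for e
  define g where "g e t = t powr (2 * alpha k + real (N e)) / exp t" for e and t :: real
  have a: "alpha k \<ge> 0" using d k by (rule alpha_nonneg)
  let ?S = "\<lambda>t x. (\<Sum>e\<in>I. c e * cone_monomial (m e) (j e) (t *\<^sub>R x, t)) * cone_weight k (t *\<^sub>R x, t)"
  have inner: "t ^ (CARD('d) - 1) * (LINT \<xi>|sphere_measure. ?S t \<xi>)
     = (\<Sum>e\<in>I. c e * \<sigma> e * g e t)" if t: "t \<ge> 0" for t
  proof -
    have "t ^ (CARD('d) - 1) * (LINT \<xi>|sphere_measure. ?S t \<xi>)
      = (LINT \<xi>|sphere_measure. t ^ (CARD('d) - 1) * (?S t \<xi>))"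
      by (rule integral_mult_right_zero[symmetric])
    also have "\<dots> = (LINT \<xi>|sphere_measure. (\<Sum>e\<in>I. c e * g e t * weighted_monomial k (m e) \<xi>))"
    proof (rule Bochner_Integration.integral_cong[OF refl])
      fix \<xi> :: "real ^ 'd"
      have "t ^ (CARD('d) - 1) * (?S t \<xi>)
        = (\<Sum>e\<in>I. c e * (t ^ (CARD('d) - 1) * (cone_monomial (m e) (j e) (t *\<^sub>R \<xi>, t) * cone_weight k (t *\<^sub>R \<xi>, t))))"
        unfolding sum_distrib_left sum_distrib_right by (simp only: mult_ac)
      then show "t ^ (CARD('d) - 1) * (?S t \<xi>)
        = (\<Sum>e\<in>I. c e * g e t * weighted_monomial k (m e) \<xi>)"
        unfolding cone_integrand_scale[OF d t] g_def N_def by (simp only: mult.assoc)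
    qed
    also have "\<dots> = (\<Sum>e\<in>I. c e * g e t * \<sigma> e)"
      unfolding \<sigma>_def
      by (rule has_bochner_integral_integral_eq)
        (intro has_bochner_integral_sum has_bochner_integral_mult_right sphere_integral k)
    finally show ?thesis by (simp only: mult_ac)
  qed
  have G: "has_bochner_integral lborel (\<lambda>t. indicator {0..} t *\<^sub>R g e t) (Gamma (2 * alpha k + real (N e) + 1))" for e
  proof -
    have "((\<lambda>t. t powr ((2 * alpha k + real (N e) + 1) - 1) / exp t) has_integral Gamma (2 * alpha k + real (N e) + 1)) {0..}"
      using a by (intro Gamma_integral_real) auto
    then have "(g e has_integral Gamma (2 * alpha k + real (N e) + 1)) {0..}" by (simp add: g_def[abs_def])
    then show ?thesis by (rule has_bochner_integral_of_has_integral) (auto simp: g_def[abs_def])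
  qed
  have "cone_integral (\<lambda>z. (\<Sum>e\<in>I. c e * cone_monomial (m e) (j e) z) * cone_weight k z)
    = (LINT t:{0..}|lborel. (\<Sum>e\<in>I. c e * \<sigma> e * g e t))"
    unfolding cone_integral_def by (rule set_lebesgue_integral_cong, simp, intro allI impI, rule inner) simp
  also have "\<dots> = (LINT t|lborel. (\<Sum>e\<in>I. c e * \<sigma> e * (indicator {0..} t *\<^sub>R g e t)))"
    unfolding set_lebesgue_integral_def
    by (rule Bochner_Integration.integral_cong[OF refl]) (simp add: sum_distrib_left mult_ac)
  also have "\<dots> = (\<Sum>e\<in>I. c e * \<sigma> e * Gamma (2 * alpha k + real (N e) + 1))"
    by (rule has_bochner_integral_integral_eq)
      (intro has_bochner_integral_sum has_bochner_integral_mult_right G)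
  also have "\<dots> = sphere_mass k * Gamma (2 * alpha k + 1) * (\<Sum>e\<in>I. c e * cone_moment (alpha k) (($) k) (m e) (j e))"
    unfolding sum_distrib_left
  proof (rule sum.cong[OF refl])
    fix e
    have p: "2 * alpha k + 1 > 0" using a by simp
    then have "2 * alpha k + 1 \<notin> \<int>\<^sub>\<le>\<^sub>0" by (auto dest: nonpos_Ints_nonpos)
    then have "pochhammer (2 * alpha k + 1) (N e) * Gamma (2 * alpha k + 1) = Gamma (2 * alpha k + 1 + of_nat (N e))"
      using Gamma_real_pos[OF p] by (simp add: pochhammer_Gamma)
    also have "2 * alpha k + 1 + of_nat (N e) = 2 * alpha k + real (N e) + 1" by simp
    finally have "Gamma (2 * alpha k + real (N e) + 1) = pochhammer (2 * alpha k + 1) (N e) * Gamma (2 * alpha k + 1)" ..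
    then show "c e * \<sigma> e * Gamma (2 * alpha k + real (N e) + 1) = sphere_mass k * Gamma (2 * alpha k + 1) * (c e * cone_moment (alpha k) (($) k) (m e) (j e))"
      unfolding \<sigma>_def cone_moment_def N_def by (simp only: mult_ac)
  qed
  finally show ?thesis .
qed

text \<open>The constant monomial determines \<open>norm_const\<close>, and the masses cancel. From
  here on inner products of polynomials are finite sums of \<open>cone_moment\<close> and integrals
  over the cone do not reappear.\<close>

lemma cone_inner_sum_monomials:
  fixes k :: "real ^ 'd"
  assumes d: "CARD('d) \<ge> 2" and k: "\<And>i. k $ i \<ge> 0"
    and fg: "\<And>z. z \<in> conic_surface \<Longrightarrow> f z * g z = (\<Sum>e\<in>I. c e * cone_monomial (m e) (j e) z)"
  shows "cone_inner k f g = (\<Sum>e\<in>I. c e * cone_moment (alpha k) (($) k) (m e) (j e))"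
proof -
  have "cone_integral (cone_weight k) = cone_integral (\<lambda>z. (\<Sum>e\<in>{()}. 1 * cone_monomial (\<lambda>_. 0) 0 z) * cone_weight k z)"
    by (simp add: cone_monomial_def)
  also have "\<dots> = sphere_mass k * Gamma (2 * alpha k + 1)"
    unfolding cone_integral_sum_monomials[OF d k] by (simp add: cone_moment_def sphere_moment_def)
  finally have n: "norm_const k = 1 / (sphere_mass k * Gamma (2 * alpha k + 1))" by (simp add: norm_const_def)
  have "2 * alpha k + 1 > 0" using alpha_nonneg[OF d k] by simp
  then have pos: "sphere_mass k * Gamma (2 * alpha k + 1) > 0"
    using sphere_mass_pos[OF k] Gamma_real_pos by (intro mult_pos_pos) auto
  have "cone_integral (\<lambda>z. f z * g z * cone_weight k z) = cone_integral (\<lambda>z. (\<Sum>e\<in>I. c e * cone_monomial (m e) (j e) z) * cone_weight k z)"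
    by (rule cone_integral_cong) (simp add: fg)
  moreover have "1 / C * (C * S) = S" if "C > 0" for C S :: real using that by simp
  ultimately show ?thesis
    unfolding cone_inner_def n cone_integral_sum_monomials[OF d k] using pos by (simp only:)
qed

text \<open>Linearity is read off from the moments, so that no integrability has to be
  discussed.\<close>

lemma cone_inner_linear_left:
  fixes k :: "real ^ 'd"
  assumes d: "CARD('d) \<ge> 2" and k: "\<And>i. k $ i \<ge> 0"
    and f: "\<And>z. z \<in> conic_surface \<Longrightarrow> f z = (\<Sum>e\<in>E. a e * cone_monomial (m e) (j e) z)"
    and g: "\<And>z. z \<in> conic_surface \<Longrightarrow> g z = (\<Sum>e\<in>I. b e * cone_monomial (m' e) (j' e) z)"
  shows "cone_inner k f g = (\<Sum>e\<in>E. a e * cone_inner k (cone_monomial (m e) (j e)) g)"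
proof -
  have 1: "cone_inner k (cone_monomial \<mu> q) g = (\<Sum>e\<in>I. b e * cone_moment (alpha k) (($) k) (\<lambda>i. \<mu> i + m' e i) (q + j' e))" for \<mu> q
    by (rule cone_inner_sum_monomials[OF d k])
      (simp add: g sum_distrib_left cone_monomial_mult[symmetric] mult_ac)
  have "cone_inner k f g = (\<Sum>(e, e')\<in>E \<times> I. a e * b e' * cone_moment (alpha k) (($) k) (\<lambda>i. m e i + m' e' i) (j e + j' e'))"
    unfolding case_prod_unfold
    by (rule cone_inner_sum_monomials[OF d k])
      (simp add: f g sum_product sum.cartesian_product case_prod_unfold cone_monomial_mult[symmetric] mult_ac)
  also have "\<dots> = (\<Sum>e\<in>E. \<Sum>e'\<in>I. a e * b e' * cone_moment (alpha k) (($) k) (\<lambda>i. m e i + m' e' i) (j e + j' e'))"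
    by (rule sum.cartesian_product[symmetric])
  finally show ?thesis unfolding 1 by (simp add: sum_distrib_left mult_ac)
qed

section \<open>Polynomials of bounded degree and the explicit kernel\<close>

lemma polys_upto_iff:
  "f \<in> polys_upto n \<longleftrightarrow> (\<exists>c. \<forall>z. f z = (\<Sum>e\<in>exponents n. c e * cone_monomial (fst e) (snd e) z))"
proof
  assume "f \<in> polys_upto n"
  then obtain c where c: "\<And>x t. f (x, t) = (\<Sum>(m, k)\<in>exponents n. c m k * (\<Prod>i\<in>UNIV. (x $ i) ^ m i) * t ^ k)"
    unfolding polys_upto_def by blast
  show "\<exists>c. \<forall>z. f z = (\<Sum>e\<in>exponents n. c e * cone_monomial (fst e) (snd e) z)"
    by (rule exI[of _ "\<lambda>e. c (fst e) (snd e)"]) (auto simp: c cone_monomial_def case_prod_unfold mult.assoc)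
next
  assume "\<exists>c. \<forall>z. f z = (\<Sum>e\<in>exponents n. c e * cone_monomial (fst e) (snd e) z)"
  then obtain c where c: "\<And>z. f z = (\<Sum>e\<in>exponents n. c e * cone_monomial (fst e) (snd e) z)" by blast
  show "f \<in> polys_upto n"
    unfolding polys_upto_def
    by (rule CollectI, rule exI[of _ "\<lambda>m k. c (m, k)"]) (auto simp: c cone_monomial_def case_prod_unfold mult.assoc)
qed

lemma polys_upto_monomial:
  assumes "(sum m UNIV) + j \<le> n"
  shows "cone_monomial m j \<in> polys_upto n"
  unfolding polys_upto_iff
proof (rule exI[of _ "\<lambda>e. if e = (m, j) then 1 else 0"], rule allI)
  fix z
  have "(m, j) \<in> exponents n" using assms by (simp add: exponents_def)
  then have "cone_monomial m j z = (\<Sum>e\<in>exponents n. if e = (m, j) then cone_monomial (fst e) (snd e) z else 0)"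
    by (simp add: sum.delta finite_exponents)
  also have "\<dots> = (\<Sum>e\<in>exponents n. (if e = (m, j) then 1 else 0) * cone_monomial (fst e) (snd e) z)"
    by (rule sum.cong) auto
  finally show "cone_monomial m j z = (\<Sum>e\<in>exponents n. (if e = (m, j) then 1 else 0) * cone_monomial (fst e) (snd e) z)" .
qed

lemma polys_upto_cmult:
  assumes "f \<in> polys_upto n"
  shows "(\<lambda>z. c * f z) \<in> polys_upto n"
proof -
  obtain a where a: "\<And>z. f z = (\<Sum>e\<in>exponents n. a e * cone_monomial (fst e) (snd e) z)"
    using assms unfolding polys_upto_iff by blast
  show ?thesis unfolding polys_upto_iff
    by (rule exI[of _ "\<lambda>e. c * a e"]) (simp add: a sum_distrib_left mult_ac)
qed

lemma polys_upto_sum: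
  assumes "\<And>i. i \<in> I \<Longrightarrow> f i \<in> polys_upto n"
  shows "(\<lambda>z. \<Sum>i\<in>I. f i z) \<in> polys_upto n"
proof -
  have "\<forall>i\<in>I. \<exists>a. \<forall>z. f i z = (\<Sum>e\<in>exponents n. a e * cone_monomial (fst e) (snd e) z)"
    using assms unfolding polys_upto_iff by blast
  from bchoice[OF this] obtain a where a: "\<And>i z. i \<in> I \<Longrightarrow> f i z = (\<Sum>e\<in>exponents n. a i e * cone_monomial (fst e) (snd e) z)"
    by blast
  show ?thesis unfolding polys_upto_iff
  proof (rule exI[of _ "\<lambda>e. \<Sum>i\<in>I. a i e"], rule allI)
    fix z
    have "(\<Sum>i\<in>I. f i z) = (\<Sum>i\<in>I. \<Sum>e\<in>exponents n. a i e * cone_monomial (fst e) (snd e) z)"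
      by (rule sum.cong[OF refl a])
    also have "\<dots> = (\<Sum>e\<in>exponents n. \<Sum>i\<in>I. a i e * cone_monomial (fst e) (snd e) z)"
      by (rule sum.swap)
    finally show "(\<Sum>i\<in>I. f i z) = (\<Sum>e\<in>exponents n. (\<Sum>i\<in>I. a i e) * cone_monomial (fst e) (snd e) z)"
      by (simp only: sum_distrib_right)
  qed
qed

definition dunkl_power :: "real ^ 'd \<Rightarrow> real ^ 'd \<Rightarrow> real ^ 'd \<Rightarrow> nat \<Rightarrow> real" where
  "dunkl_power k x y l = (\<Sum>m\<in>multi_indices l. \<Prod>i\<in>UNIV. (x $ i * y $ i) ^ m i / dunkl_fact (k $ i) (m i))"

text \<open>Up to the factor \<open>l!\<close>, \<open>dunkl_power k x y l\<close> is the Dunkl intertwining operator applied to \<open>\<langle>\<cdot>, y\<rangle>\<^sup>l\<close>.\<close>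

definition cone_kernel :: "real ^ 'd \<Rightarrow> nat \<Rightarrow> (real ^ 'd) \<times> real \<Rightarrow> (real ^ 'd) \<times> real \<Rightarrow> real" where
  "cone_kernel k n z w =
     (\<Sum>p\<le>n. laguerre (n - p) (2 * alpha k + 2 * of_nat p) (snd z + snd w) / (2 ^ p * pochhammer (alpha k + 1/2) p)
        * (\<Sum>l\<le>p. (snd z * snd w) ^ (p - l) / fact (p - l) * dunkl_power k (fst z) (fst w) l))"

definition cone_kernel_coeff :: "real ^ 'd \<Rightarrow> nat \<Rightarrow> (real ^ 'd) \<times> real \<Rightarrow> nat \<Rightarrow> nat \<Rightarrow> nat \<Rightarrow> ('d \<Rightarrow> nat) \<Rightarrow> real" where
  "cone_kernel_coeff k n w p i l m =
     (- 1) ^ i / fact i * laguerre_shift_coeff (alpha k) (snd w) n p i / (2 ^ p * pochhammer (alpha k + 1/2) p)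
           * (snd w ^ (p - l) / fact (p - l)) * (\<Prod>i\<in>UNIV. (fst w $ i) ^ m i / dunkl_fact (k $ i) (m i))"

text \<open>For fixed \<open>w\<close> this exhibits a polynomial in \<open>z\<close>; the exponent
  of \<open>t\<close> is \<open>i\<close> from the Laguerre factor plus \<open>p - l\<close> from
  the powers of \<open>t s\<close>, and the total degree \<open>p + i\<close> is at most
  \<open>n\<close>.\<close>

lemma cone_kernel_expand:
  "cone_kernel k n z w = (\<Sum>p\<le>n. \<Sum>i\<le>n - p. \<Sum>l\<le>p. \<Sum>m\<in>multi_indices l.
      cone_kernel_coeff k n w p i l m * cone_monomial m (i + (p - l)) z)"
  unfolding cone_kernel_def
proof (rule sum.cong[OF refl])
  fix p assume "p \<in> {..n}"
  then have p: "p \<le> n" by simp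
  let ?L = "laguerre (n - p) (2 * alpha k + 2 * of_nat p) (snd z + snd w) / (2 ^ p * pochhammer (alpha k + 1/2) p) * (\<Sum>l\<le>p. (snd z * snd w) ^ (p - l) / fact (p - l) * dunkl_power k (fst z) (fst w) l)"
  have "?L
    = (\<Sum>i\<le>n - p. \<Sum>l\<le>p. \<Sum>m\<in>multi_indices l. ((- snd z) ^ i / fact i * laguerre_shift_coeff (alpha k) (snd w) n p i) / (2 ^ p * pochhammer (alpha k + 1/2) p)
        * ((snd z * snd w) ^ (p - l) / fact (p - l) * (\<Prod>i\<in>UNIV. (fst z $ i * fst w $ i) ^ m i / dunkl_fact (k $ i) (m i))))"
    unfolding laguerre_shift[OF p] dunkl_power_def sum_divide_distrib
    by (simp only: sum_distrib_left sum_distrib_right) (subst sum.swap, simp only: sum.swap[of _ "{..n - p}"])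
  also have "\<dots> = (\<Sum>i\<le>n - p. \<Sum>l\<le>p. \<Sum>m\<in>multi_indices l. cone_kernel_coeff k n w p i l m * cone_monomial m (i + (p - l)) z)"
  proof (intro sum.cong refl)
    fix i l and m :: "'a \<Rightarrow> nat"
    have 1: "(- snd z) ^ i = (- 1) ^ i * snd z ^ i" by (rule power_minus)
    define Pz where "Pz = (\<Prod>i\<in>UNIV. (fst z $ i) ^ m i)"
    define Pw where "Pw = (\<Prod>i\<in>UNIV. (fst w $ i) ^ m i / dunkl_fact (k $ i) (m i))"
    have 2: "(\<Prod>i\<in>UNIV. (fst z $ i * fst w $ i) ^ m i / dunkl_fact (k $ i) (m i)) = Pz * Pw"
      by (simp add: Pz_def Pw_def prod.distrib[symmetric] power_mult_distrib)
    show "((- snd z) ^ i / fact i * laguerre_shift_coeff (alpha k) (snd w) n p i) / (2 ^ p * pochhammer (alpha k + 1/2) p)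
        * ((snd z * snd w) ^ (p - l) / fact (p - l) * (\<Prod>i\<in>UNIV. (fst z $ i * fst w $ i) ^ m i / dunkl_fact (k $ i) (m i)))
      = cone_kernel_coeff k n w p i l m * cone_monomial m (i + (p - l)) z"
      unfolding 1 2 cone_kernel_coeff_def cone_monomial_def Pz_def[symmetric] Pw_def[symmetric]
      unfolding power_add power_mult_distrib
      by (simp only: divide_inverse mult_ac)
  qed
  finally show "?L
     = (\<Sum>i\<le>n - p. \<Sum>l\<le>p. \<Sum>m\<in>multi_indices l. cone_kernel_coeff k n w p i l m * cone_monomial m (i + (p - l)) z)" .
qed

lemma cone_kernel_polys_upto: "(\<lambda>z. cone_kernel k n z w) \<in> polys_upto n"
  unfolding cone_kernel_expand
  by (intro polys_upto_sum polys_upto_cmult polys_upto_monomial) (auto simp: multi_indices_def)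

definition kernel_indices :: "nat \<Rightarrow> (nat \<times> nat \<times> nat \<times> ('d::finite \<Rightarrow> nat)) set" where
  "kernel_indices n = (SIGMA p:{..n}. SIGMA i:{..n - p}. SIGMA l:{..p}. multi_indices l)"

lemma sum_kernel_indices:
  "(\<Sum>p\<le>n. \<Sum>i\<le>n - p. \<Sum>l\<le>p. \<Sum>m\<in>multi_indices l. F p i l m) = (\<Sum>(p, i, l, m)\<in>kernel_indices n. F p i l m)"
  by (simp add: kernel_indices_def sum.Sigma)

lemma cone_inner_monomial_kernel:
  fixes k :: "real ^ 'd" and \<mu> :: "'d \<Rightarrow> nat" and j :: nat
  assumes d: "CARD('d) \<ge> 2" and k: "\<And>i. k $ i \<ge> 0" and w: "w \<in> conic_surface"
  defines "N \<equiv> (sum \<mu> UNIV) + j"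
  shows "n > N \<Longrightarrow> cone_inner k (cone_monomial \<mu> j) (\<lambda>z. cone_kernel k n z w) = 0"
    and "(\<Sum>n\<le>N. cone_inner k (cone_monomial \<mu> j) (\<lambda>z. cone_kernel k n z w)) = cone_monomial \<mu> j w"
proof -
  let ?K = "\<lambda>n. cone_inner k (cone_monomial \<mu> j) (\<lambda>z. cone_kernel k n z w)"
  define H where "H = Abs_fps (\<lambda>n. pochhammer (2 * alpha k + 1) (N + n) / (2 ^ n * pochhammer (alpha k + 1/2) n)
       * (\<Sum>l\<le>n. snd w ^ (n - l) / fact (n - l) * kernel_moment (alpha k) (($) k) \<mu> (($) (fst w)) l))"
  \<comment> \<open>The cone equation for the second point, in the form that
    \<open>exp_poly_kernel_moment\<close> requires.\<close>
  have s: "(snd w)\<^sup>2 = (\<Sum>i\<in>UNIV. (fst w $ i)\<^sup>2)"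
  proof -
    have "snd w = norm (fst w)" using w by (auto simp: conic_surface_def)
    moreover have "(norm (fst w))\<^sup>2 = fst w \<bullet> fst w" by (simp add: power2_norm_eq_inner)
    moreover have "fst w \<bullet> fst w = (\<Sum>i\<in>UNIV. (fst w $ i)\<^sup>2)" by (simp add: inner_vec_def power2_eq_square)
    ultimately show ?thesis by (simp only:)
  qed
  have H: "exp_poly (snd w) N (cone_monomial \<mu> j w) H"
    unfolding H_def cone_monomial_def
    by (rule exp_poly_kernel_moment) (use k alpha_nonneg[OF d k] s in \<open>auto simp: N_def\<close>)
  have "?K n = fps_nth (one_minus_X_powr (of_nat N) * (fps_exp (- snd w) oo geo_fps) * (H oo geo_fps)) n" for n
  proof -
    have "?K n
      = (\<Sum>(p, i, l, m)\<in>kernel_indices n. cone_kernel_coeff k n w p i l m * cone_moment (alpha k) (($) k) (\<lambda>i. \<mu> i + m i) (j + i + (p - l)))"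
      unfolding case_prod_unfold
    proof (rule cone_inner_sum_monomials[OF d k])
      fix z :: "(real ^ 'd) \<times> real"
      show "cone_monomial \<mu> j z * cone_kernel k n z w = (\<Sum>e\<in>kernel_indices n. cone_kernel_coeff k n w (fst e) (fst (snd e)) (fst (snd (snd e))) (snd (snd (snd e))) *
          cone_monomial (\<lambda>i. \<mu> i + snd (snd (snd e)) i) (j + fst (snd e) + (fst e - fst (snd (snd e)))) z)"
        unfolding cone_kernel_expand sum_kernel_indices sum_distrib_left case_prod_unfold
        by (rule sum.cong[OF refl]) (simp only: add.assoc cone_monomial_mult[symmetric] mult_ac)
    qed
    also have "\<dots> = fps_nth (one_minus_X_powr (of_nat N) * (fps_exp (- snd w) oo geo_fps) * (H oo geo_fps)) n"
      unfolding sum_kernel_indices[symmetric] cone_kernel_coeff_def H_def N_def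
      by (rule kernel_cone_moment)
    finally show ?thesis .
  qed
  then show "n > N \<Longrightarrow> ?K n = 0"
    and "(\<Sum>n\<le>N. ?K n) = cone_monomial \<mu> j w"
    using exp_poly_compose_geo[OF H] by simp_all
qed

lemma cone_inner_poly_kernel:
  fixes k :: "real ^ 'd"
  assumes d: "CARD('d) \<ge> 2" and k: "\<And>i. k $ i \<ge> 0" and w: "w \<in> conic_surface" and f: "f \<in> polys_upto N"
  shows "n > N \<Longrightarrow> cone_inner k f (\<lambda>z. cone_kernel k n z w) = 0"
    and "(\<Sum>n\<le>N. cone_inner k f (\<lambda>z. cone_kernel k n z w)) = f w"
proof -
  let ?K = "\<lambda>n. (\<lambda>z. cone_kernel k n z w)"
  obtain a where a: "\<And>z. f z = (\<Sum>e\<in>exponents N. a e * cone_monomial (fst e) (snd e) z)"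
    using f unfolding polys_upto_iff by blast
  have lin: "cone_inner k f (?K n) = (\<Sum>e\<in>exponents N. a e * cone_inner k (cone_monomial (fst e) (snd e)) (?K n))" for n
    by (rule cone_inner_linear_left[OF d k a]) (rule cone_kernel_expand[unfolded sum_kernel_indices case_prod_unfold])
  have e: "(\<Sum>i\<in>UNIV. fst e i) + snd e \<le> N" if "e \<in> exponents N" for e :: "('d \<Rightarrow> nat) \<times> nat"
    using that by (auto simp: exponents_def)
  show "cone_inner k f (?K n) = 0" if "n > N"
    unfolding lin
  proof (rule sum.neutral, rule ballI)
    fix e' :: "('d \<Rightarrow> nat) \<times> nat" assume "e' \<in> exponents N"
    then have "n > (\<Sum>i\<in>UNIV. fst e' i) + snd e'" using e that by fastforce
    then show "a e' * cone_inner k (cone_monomial (fst e') (snd e')) (?K n) = 0"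
      by (simp only: cone_inner_monomial_kernel(1)[OF d k w] mult_zero_right)
  qed
  have "(\<Sum>n\<le>N. cone_inner k (cone_monomial (fst e) (snd e)) (?K n)) = cone_monomial (fst e) (snd e) w"
    if "e \<in> exponents N" for e :: "('d \<Rightarrow> nat) \<times> nat"
  proof -
    \<comment> \<open>Kernels beyond the degree of a monomial contribute nothing, so all monomials
      of \<open>f\<close> can be summed up to the common bound \<open>N\<close>.\<close>
    have "(\<Sum>n\<le>N. cone_inner k (cone_monomial (fst e) (snd e)) (?K n))
      = (\<Sum>n\<le>(\<Sum>i\<in>UNIV. fst e i) + snd e. cone_inner k (cone_monomial (fst e) (snd e)) (?K n))"
      by (rule sum.mono_neutral_right) (use e[OF that] cone_inner_monomial_kernel(1)[OF d k w] in auto)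
    then show ?thesis using cone_inner_monomial_kernel(2)[OF d k w] by simp
  qed
  then show "(\<Sum>n\<le>N. cone_inner k f (?K n)) = f w"
    unfolding lin by (subst sum.swap) (simp add: sum_distrib_left[symmetric] a)
qed

section \<open>Existence and uniqueness of the reproducing kernel\<close>

text \<open>Pairing a section of \<open>L\<close> with a section of \<open>L'\<close> and evaluating
  in both ways gives \<open>L (p, q) = L' (q, p)\<close>. Taken for \<open>K\<close> and
  \<open>K'\<close>, and for \<open>K'\<close> with itself, this yields the equality.\<close>

lemma reproducing_kernel_unique:
  assumes K: "is_reproducing_kernel X V ip K" and K': "is_reproducing_kernel X V ip K'"
    and sym: "\<And>f g. ip f g = ip g f"
  shows "K = K'"
proof -
  have 1: "L (p, q) = L' (q, p)"
    if "is_reproducing_kernel X V ip L" "is_reproducing_kernel X V ip L'" "p \<in> X" "q \<in> X" for L L' p q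
  proof -
    have "L' (q, p) = ip (\<lambda>z. L' (z, p)) (\<lambda>z. L (z, q))"
      using that unfolding is_reproducing_kernel_def by auto
    also have "\<dots> = ip (\<lambda>z. L (z, q)) (\<lambda>z. L' (z, p))" by (rule sym)
    also have "\<dots> = L (p, q)"
      using that unfolding is_reproducing_kernel_def by auto
    finally show ?thesis ..
  qed
  show ?thesis
  proof (rule extensionalityI)
    show "K \<in> extensional (X \<times> X)" "K' \<in> extensional (X \<times> X)"
      using K K' unfolding is_reproducing_kernel_def by auto
    fix z assume "z \<in> X \<times> X"
    then show "K z = K' z" using 1[OF K K'] 1[OF K' K'] by (cases z) auto
  qed
qed

lemma is_reproducing_kernel_cone:
  fixes k :: "real ^ 'd"
  assumes d: "CARD('d) \<ge> 2" and k: "\<And>i. k $ i \<ge> 0"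
  shows "is_reproducing_kernel conic_surface (orth_space k n) (cone_inner k)
     (restrict (\<lambda>(z, w). cone_kernel k n z w) (conic_surface \<times> conic_surface))"
  unfolding is_reproducing_kernel_def
proof (intro conjI ballI)
  let ?K = "restrict (\<lambda>(z, w). cone_kernel k n z w) (conic_surface \<times> conic_surface)"
  fix w :: "(real ^ 'd) \<times> real" assume w: "w \<in> conic_surface"
  have eq: "(\<lambda>z. ?K (z, w)) = restrict (\<lambda>z. cone_kernel k n z w) conic_surface"
    using w by (auto simp: fun_eq_iff restrict_def)
  show "(\<lambda>z. ?K (z, w)) \<in> orth_space k n"
    unfolding eq orth_space_def
    using cone_inner_poly_kernel(1)[OF d k w] cone_kernel_polys_upto[of k n w]
    by (auto simp: cone_inner_commute[of k "\<lambda>z. cone_kernel k n z w"])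
  fix f assume "f \<in> orth_space k n"
  then obtain f0 where f0: "f = restrict f0 conic_surface" "f0 \<in> polys_upto n"
    and orth: "\<And>m g. m < n \<Longrightarrow> g \<in> polys_upto m \<Longrightarrow> cone_inner k f0 g = 0"
    unfolding orth_space_def by auto
  have "f w = (\<Sum>m\<le>n. cone_inner k f0 (\<lambda>z. cone_kernel k m z w))"
    using w f0 cone_inner_poly_kernel(2)[OF d k w f0(2)] by simp
  \<comment> \<open>The kernels with \<open>m < n\<close> are polynomials of degree at most
    \<open>m\<close> in the first point, hence orthogonal to \<open>f0\<close>; only the kernel of
    degree \<open>n\<close> reproduces it.\<close>
  also have "\<dots> = (\<Sum>m\<in>{n}. cone_inner k f0 (\<lambda>z. cone_kernel k m z w))"
    by (rule sum.mono_neutral_right) (auto intro!: orth cone_kernel_polys_upto)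
  also have "\<dots> = cone_inner k f (restrict (\<lambda>z. cone_kernel k n z w) conic_surface)"
    unfolding f0 sum.insert by (simp, rule cone_inner_cong) auto
  finally show "cone_inner k f (\<lambda>z. ?K (z, w)) = f w"
    unfolding eq ..
qed simp

lemma kernel_P_eq:
  fixes k :: "real ^ 'd"
  assumes d: "CARD('d) \<ge> 2" and k: "\<And>i. k $ i \<ge> 0" and "z \<in> conic_surface" "w \<in> conic_surface"
  shows "kernel_P k n z w = cone_kernel k n z w"
proof -
  let ?K = "restrict (\<lambda>(z, w). cone_kernel k n z w) (conic_surface \<times> conic_surface)"
  have "(THE K. is_reproducing_kernel conic_surface (orth_space k n) (cone_inner k) K) = ?K"
  proof (rule the_equality)
    show "is_reproducing_kernel conic_surface (orth_space k n) (cone_inner k) (?K)"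
      by (rule is_reproducing_kernel_cone[OF d k])
    show "K = ?K"
      if "is_reproducing_kernel conic_surface (orth_space k n) (cone_inner k) K" for K
      by (rule reproducing_kernel_unique[OF that is_reproducing_kernel_cone[OF d k] cone_inner_commute])
  qed
  then show ?thesis using assms(3,4) by (simp add: kernel_P_def)
qed

section \<open>The integral over the cube\<close>

lemma fps_exp_sum: "finite A \<Longrightarrow> (\<Prod>i\<in>A. fps_exp (b i)) = fps_exp (\<Sum>i\<in>A. b i :: real)"
  by (induction A rule: finite_induct) (simp_all add: fps_exp_add_mult)

text \<open>Coefficients of \<open>\<Prod> exp (b_i X) = exp (\<Sum> b_i X)\<close>.\<close>

lemma multinomial:
  fixes b :: "'i::finite \<Rightarrow> real"
  shows "(sum b UNIV) ^ l / fact l = (\<Sum>m\<in>multi_indices l. \<Prod>i\<in>UNIV. b i ^ m i / fact (m i))"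
proof -
  have "(sum b UNIV) ^ l / fact l = fps_nth (\<Prod>i\<in>UNIV. fps_exp (b i)) l"
    by (simp add: fps_exp_sum)
  also have "\<dots> = (\<Sum>m\<in>multi_indices l. \<Prod>i\<in>UNIV. b i ^ m i / fact (m i))"
    by (simp add: fps_nth_prod_multi_indices)
  finally show ?thesis .
qed

lemma binomial_over_fact:
  fixes a b :: real
  shows "(a + b) ^ p / fact p = (\<Sum>l\<le>p. a ^ (p - l) / fact (p - l) * (b ^ l / fact l))"
proof -
  have "(a + b) ^ p / fact p = fps_nth (fps_exp b * fps_exp a) p"
    by (simp add: fps_exp_add_mult[symmetric] add.commute)
  also have "\<dots> = (\<Sum>l=0..p. b ^ l / fact l * (a ^ (p - l) / fact (p - l)))"
    by (simp add: fps_mult_nth)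
  finally show ?thesis by (simp add: atLeast0AtMost mult.commute)
qed

lemma fact_eq_pochhammer_half:
  "(fact m :: real) = 2 ^ m * fact (m div 2) * pochhammer (1/2) ((m + 1) div 2)"
proof (cases "even m")
  case True
  then obtain b where m: "m = 2 * b" by (elim evenE)
  show ?thesis unfolding m using fact_double[of b, where 'a=real] by simp
next
  case False
  then obtain b where m: "m = 2 * b + 1" by (elim oddE)
  have "(2 * b + 1 + 1) div 2 = Suc b" "(2 * b + 1) div 2 = b" by simp_all
  moreover have "(fact (2 * b + 1) :: real) = (2 * real b + 1) * fact (2 * b)" by simp
  ultimately show ?thesis unfolding m using fact_double[of b, where 'a=real]
    by (simp add: pochhammer_Suc algebra_simps del: fact_Suc)
qed

lemma dunkl_fact_0: "dunkl_fact 0 m = fact m"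
  unfolding dunkl_fact_def fact_eq_pochhammer_half[of m] by simp

text \<open>The unnormalized moment of \<open>u_i\<close>. Because of the factor
  \<open>1 + u\<close>, the powers \<open>m\<close> and \<open>m + 1\<close> both occur, and exactly
  one of them is even; this explains \<open>(m + 1) div 2\<close>.\<close>

definition line_moment :: "real \<Rightarrow> nat \<Rightarrow> real" where
  "line_moment k m = (if k = 0 then 1 else Beta (real ((m + 1) div 2) + 1/2) k)"

text \<open>After normalization the moments are quotients of factorials, also for the Dirac case.
  The numerator cancels the \<open>m!\<close> of the multinomial expansion and leaves the Dunkl
  factorial.\<close>

lemma line_moment_normalized:
  assumes k: "k \<ge> 0"
  shows "(if k = 0 then 1 else c_const (k - 1/2)) * line_moment k m = fact m / dunkl_fact k m"
proof (cases "k = 0")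
  case True
  then show ?thesis by (simp add: line_moment_def dunkl_fact_0)
next
  case False
  with k have k: "k > 0" by simp
  define h where "h = (m + 1) div 2"
  have G: "Gamma (z + real h) = pochhammer z h * Gamma z" if "z > 0" for z :: real
  proof -
    have "z \<notin> \<int>\<^sub>\<le>\<^sub>0" using that by (auto dest: nonpos_Ints_nonpos)
    then show ?thesis using Gamma_real_pos[OF that] by (simp add: pochhammer_Gamma)
  qed
  have pos: "Gamma (1/2 :: real) > 0" "Gamma k > 0" "Gamma (k + 1/2) > 0" "pochhammer (k + 1/2) h > 0"
    using k by (auto intro!: Gamma_real_pos pochhammer_pos)
  have "Beta (real h + 1/2) k = Gamma (1/2 + real h) * Gamma k / Gamma (k + 1/2 + real h)"
    by (simp add: Beta_def add_ac)
  also have "\<dots> = pochhammer (1/2) h * Gamma (1/2) * Gamma k / (pochhammer (k + 1/2) h * Gamma (k + 1/2))"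
    using k by (simp only: G[of "1/2"] G[of "k + 1/2"] zero_less_divide_1_iff zero_less_numeral add_pos_pos)
  finally have B: "Beta (real h + 1/2) k = pochhammer (1/2) h * Gamma (1/2) * Gamma k / (pochhammer (k + 1/2) h * Gamma (k + 1/2))" .
  have c: "c_const (k - 1/2) = Gamma (k + 1/2) / (Gamma (1/2) * Gamma k)"
    unfolding c_const_def by (simp add: add.commute)
  have "c_const (k - 1/2) * Beta (real h + 1/2) k = pochhammer (1/2) h / pochhammer (k + 1/2) h"
    unfolding B c using pos by (simp add: Gamma_one_half_real field_simps)
  also have "\<dots> = fact m / dunkl_fact k m"
    unfolding dunkl_fact_def fact_eq_pochhammer_half[of m] h_def[symmetric] by simp
  finally show ?thesis using k by (simp add: line_moment_def h_def)
qed

lemma has_bochner_integral_line: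
  assumes k: "k \<ge> 0"
  shows "has_bochner_integral (if k = 0 then return lborel 1 else lborel)
     (\<lambda>u::real. indicator {-1..1} u * (u ^ m * (if k = 0 then 1 else (1 + u) * (1 - u\<^sup>2) powr (k - 1)))) (line_moment k m)"
proof (cases "k = 0")
  case True
  interpret prob_space "return lborel (1::real)" by (rule prob_space_return) simp
  have AE: "AE u in return lborel (1::real). indicator {-1..1} u * (u ^ m * 1) = (1::real)"
    by (subst AE_return) (auto simp: measurable_sets)
  have "has_bochner_integral (return lborel (1::real)) (\<lambda>_. 1) (1::real)"
    using prob_space by (simp add: has_bochner_integral_iff)
  then have "has_bochner_integral (return lborel (1::real)) (\<lambda>u. indicator {-1..1} u * (u ^ m * 1)) (1::real)"
    by (subst has_bochner_integral_cong_AE[OF _ _ AE]) auto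
  then show ?thesis using True by (simp add: line_moment_def)
next
  case False
  with k have k: "k > 0" by simp
  let ?I = "\<lambda>m. if even m then Beta ((real m + 1) / 2) k else 0"
  have "has_bochner_integral lborel (\<lambda>u::real. indicator {-1..1} u *\<^sub>R (u ^ m * (1 - u\<^sup>2) powr (k - 1)) + indicator {-1..1} u *\<^sub>R (u ^ Suc m * (1 - u\<^sup>2) powr (k - 1))) (?I m + ?I (Suc m))"
    by (intro has_bochner_integral_add has_bochner_integral_symmetric_beta k)
  also have "(\<lambda>u::real. indicator {-1..1} u *\<^sub>R (u ^ m * (1 - u\<^sup>2) powr (k - 1)) + indicator {-1..1} u *\<^sub>R (u ^ Suc m * (1 - u\<^sup>2) powr (k - 1)))
    = (\<lambda>u. indicator {-1..1} u * (u ^ m * ((1 + u) * (1 - u\<^sup>2) powr (k - 1))))"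
    by (rule ext) (simp add: algebra_simps)
  also have "?I m + ?I (Suc m) = Beta (real ((m + 1) div 2) + 1/2) k"
  proof (cases "even m")
    case True
    then obtain b where m: "m = 2 * b" by (elim evenE)
    have "(real (2 * b) + 1) / 2 = real b + 1/2" "(2 * b + 1) div 2 = b" by (simp_all add: field_simps)
    then show ?thesis unfolding m by (simp only:) simp
  next
    case False
    then obtain b where m: "m = 2 * b + 1" by (elim oddE)
    have "(real (Suc (2 * b + 1)) + 1) / 2 = real (b + 1) + 1/2" "(2 * b + 1 + 1) div 2 = b + 1" by (simp_all add: field_simps)
    then show ?thesis unfolding m by (simp only:) simp
  qed
  finally show ?thesis using k by (simp add: line_moment_def)
qed

lemma indicator_cube:
  fixes u :: "'d::finite \<Rightarrow> real"
  shows "indicator cube u = (\<Prod>i\<in>UNIV. indicator {-1..1} (u i) :: real)"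
proof (cases "u \<in> cube")
  case True
  then show ?thesis by (simp add: cube_def)
next
  case False
  then obtain i where "u i \<notin> {-1..1}" by (auto simp: cube_def)
  then have "indicator {-1..1} (u i) = (0 :: real)" by (simp add: indicator_def)
  then have "(\<Prod>i\<in>UNIV. indicator {-1..1} (u i) :: real) = 0" by (intro prod_zero) auto
  with False show ?thesis by simp
qed

text \<open>The integrand is a product over the coordinates, and both the Dirac and the Lebesgue
  factors of the measure are sigma-finite, so the integral factorizes.\<close>

lemma has_bochner_integral_cube_monomial:
  fixes k :: "real ^ 'd"
  assumes k: "\<And>i. k $ i \<ge> 0"
  shows "has_bochner_integral (du_measure k) (\<lambda>u. indicator cube u *\<^sub>R ((\<Prod>i\<in>UNIV. u i ^ m i) * Phi k u))
     (\<Prod>i\<in>UNIV. line_moment (k $ i) (m i))"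
proof -
  define M :: "'d \<Rightarrow> real measure" where "M i = (if k $ i = 0 then return lborel 1 else lborel)" for i
  define f where "f i u = indicator {-1..1} u * (u ^ m i * (if k $ i = 0 then 1 else (1 + u) * (1 - u\<^sup>2) powr (k $ i - 1)))" for i and u :: real
  have f: "has_bochner_integral (M i) (f i) (line_moment (k $ i) (m i))" for i
    unfolding M_def f_def[abs_def] by (rule has_bochner_integral_line[OF k])
  have sf: "sigma_finite_measure (M i)" for i
  proof (cases "k $ i = 0")
    case True
    interpret prob_space "return lborel (1::real)" by (rule prob_space_return) simp
    show ?thesis using True by (simp add: M_def sigma_finite_measure_axioms)
  qed (simp add: M_def sigma_finite_lborel)
  interpret product_sigma_finite M by (rule product_sigma_finite.intro) (rule sf)
  have "has_bochner_integral (Pi\<^sub>M UNIV M) (\<lambda>u. \<Prod>i\<in>UNIV. f i (u i)) (\<Prod>i\<in>UNIV. line_moment (k $ i) (m i))"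
    unfolding has_bochner_integral_iff
  proof
    show "integrable (Pi\<^sub>M UNIV M) (\<lambda>u. \<Prod>i\<in>UNIV. f i (u i))"
      using f by (intro product_integrable_prod) (auto simp: has_bochner_integral_iff)
    have "(\<integral>u. (\<Prod>i\<in>UNIV. f i (u i)) \<partial>Pi\<^sub>M UNIV M) = (\<Prod>i\<in>UNIV. \<integral>u. f i u \<partial>M i)"
      using f by (intro product_integral_prod) (auto simp: has_bochner_integral_iff)
    then show "(\<integral>u. (\<Prod>i\<in>UNIV. f i (u i)) \<partial>Pi\<^sub>M UNIV M) = (\<Prod>i\<in>UNIV. line_moment (k $ i) (m i))"
      using f by (simp add: has_bochner_integral_iff)
  qed
  moreover have "(\<lambda>u. \<Prod>i\<in>UNIV. f i (u i)) = (\<lambda>u. indicator cube u *\<^sub>R ((\<Prod>i\<in>UNIV. u i ^ m i) * Phi k u))"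
    by (rule ext) (simp add: f_def indicator_cube Phi_def prod.distrib)
  ultimately show ?thesis by (simp add: du_measure_def M_def[abs_def])
qed

lemma has_bochner_integral_cube_power:
  fixes k :: "real ^ 'd"
  assumes k: "\<And>i. k $ i \<ge> 0"
  shows "has_bochner_integral (du_measure k)
      (\<lambda>u. indicator cube u *\<^sub>R ((b + (\<Sum>i\<in>UNIV. a i * u i)) ^ p / fact p * Phi k u))
     (\<Sum>l\<le>p. b ^ (p - l) / fact (p - l) * (\<Sum>m\<in>multi_indices l. (\<Prod>i\<in>UNIV. a i ^ m i / fact (m i)) * (\<Prod>i\<in>UNIV. line_moment (k $ i) (m i))))"
proof -
  let ?q = "\<lambda>u l. b ^ (p - l) / fact (p - l) * (\<Sum>m\<in>multi_indices l. (\<Prod>i\<in>UNIV. a i ^ m i / fact (m i)) * (indicator cube u *\<^sub>R ((\<Prod>i\<in>UNIV. u i ^ m i) * Phi k u)))"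
  have "(\<lambda>u. indicator cube u *\<^sub>R ((b + (\<Sum>i\<in>UNIV. a i * u i)) ^ p / fact p * Phi k u))
    = (\<lambda>u. \<Sum>l\<le>p. ?q u l)"
  proof (rule ext)
    fix u :: "'d \<Rightarrow> real"
    have 1: "(\<Prod>i\<in>UNIV. (a i * u i) ^ m i / fact (m i)) = (\<Prod>i\<in>UNIV. a i ^ m i / fact (m i)) * (\<Prod>i\<in>UNIV. u i ^ m i)" for m
      by (simp add: prod.distrib[symmetric] power_mult_distrib)
    show "indicator cube u *\<^sub>R ((b + (\<Sum>i\<in>UNIV. a i * u i)) ^ p / fact p * Phi k u)
      = (\<Sum>l\<le>p. ?q u l)"
      unfolding binomial_over_fact multinomial 1 real_scaleR_def sum_distrib_left sum_distrib_right
      by (simp only: mult_ac)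
  qed
  then show ?thesis
    by (simp only:) (intro has_bochner_integral_sum has_bochner_integral_mult_right has_bochner_integral_cube_monomial k)
qed

lemma cube_moment_dunkl_power:
  fixes k :: "real ^ 'd"
  assumes k: "\<And>i. k $ i \<ge> 0"
  shows "c_prod k * (\<Sum>m\<in>multi_indices l. (\<Prod>i\<in>UNIV. (x $ i * y $ i) ^ m i / fact (m i)) * (\<Prod>i\<in>UNIV. line_moment (k $ i) (m i)))
    = dunkl_power k x y l"
  unfolding dunkl_power_def sum_distrib_left
proof (rule sum.cong[OF refl])
  fix m :: "'d \<Rightarrow> nat"
  have "c_prod k * ((\<Prod>i\<in>UNIV. (x $ i * y $ i) ^ m i / fact (m i)) * (\<Prod>i\<in>UNIV. line_moment (k $ i) (m i)))
     = (\<Prod>i\<in>UNIV. (x $ i * y $ i) ^ m i / fact (m i) * ((if k $ i = 0 then 1 else c_const (k $ i - 1/2)) * line_moment (k $ i) (m i)))"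
    unfolding c_prod_def prod.distrib by (simp only: mult_ac)
  also have "\<dots> = (\<Prod>i\<in>UNIV. (x $ i * y $ i) ^ m i / dunkl_fact (k $ i) (m i))"
    unfolding line_moment_normalized[OF k] by (intro prod.cong refl) simp
  finally show "c_prod k * ((\<Prod>i\<in>UNIV. (x $ i * y $ i) ^ m i / fact (m i)) * (\<Prod>i\<in>UNIV. line_moment (k $ i) (m i)))
     = (\<Prod>i\<in>UNIV. (x $ i * y $ i) ^ m i / dunkl_fact (k $ i) (m i))" .
qed

text \<open>The radicand has to be nonnegative: the vector with entries \<open>y_i u_i\<close> is no
  longer than \<open>y\<close>, and Cauchy-Schwarz bounds the sum by \<open>t * s\<close> on the
  cone.\<close>

lemma rho_square:
  fixes x y :: "real ^ 'd"
  assumes xt: "(x, t) \<in> conic_surface" and ys: "(y, s) \<in> conic_surface" and u: "\<And>i. \<bar>u i\<bar> \<le> 1"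
  shows "(rho x t y s u)\<^sup>2 = (t * s + (\<Sum>i\<in>UNIV. x $ i * y $ i * u i)) / 2"
proof -
  define v where "v = (\<chi> i. y $ i * u i)"
  have "norm v \<le> norm y"
    unfolding norm_eq_sqrt_inner inner_vec_def v_def
  proof (rule real_sqrt_le_mono, rule sum_mono)
    fix i
    have "(u i)\<^sup>2 \<le> 1" using u[of i] by (simp add: abs_square_le_1)
    then have "(y $ i)\<^sup>2 * (u i)\<^sup>2 \<le> (y $ i)\<^sup>2 * 1" by (intro mult_left_mono) auto
    then show "(\<chi> i. y $ i * u i) $ i \<bullet> (\<chi> i. y $ i * u i) $ i \<le> y $ i \<bullet> y $ i"
      by (simp add: power2_eq_square mult_ac)
  qed
  then have "norm x * norm v \<le> t * s"
    using xt ys by (intro mult_mono) (auto simp: conic_surface_def)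
  moreover have "\<bar>x \<bullet> v\<bar> \<le> norm x * norm v" by (rule Cauchy_Schwarz_ineq2)
  moreover have "x \<bullet> v = (\<Sum>i\<in>UNIV. x $ i * y $ i * u i)" by (simp add: inner_vec_def v_def mult_ac)
  ultimately show ?thesis by (simp add: rho_def)
qed

text \<open>The inner integral is a polynomial in \<open>\<rho>^2\<close>, that is, in an affine
  function of \<open>u\<close>; the outer one is therefore a finite combination of moments.\<close>

lemma cube_integral:
  fixes k x y :: "real ^ 'd"
  assumes d: "CARD('d) \<ge> 2" and k: "\<And>i. k $ i \<ge> 0"
    and xt: "(x, t) \<in> conic_surface" and ys: "(y, s) \<in> conic_surface" and a: "alpha k > 0"
  shows "C_const k *
          (LINT u:cube|du_measure k.
             (LINT \<theta>:{0..pi}|lborel.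
                laguerre n (2 * alpha k) (t + s + 2 * rho x t y s u * cos \<theta>)
                * exp (- rho x t y s u * cos \<theta>)
                * bessel_j (alpha k - 1) (rho x t y s u * sin \<theta>)
                * (sin \<theta>) powr (2 * alpha k - 1))
             * Phi k u) = cone_kernel k n (x, t) (y, s)"
proof -
  define c where "c = 2 powr (1 - alpha k) * sqrt pi / Gamma (alpha k + 1/2)"
  define L where "L p = laguerre (n - p) (2 * alpha k + 2 * of_nat p) (t + s) / (2 ^ p * pochhammer (alpha k + 1/2) p)" for p
  define S where "S p = (\<Sum>l\<le>p. (t * s) ^ (p - l) / fact (p - l) * (\<Sum>m\<in>multi_indices l. (\<Prod>i\<in>UNIV. (x $ i * y $ i) ^ m i / fact (m i)) * (\<Prod>i\<in>UNIV. line_moment (k $ i) (m i))))" for p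
  define I where "I u = (LINT \<theta>:{0..pi}|lborel.
                laguerre n (2 * alpha k) (t + s + 2 * rho x t y s u * cos \<theta>)
                * exp (- rho x t y s u * cos \<theta>)
                * bessel_j (alpha k - 1) (rho x t y s u * sin \<theta>)
                * (sin \<theta>) powr (2 * alpha k - 1))" for u
  let ?e = "\<lambda>u p. (t * s + (\<Sum>i\<in>UNIV. (x $ i * y $ i) * u i)) ^ p / fact p"
  have "(LINT u:cube|du_measure k. I u * Phi k u)
    = (LINT u|du_measure k. c * (\<Sum>p\<le>n. L p * (indicator cube u *\<^sub>R (?e u p * Phi k u))))"
    unfolding set_lebesgue_integral_def
  proof (rule Bochner_Integration.integral_cong[OF refl])
    fix u :: "'d \<Rightarrow> real"
    show "indicator cube u *\<^sub>R (I u * Phi k u) = c * (\<Sum>p\<le>n. L p * (indicator cube u *\<^sub>R (?e u p * Phi k u)))"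
    proof (cases "u \<in> cube")
      case True
      then have u: "\<bar>u i\<bar> \<le> 1" for i by (auto simp: cube_def abs_le_iff)
      note r2 = rho_square[OF xt ys u]
      have "rho x t y s u \<ge> 0"
      proof -
        have "(t * s + (\<Sum>i\<in>UNIV. x $ i * y $ i * u i)) / 2 \<ge> 0" using zero_le_power2[of "rho x t y s u"] unfolding r2 .
        then show ?thesis by (simp add: rho_def)
      qed
      then have "I u = c * (\<Sum>p\<le>n. laguerre (n - p) (2 * alpha k + 2 * of_nat p) (t + s) * rho x t y s u ^ (2 * p) / (fact p * pochhammer (alpha k + 1/2) p))"
        unfolding I_def c_def by (rule theta_integral[OF a])
      also have "\<dots> = c * (\<Sum>p\<le>n. L p * (?e u p))"
        unfolding power_mult r2 L_def by (simp add: power_divide mult_ac)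
      finally show ?thesis using True by (simp add: sum_distrib_left sum_distrib_right mult_ac)
    qed simp
  qed
  also have "\<dots> = c * (\<Sum>p\<le>n. L p * S p)"
    unfolding S_def
    by (rule has_bochner_integral_integral_eq)
      (intro has_bochner_integral_sum has_bochner_integral_mult_right has_bochner_integral_cube_power k)
  finally have "C_const k * (LINT u:cube|du_measure k. I u * Phi k u) = C_const k * c * (\<Sum>p\<le>n. L p * S p)"
    by simp
  \<comment> \<open>\<open>C_const\<close> without \<open>c_prod\<close> is the reciprocal of the
    constant from \<open>theta_integral\<close>; the remaining \<open>c_prod\<close> normalizes the
    moments of \<open>u\<close>.\<close>
  also have "C_const k * c = c_prod k"
  proof -
    have "Gamma (alpha k + 1/2) > 0" using a by (intro Gamma_real_pos) auto
    moreover have "2 powr (alpha k - 1) * 2 powr (1 - alpha k) = (1 :: real)"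
      by (simp add: powr_add[symmetric])
    moreover have "C_const k * c = (2 powr (alpha k - 1) * 2 powr (1 - alpha k)) * (Gamma (alpha k + 1/2) / Gamma (alpha k + 1/2)) * (sqrt pi / sqrt pi) * c_prod k"
      unfolding C_const_def c_def by simp
    ultimately show ?thesis by simp
  qed
  also have "c_prod k * (\<Sum>p\<le>n. L p * S p) = (\<Sum>p\<le>n. L p * (\<Sum>l\<le>p. (t * s) ^ (p - l) / fact (p - l) * dunkl_power k x y l))"
    unfolding S_def cube_moment_dunkl_power[OF k, symmetric] sum_distrib_left by (simp only: mult_ac)
  also have "\<dots> = cone_kernel k n (x, t) (y, s)"
    by (simp add: cone_kernel_def L_def)
  finally show ?thesis unfolding I_def .
qed

lemma dunkl_power_0: "dunkl_power 0 x y l = (x \<bullet> y) ^ l / fact l"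
  by (simp add: dunkl_power_def dunkl_fact_0 inner_vec_def multinomial)

text \<open>At the apex \<open>dunkl_power\<close> vanishes unless \<open>l = 0\<close> and
  \<open>(t * 0) ^ (p - l)\<close> unless \<open>l = p\<close>, so only \<open>p = 0\<close> is
  left.\<close>

lemma cone_kernel_apex: "cone_kernel k n (x, t) (0, 0) = laguerre n (2 * alpha k) t"
proof -
  have D: "dunkl_power k x 0 l = (if l = 0 then 1 else 0)" for l
  proof (cases "l = 0")
    case True
    have "multi_indices 0 = {\<lambda>_ :: 'a. 0 :: nat}" by (auto simp: multi_indices_def)
    then show ?thesis using True by (simp add: dunkl_power_def dunkl_fact_def)
  next
    case False
    have "(\<Prod>i\<in>UNIV. (x $ i * (0 :: real ^ 'a) $ i) ^ m i / dunkl_fact (k $ i) (m i)) = 0" if "m \<in> multi_indices l" for m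
    proof -
      have "\<exists>i. m i \<noteq> 0"
      proof (rule ccontr)
        assume "\<not> (\<exists>i. m i \<noteq> 0)"
        then have "l = 0" using that by (simp add: multi_indices_def)
        with False show False ..
      qed
      then obtain i where "m i \<noteq> 0" ..
      then have "(x $ i * (0 :: real ^ 'a) $ i) ^ m i / dunkl_fact (k $ i) (m i) = 0" by simp
      then show ?thesis by (intro prod_zero) (auto simp del: divide_eq_0_iff)
    qed
    then have "dunkl_power k x 0 l = 0" unfolding dunkl_power_def by (rule sum.neutral[OF ballI])
    then show ?thesis using False by simp
  qed
  have "(\<Sum>l\<le>p. (t * 0) ^ (p - l) / fact (p - l) * dunkl_power k x 0 l) = (if p = 0 then 1 else 0)" for p
    by (cases p) (auto simp: D intro!: sum.neutral)
  then have "cone_kernel k n (x, t) (0, 0) = (\<Sum>p\<le>n. (if p = 0 then laguerre n (2 * alpha k) t else 0))"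
    unfolding cone_kernel_def by (intro sum.cong) auto
  then show ?thesis by simp
qed

lemma alpha_eq_0_iff:
  fixes k :: "real ^ 'd"
  assumes d: "CARD('d) \<ge> 2" and k: "\<And>i. k $ i \<ge> 0"
  shows "alpha k = 0 \<longleftrightarrow> CARD('d) = 2 \<and> k = 0"
proof
  assume a: "alpha k = 0"
  have 1: "abs_mult k \<ge> 0" using k unfolding abs_mult_def by (intro sum_nonneg) auto
  have 2: "real CARD('d) \<ge> 2" using d by simp
  have "real CARD('d) = 2" using a 1 2 unfolding alpha_def by argo
  moreover have "abs_mult k = 0" using a 1 2 unfolding alpha_def by argo
  ultimately have "CARD('d) = 2" "abs_mult k = 0" by simp_all
  then show "CARD('d) = 2 \<and> k = 0"
    using k by (simp add: abs_mult_def sum_nonneg_eq_0_iff vec_eq_iff)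
qed (auto simp: alpha_def abs_mult_def)

text \<open>For weight zero the Dunkl kernel is the exponential, and the binomial theorem
  reassembles the inner sum into a power of
  \<open>ts + \<langle>x, y\<rangle> = 2 \<rho>^2\<close>.\<close>

lemma cone_kernel_0:
  fixes x y :: "real ^ 'd"
  assumes d: "CARD('d) = 2" and xt: "(x, t) \<in> conic_surface" and ys: "(y, s) \<in> conic_surface"
  defines "\<rho> \<equiv> sqrt ((t * s + x \<bullet> y) / 2)"
  shows "cone_kernel 0 n (x, t) (y, s)
    = 1 / 2 * (exp (- \<rho>) * laguerre n 0 (t + s + 2 * \<rho>) + exp \<rho> * laguerre n 0 (t + s - 2 * \<rho>))
            - 1 / 2 * \<rho>\<^sup>2 *
              (LINT \<theta>:{0..pi}|lborel.
                 laguerre n 0 (t + s + 2 * \<rho> * cos \<theta>)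
                 * exp (- \<rho> * cos \<theta>)
                 * bessel_j 1 (\<rho> * sin \<theta>)
                 * sin \<theta>)"
proof -
  have \<rho>: "\<rho> = rho x t y s (\<lambda>_. 1)" by (simp add: \<rho>_def rho_def inner_vec_def)
  have r2: "\<rho>\<^sup>2 = (t * s + x \<bullet> y) / 2"
    unfolding \<rho> by (subst rho_square[OF xt ys]) (simp_all add: inner_vec_def)
  then have "(t * s + x \<bullet> y) / 2 \<ge> 0" by (metis zero_le_power2)
  then have \<rho>0: "\<rho> \<ge> 0" by (simp add: \<rho>_def)
  have a: "alpha (0 :: real ^ 'd) = 0" using d by (simp add: alpha_def abs_mult_def)
  have "cone_kernel 0 n (x, t) (y, s) = (\<Sum>k\<le>n. laguerre (n - k) (2 * of_nat k) (t + s) * \<rho> ^ (2 * k) / (fact k * pochhammer (1/2) k))"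
    unfolding cone_kernel_def dunkl_power_0 binomial_over_fact[symmetric] a power_mult r2 fst_conv snd_conv
    by (simp add: power_divide mult_ac)
  then show ?thesis unfolding theta_integral_0[OF \<rho>0] .
qed

theorem theorem3p7:
  fixes \<kappa> :: "real ^ 'd" and x y :: "real ^ 'd" and t s :: real and n :: nat
  assumes d: "CARD('d) \<ge> 2"
    and \<kappa>: "\<And>i. \<kappa> $ i \<ge> 0"
    and xt: "(x, t) \<in> conic_surface"
    and ys: "(y, s) \<in> conic_surface"
  shows
    "(alpha \<kappa> > 0 \<longrightarrow>
        kernel_P \<kappa> n (x, t) (y, s) =
          C_const \<kappa> *
          (LINT u:cube|du_measure \<kappa>.
             (LINT \<theta>:{0..pi}|lborel.
                laguerre n (2 * alpha \<kappa>) (t + s + 2 * rho x t y s u * cos \<theta>)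
                * exp (- rho x t y s u * cos \<theta>)
                * bessel_j (alpha \<kappa> - 1) (rho x t y s u * sin \<theta>)
                * (sin \<theta>) powr (2 * alpha \<kappa> - 1))
             * Phi \<kappa> u))
     \<and> (alpha \<kappa> = 0 \<longleftrightarrow> CARD('d) = 2 \<and> \<kappa> = 0)
     \<and> (alpha \<kappa> = 0 \<longrightarrow>
         (let \<rho> = sqrt ((t * s + x \<bullet> y) / 2) in
          kernel_P (0 :: real ^ 'd) n (x, t) (y, s) =
            1 / 2 * (exp (- \<rho>) * laguerre n 0 (t + s + 2 * \<rho>)
                     + exp \<rho> * laguerre n 0 (t + s - 2 * \<rho>))
            - 1 / 2 * \<rho>\<^sup>2 *
              (LINT \<theta>:{0..pi}|lborel.
                 laguerre n 0 (t + s + 2 * \<rho> * cos \<theta>)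
                 * exp (- \<rho> * cos \<theta>)
                 * bessel_j 1 (\<rho> * sin \<theta>)
                 * sin \<theta>)))
     \<and> kernel_P \<kappa> n (x, t) (0, 0) = laguerre n (2 * abs_mult \<kappa> + real CARD('d) - 2) t"
proof (intro conjI impI, goal_cases)
  case 1
  then show ?case by (simp only: kernel_P_eq[OF d \<kappa> xt ys] cube_integral[OF d \<kappa> xt ys])
next
  case 2
  show ?case by (rule alpha_eq_0_iff[OF d \<kappa>])
next
  case 3
  then have d2: "CARD('d) = 2" using alpha_eq_0_iff[OF d \<kappa>] by blast
  have K: "kernel_P (0 :: real ^ 'd) n (x, t) (y, s) = cone_kernel 0 n (x, t) (y, s)"
    by (rule kernel_P_eq[OF d _ xt ys]) simp
  show ?case unfolding Let_def K by (rule cone_kernel_0[OF d2 xt ys])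
next
  case 4
  have apex: "(0, 0) \<in> (conic_surface :: ((real ^ 'd) \<times> real) set)" by (simp add: conic_surface_def)
  have "2 * alpha \<kappa> = 2 * abs_mult \<kappa> + real CARD('d) - 2" by (simp add: alpha_def field_simps)
  then show ?case
    unfolding kernel_P_eq[OF d \<kappa> xt apex] cone_kernel_apex by (simp only:)
qed

end
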